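(* Let $F\in\mathrm{End}(\mathbb{C}^2,O)$ be such that $dF_O$ is non-diagonalizable and $\mathrm{sp}(dF_O)=\{1\}$. Assume that $dF_O$ is in Jordan canonical form, and that the coefficient $a_{11}^2$ of $(z_1)^2$ in the second component of $F$ vanishes, so that $F=(f_1,f_2)$ with $$f_1(z)=z_1+z_2+a_{11}^1(z_1)^2+2a_{12}^1z_1z_2+a_{22}^1(z_2)^2+\cdots,$$ $$f_2(z)=z_2+2a_{12}^2z_1z_2+a_{22}^2(z_2)^2+a_{111}^2(z_1)^3+\cdots,$$ where $a_{111}^2$ is the coefficient of $(z_1)^3$ in $f_2$. Set $$\varepsilon=a_{11}^1+a_{12}^2,\qquad \eta=(a_{11}^1-a_{12}^2)^2+2a_{111}^2,$$ and assume that $(\varepsilon,\eta)\neq(0,0)$. Then: (i) if $\eta\neq0$ and $\eta\neq\varepsilon^2$, then $F$ admits two distinct parabolic curves at the origin; (ii) if $\eta=\varepsilon^2\neq0$, or $\eta=0\neq\varepsilon^2$, then $F$ admits one parabolic curve at the origin. In both cases, the parabolic curves are tangent to $e_1$. Furthermore, if $z^o$ belongs to the image of one of the curves and $z^k=F^k(z^o)$, then $z^k_1=c_1/k+o(1/k)$ and $z^k_2=c_2/k^2+o(1/k^2)$ for suitable $c_1\neq0$ and $c_2\in\mathbb{C}$.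
   Context: $\mathrm{End}(\mathbb{C}^2,O)$ is the set of germs at the origin $O$ of holomorphic self-maps of $\mathbb{C}^2$ fixing $O$; $\mathrm{sp}$ denotes the spectrum; $e_1=(1,0)$; $F^k$ is the $k$-th iterate. Let $\Delta=\{\zeta\in\mathbb{C}: |\zeta-1|<1\}$. A holomorphic curve at the origin is a holomorphic injective map $\varphi\colon\Delta\to\mathbb{C}^2\setminus\{O\}$ that extends continuously to $0\in\partial\Delta$ with $\varphi(0)=O$. It is $F$-invariant if $F(\varphi(\Delta))\subseteq\varphi(\Delta)$; it is stable if it is $F$-invariant and, with $D=\varphi(\Delta)$, $(F|_D)^k\to O$ uniformly on compact subsets of $D$. A parabolic curve for $F$ is a stable holomorphic curve at the origin. It is tangent to $v\in\mathbb{C}^2\setminus\{O\}$ if $[\varphi(\zeta)]\to[v]$ in $\mathbb{P}^{1}(\mathbb{C})$ as $\zeta\to0$. In (ii), "one parabolic curve" is an existence assertion; "the parabolic curves" in the final statements are those whose existence is asserted in (i) and (ii). *)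

theory Defs
  imports
    "HOL-Complex_Analysis.Complex_Analysis"
    "HOL-Library.Landau_Symbols"
    "Jordan_Normal_Form.Spectral_Radius"
begin

section \<open>Germs of holomorphic self-maps of \<open>\<complex>\<^sup>2\<close> at the origin\<close>

text \<open>
  \<open>\<complex>\<^sup>2\<close> is the type \<open>complex \<times> complex\<close>, and the origin \<open>O\<close> is \<open>0 = (0, 0)\<close>.
  Holomorphy in two variables is complex Frechet differentiability on an open set.
\<close>

definition holomorphic2_on :: "(complex \<times> complex \<Rightarrow> complex) \<Rightarrow> (complex \<times> complex) set \<Rightarrow> bool" where
  "holomorphic2_on f U \<longleftrightarrow>
     open U \<and> (\<forall>z\<in>U. \<exists>a b. (f has_derivative (\<lambda>h. a * fst h + b * snd h)) (at z))"

text \<open>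
  An element of \<open>End(\<complex>\<^sup>2, O)\<close> is given by a representative: a function \<open>F\<close> that is considered only on
  the open neighbourhood \<open>U\<close> of the origin. The values of \<open>F\<close> outside \<open>U\<close> are junk.
\<close>

definition End_germ :: "(complex \<times> complex) set \<Rightarrow> (complex \<times> complex \<Rightarrow> complex \<times> complex) \<Rightarrow> bool" where
  "End_germ U F \<longleftrightarrow>
     open U \<and> 0 \<in> U \<and> F 0 = 0 \<and> holomorphic2_on (fst \<circ> F) U \<and> holomorphic2_on (snd \<circ> F) U"

text \<open>The coefficient of \<open>z\<^sub>1\<^sup>i z\<^sub>2\<^sup>j\<close> in the Taylor expansion of \<open>f\<close> at the origin.\<close>

definition taylor_coeff :: "(complex \<times> complex \<Rightarrow> complex) \<Rightarrow> nat \<Rightarrow> nat \<Rightarrow> complex" where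
  "taylor_coeff f i j =
     (deriv ^^ i) (\<lambda>x. (deriv ^^ j) (\<lambda>y. f (x, y)) 0) 0 / (fact i * fact j)"

text \<open>The matrix of \<open>dF\<^sub>O\<close> in the standard basis.\<close>

definition dF_mat :: "(complex \<times> complex \<Rightarrow> complex \<times> complex) \<Rightarrow> complex mat" where
  "dF_mat F = (let dF = frechet_derivative F (at 0) in
     mat_of_rows_list 2
       [[fst (dF (1, 0)), fst (dF (0, 1))],
        [snd (dF (1, 0)), snd (dF (0, 1))]])"

definition diagonalizable_mat :: "complex mat \<Rightarrow> bool" where
  "diagonalizable_mat A \<longleftrightarrow> (\<exists>D. diagonal_mat D \<and> similar_mat A D)"

text \<open>
  In contrast to \<^const>\<open>jordan_nf\<close>, the matrix itself, and not only a conjugate of it, is required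
  to be block diagonal with Jordan blocks. The ones of a Jordan block are above the diagonal.
\<close>

definition in_jordan_form :: "complex mat \<Rightarrow> bool" where
  "in_jordan_form A \<longleftrightarrow> (\<exists>n_as. 0 \<notin> fst ` set n_as \<and> A = jordan_matrix n_as)"


section \<open>The projective line\<close>

definition proj_pt :: "complex \<times> complex \<Rightarrow> (complex \<times> complex) set" where
  "proj_pt v = {(c * fst v, c * snd v) |c. c \<noteq> 0}"

text \<open>\<open>\<bbbP>\<^sup>1(\<complex>)\<close> with the quotient topology coming from \<open>\<complex>\<^sup>2 - {O}\<close>.\<close>

definition P1_topology :: "(complex \<times> complex) set topology" where
  "P1_topology = topology (\<lambda>S. S \<subseteq> proj_pt ` (- {0}) \<and> open {v \<in> - {0}. proj_pt v \<in> S})"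

lemma openin_P1_topology:
  "openin P1_topology S \<longleftrightarrow> S \<subseteq> proj_pt ` (- {0}) \<and> open {v \<in> - {0}. proj_pt v \<in> S}"
proof -
  have "istopology (\<lambda>S. S \<subseteq> proj_pt ` (- {0}) \<and> open {v \<in> - {0}. proj_pt v \<in> S})"
    unfolding istopology_def
  proof (intro conjI allI impI)
    fix S T
    assume S: "S \<subseteq> proj_pt ` (- {0}) \<and> open {v \<in> - {0}. proj_pt v \<in> S}"
      and T: "T \<subseteq> proj_pt ` (- {0}) \<and> open {v \<in> - {0}. proj_pt v \<in> T}"
    show "S \<inter> T \<subseteq> proj_pt ` (- {0})" using S by blast
    have "{v \<in> - {0}. proj_pt v \<in> S \<inter> T} = {v \<in> - {0}. proj_pt v \<in> S} \<inter> {v \<in> - {0}. proj_pt v \<in> T}"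
      by blast
    then show "open {v \<in> - {0}. proj_pt v \<in> S \<inter> T}" using S T by (simp add: open_Int)
  next
    fix K
    assume K: "\<forall>S\<in>K. S \<subseteq> proj_pt ` (- {0}) \<and> open {v \<in> - {0}. proj_pt v \<in> S}"
    show "\<Union> K \<subseteq> proj_pt ` (- {0})" using K by blast
    have "{v \<in> - {0}. proj_pt v \<in> \<Union> K} = (\<Union>S\<in>K. {v \<in> - {0}. proj_pt v \<in> S})"
      by blast
    then show "open {v \<in> - {0}. proj_pt v \<in> \<Union> K}" using K by (simp add: open_UN)
  qed
  then show ?thesis
    by (simp add: P1_topology_def topology_inverse')
qed

lemma topspace_P1_topology: "topspace P1_topology = proj_pt ` (- {0})"
proof
  show "topspace P1_topology \<subseteq> proj_pt ` (- {0})"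
    using openin_topspace[of P1_topology] unfolding openin_P1_topology by blast
  have "{v \<in> - {0}. proj_pt v \<in> proj_pt ` (- {0})} = - {0}" by blast
  then have "openin P1_topology (proj_pt ` (- {0}))"
    unfolding openin_P1_topology by (simp add: open_Compl)
  then show "proj_pt ` (- {0}) \<subseteq> topspace P1_topology" by (rule openin_subset)
qed

lemma quotient_map_proj_pt: "quotient_map (top_of_set (- {0})) P1_topology proj_pt"
  unfolding quotient_map_def
proof (intro conjI allI impI)
  show "proj_pt ` topspace (top_of_set (- {0})) = topspace P1_topology"
    by (simp add: topspace_P1_topology)
next
  fix S
  assume "S \<subseteq> topspace P1_topology"
  then show "openin (top_of_set (- {0})) {x \<in> topspace (top_of_set (- {0})). proj_pt x \<in> S} =
      openin P1_topology S"
    by (simp add: openin_P1_topology topspace_P1_topology openin_open_eq open_Compl)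
qed


section \<open>Parabolic curves\<close>

abbreviation curve_dom :: "complex set"  (\<open>\<Delta>\<close>) where
  "\<Delta> \<equiv> ball 1 1"

text \<open>Only the values of \<open>\<phi>\<close> on \<open>\<Delta>\<close> matter; in particular \<open>\<phi> 0\<close> is not used, the last condition
  says that the extension of \<open>\<phi>\<close> by \<open>0 \<mapsto> O\<close> is continuous.\<close>

definition holomorphic_curve :: "(complex \<Rightarrow> complex \<times> complex) \<Rightarrow> bool" where
  "holomorphic_curve \<phi> \<longleftrightarrow>
     (fst \<circ> \<phi>) holomorphic_on \<Delta> \<and> (snd \<circ> \<phi>) holomorphic_on \<Delta> \<and> inj_on \<phi> \<Delta> \<and>
     \<phi> ` \<Delta> \<subseteq> - {0} \<and> (\<phi> \<longlongrightarrow> 0) (at 0 within \<Delta>)"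

text \<open>The inclusion in \<open>U\<close> expresses that the representative of the germ is defined on the curve.\<close>

definition invariant_curve ::
  "(complex \<times> complex) set \<Rightarrow> (complex \<times> complex \<Rightarrow> complex \<times> complex) \<Rightarrow>
   (complex \<Rightarrow> complex \<times> complex) \<Rightarrow> bool" where
  "invariant_curve U F \<phi> \<longleftrightarrow> \<phi> ` \<Delta> \<subseteq> U \<and> F ` (\<phi> ` \<Delta>) \<subseteq> \<phi> ` \<Delta>"

definition stable_curve ::
  "(complex \<times> complex) set \<Rightarrow> (complex \<times> complex \<Rightarrow> complex \<times> complex) \<Rightarrow>
   (complex \<Rightarrow> complex \<times> complex) \<Rightarrow> bool" where
  "stable_curve U F \<phi> \<longleftrightarrow> invariant_curve U F \<phi> \<and>
     (\<forall>K. compact K \<and> K \<subseteq> \<phi> ` \<Delta> \<longrightarrow> uniform_limit K (\<lambda>k. F ^^ k) (\<lambda>_. 0) sequentially)"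

definition parabolic_curve ::
  "(complex \<times> complex) set \<Rightarrow> (complex \<times> complex \<Rightarrow> complex \<times> complex) \<Rightarrow>
   (complex \<Rightarrow> complex \<times> complex) \<Rightarrow> bool" where
  "parabolic_curve U F \<phi> \<longleftrightarrow> holomorphic_curve \<phi> \<and> stable_curve U F \<phi>"

definition tangent_to :: "(complex \<Rightarrow> complex \<times> complex) \<Rightarrow> complex \<times> complex \<Rightarrow> bool" where
  "tangent_to \<phi> v \<longleftrightarrow> limitin P1_topology (\<lambda>\<zeta>. proj_pt (\<phi> \<zeta>)) (proj_pt v) (at 0 within \<Delta>)"

text \<open>
  A parabolic curve can be reparametrised, and restricted to a smaller invariant domain, so that
  neither \<open>\<phi> \<noteq> \<psi>\<close> nor \<open>\<phi> ` \<Delta> \<noteq> \<psi> ` \<Delta>\<close> would express that two curves are really distinct: they are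
  if not even a piece of curve ending at the origin is common to them. For holomorphic curves
  this implies \<open>\<phi> ` \<Delta> \<noteq> \<psi> ` \<Delta>\<close>, as otherwise \<open>\<phi>\<close> itself would be common to them.
\<close>

definition distinct_curves ::
  "(complex \<Rightarrow> complex \<times> complex) \<Rightarrow> (complex \<Rightarrow> complex \<times> complex) \<Rightarrow> bool" where
  "distinct_curves \<phi> \<psi> \<longleftrightarrow>
     \<not> (\<exists>\<gamma>. holomorphic_curve \<gamma> \<and> \<gamma> ` \<Delta> \<subseteq> \<phi> ` \<Delta> \<inter> \<psi> ` \<Delta>)"

end

theory Submission
  imports Defs
begin

text \<open>
  The curves are parametrised by the variable in which \<open>F\<close> acts as the translation by \<open>1\<close>: on a half
  plane \<open>Re w > R\<close>, holomorphic \<open>z1\<close>, \<open>z2\<close> tending to \<open>0\<close> at infinity are constructed such that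
  \<open>F (z1 w, z2 w) = (z1 (w + 1), z2 (w + 1))\<close>. As \<open>\<zeta> \<mapsto> 2 R / \<zeta>\<close> maps \<open>\<Delta>\<close> onto the half plane,
  \<open>\<zeta> \<mapsto> (z1 (2 R / \<zeta>), z2 (2 R / \<zeta>))\<close> is then a parabolic curve, and the asymptotics of the orbits
  are those of \<open>z1\<close> and \<open>z2\<close> at infinity, since the \<open>k\<close>-th iterate of the point at \<open>w\<close> is the point at
  \<open>w + k\<close> (\<open>parabolic_curve_of_solution\<close>).

  Give \<open>z\<^sub>1\<close> the weight \<open>1\<close> and \<open>z\<^sub>2\<close> the weight \<open>2\<close>, and write \<open>a\<close>, \<open>b\<close>, \<open>c\<close> for the coefficients
  \<open>a11_1\<close>, \<open>a12_2\<close>, \<open>a111_2\<close>. In the lowest order the equation is solved by \<open>z1 = \<kappa> / w\<close>, \<open>\<kappa> \<noteq> 0\<close>, and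
  \<open>z2 = t \<kappa>\<^sup>2 / w\<^sup>2\<close> if and only if \<open>(a + t) \<kappa> = -1\<close> and \<open>2 b t + c = 2 t (a + t)\<close>. The solutions of the
  quadratic equation are \<open>t = (b - a + \<sigma>) / 2\<close> with \<open>\<sigma>\<^sup>2 = \<eta>\<close>, and then \<open>a + t = (\<epsilon> + \<sigma>) / 2\<close>. So each
  square root \<open>\<sigma>\<close> of \<open>\<eta>\<close> with \<open>\<epsilon> + \<sigma> \<noteq> 0\<close> gives a curve (\<open>germ_parabolic_curve\<close>): under the
  hypothesis of (i) these are two, under that of (ii) there is one. On the curve belonging to \<open>t\<close> the
  quotient \<open>z\<^sub>2 / z\<^sub>1\<^sup>2\<close> tends to \<open>t\<close> at the origin, which separates curves with different \<open>t\<close>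
  (\<open>distinct_curves_of_slopes\<close>).

  For a given \<open>t\<close>, an approximate solution is first computed to any order among the polynomials in
  \<open>1 / w\<close> and \<open>log w\<close> (\<open>approx_solution_exists\<close>). The terms of one order are a pair of polynomials in
  \<open>log w\<close> subject to a linear system of differential equations with constant coefficients, and such a
  system always has a polynomial solution (\<open>poly_linear_system\<close>): the logarithms absorb all resonances.
  An exact solution is then found near an approximate one of high order (\<open>shadowing\<close>). The correction
  \<open>u\<close> satisfies an equation \<open>u (w + 1) - u w = E w (u w)\<close>, that is, \<open>u w = - (\<Sum>k. E (w + k) (u (w + k)))\<close>.
  Among the \<open>u\<close> of size \<open>1 / w^m\<close> the summation gains a factor \<open>1 / m\<close>, while the Lipschitz constant of
  \<open>E\<close> does not depend on \<open>m\<close>. For large \<open>m\<close> the right-hand side is a contraction, whatever the sign of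
  the real parts of the exponents of the linearised equation.
\<close>

section \<open>Taylor expansions in two variables\<close>

lemma holomorphic_uniform_limit_open:
  fixes g :: "nat \<Rightarrow> complex \<Rightarrow> complex"
  assumes S: "open S" and "\<And>n. g n holomorphic_on S" and lim: "uniform_limit S g h sequentially"
  shows "h holomorphic_on S"
proof (rule holomorphic_uniform_sequence[of S g])
  fix x assume "x \<in> S"
  then obtain d where "d > 0" "cball x d \<subseteq> S" using S open_contains_cball by blast
  with lim show "\<exists>d. 0 < d \<and> cball x d \<subseteq> S \<and> uniform_limit (cball x d) g h sequentially"
    using uniform_limit_on_subset by blast
qed (use assms in auto)

lemma taylor_remainder_bound:
  fixes g :: "complex \<Rightarrow> complex"
  assumes hol: "g holomorphic_on ball 0 r" and bd: "\<And>w. w \<in> ball 0 r \<Longrightarrow> norm (g w) \<le> M"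
    and r: "r > 0"
  shows "norm ((deriv ^^ n) g 0 / fact n) \<le> M * (2/r)^n"
    and "norm y \<le> r/4 \<Longrightarrow>
      norm (g y - (\<Sum>j<n. (deriv ^^ j) g 0 / fact j * y^j)) \<le> 2 * M * (2/r * norm y)^n"
proof -
  have cau: "norm ((deriv ^^ n) g 0 / fact n) \<le> M * (2/r)^n" for n
  proof -
    have "norm ((deriv ^^ n) g 0) \<le> fact n * M / (r/2)^n"
    proof (rule Cauchy_inequality)
      show "g holomorphic_on ball 0 (r/2)" using hol r by (auto intro: holomorphic_on_subset)
      have "g holomorphic_on cball 0 (r/2)" using r by (intro holomorphic_on_subset[OF hol]) auto
      then show "continuous_on (cball 0 (r/2)) g" by (rule holomorphic_on_imp_continuous_on)
      show "norm (g x) \<le> M" if "norm (0 - x) = r/2" for x using that r by (intro bd) auto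
    qed (use r in auto)
    then show ?thesis by (simp add: norm_divide field_simps power_divide)
  qed
  show "norm ((deriv ^^ n) g 0 / fact n) \<le> M * (2/r)^n" by (rule cau)
  assume y: "norm y \<le> r/4"
  define q where "q = 2/r * norm y"
  have q: "0 \<le> q" "q \<le> 1/2" using y r by (auto simp: q_def field_simps)
  have M: "0 \<le> M" using bd[of 0] r by (meson centre_in_ball norm_ge_zero order_trans)
  define c where "c j = (deriv ^^ j) g 0 / fact j * y^j" for j
  have cj: "norm (c j) \<le> M * q^j" for j
  proof -
    have "norm (c j) = norm ((deriv ^^ j) g 0 / fact j) * norm y ^ j"
      unfolding c_def norm_mult norm_power ..
    also have "\<dots> \<le> M * (2/r)^j * norm y ^ j"
      by (rule mult_right_mono[OF cau]) simp
    also have "\<dots> = M * q^j"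
      unfolding q_def power_mult_distrib by (simp only: mult.assoc)
    finally show ?thesis .
  qed
  have "y \<in> ball 0 r" using y r by auto
  from holomorphic_power_series[OF hol this] have "c sums g y" by (simp add: c_def[abs_def])
  then have s: "(\<lambda>i. c (i + n)) sums (g y - (\<Sum>j<n. c j))" by (rule sums_split_initial_segment)
  have gs: "(\<lambda>i. M * q^n * q^i) sums (M * q^n * (1/(1-q)))"
    using geometric_sums[of q] q by (intro sums_mult) auto
  have ci: "norm (c (i + n)) \<le> M * q^n * q^i" for i
    using cj[of "i+n"] by (simp add: power_add mult_ac)
  have "norm (suminf (\<lambda>i. c (i + n))) \<le> suminf (\<lambda>i. M * q^n * q^i)"
    using ci gs by (intro norm_suminf_le) (auto simp: sums_iff)
  then have "norm (g y - (\<Sum>j<n. c j)) \<le> M * q^n * (1/(1-q))"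
    using s gs by (simp add: sums_iff)
  also have "\<dots> \<le> M * q^n * 2"
    using q M by (intro mult_left_mono) (auto simp: field_simps)
  finally show "norm (g y - (\<Sum>j<n. (deriv ^^ j) g 0 / fact j * y^j)) \<le> 2 * M * (2/r * norm y)^n"
    by (simp add: c_def q_def mult_ac)
qed

text \<open>
  The Taylor expansion in two variables is obtained by expanding first in \<open>y\<close> and then in \<open>x\<close>. This
  only uses holomorphy in each variable and a bound on the bidisc.
\<close>

definition sep_holomorphic :: "(complex \<times> complex \<Rightarrow> complex) \<Rightarrow> real \<Rightarrow> real \<Rightarrow> bool" where
  "sep_holomorphic f r M \<longleftrightarrow> r > 0 \<and>
     (\<forall>y\<in>ball 0 r. (\<lambda>x. f (x, y)) holomorphic_on ball 0 r) \<and>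
     (\<forall>x\<in>ball 0 r. (\<lambda>y. f (x, y)) holomorphic_on ball 0 r) \<and>
     (\<forall>x\<in>ball 0 r. \<forall>y\<in>ball 0 r. norm (f (x, y)) \<le> M)"

lemma sep_holomorphicD:
  assumes "sep_holomorphic f r M"
  shows "r > 0" "norm y < r \<Longrightarrow> (\<lambda>x. f (x, y)) holomorphic_on ball 0 r"
    "norm x < r \<Longrightarrow> (\<lambda>y. f (x, y)) holomorphic_on ball 0 r"
    "norm x < r \<Longrightarrow> norm y < r \<Longrightarrow> norm (f (x, y)) \<le> M"
  using assms by (auto simp: sep_holomorphic_def)

definition ycoeff :: "(complex \<times> complex \<Rightarrow> complex) \<Rightarrow> nat \<Rightarrow> complex \<Rightarrow> complex" where
  "ycoeff f j x = (deriv ^^ j) (\<lambda>y. f (x, y)) 0 / fact j"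

lemma higher_deriv_divide_fact:
  fixes g :: "complex \<Rightarrow> complex"
  assumes "g holomorphic_on ball 0 r" "r > 0"
  shows "(deriv ^^ n) (\<lambda>x. g x / c) 0 = (deriv ^^ n) g 0 / c"
  using higher_deriv_cmult[OF assms(1), of 0 n "1/c"] assms(2) by simp

text \<open>
  The \<open>j\<close>-th coefficient is the uniform limit, for \<open>h \<rightarrow> 0\<close>, of the quotients
  \<open>(f (x, h) - (\<Sum>i<j. ycoeff f i x * h\<^sup>i)) / h\<^sup>j\<close>. These are holomorphic in \<open>x\<close> if the preceding
  coefficients are.
\<close>

lemma ycoeff_holomorphic:
  assumes f: "sep_holomorphic f r M"
  shows "ycoeff f j holomorphic_on ball 0 r"
proof (induction j rule: less_induct)
  case (less j)
  note r = sep_holomorphicD(1)[OF f]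
  \<comment> \<open>Points tending to \<open>0\<close> within the disc on which \<open>taylor_remainder_bound\<close> holds.\<close>
  define h where "h k = complex_of_real (r / (4 * (of_nat k + 1)))" for k :: nat
  have nh: "norm (h k) = r / (4 * (real k + 1))" for k
    using r by (simp add: h_def norm_divide del: of_real_divide)
  have h0: "h k \<noteq> 0" for k
  proof -
    have "norm (h k) > 0" unfolding nh using r by simp
    then show ?thesis by auto
  qed
  have h4: "norm (h k) \<le> r / 4" for k using r unfolding nh by (simp add: field_simps)
  define G where "G k x = (f (x, h k) - (\<Sum>i<j. ycoeff f i x * h k ^ i)) / h k ^ j" for k x
  have hol: "G k holomorphic_on ball 0 r" for k
    unfolding G_def using h0[of k] h4[of k] r
    by (intro holomorphic_intros less.IH sep_holomorphicD(2)[OF f]) auto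
  have bound: "norm (G k x - ycoeff f j x) \<le> 2 * M * (2/r)^Suc j * norm (h k)"
    if "x \<in> ball 0 r" for k x
  proof -
    have "norm (f (x, h k) - (\<Sum>i<Suc j. ycoeff f i x * h k ^ i)) \<le> 2 * M * (2/r * norm (h k))^Suc j"
      using taylor_remainder_bound(2)[of "\<lambda>y. f (x, y)" r M "h k" "Suc j"] sep_holomorphicD[OF f] that h4 
      by (auto simp: ycoeff_def)
    moreover have "f (x, h k) - (\<Sum>i<Suc j. ycoeff f i x * h k ^ i) = (G k x - ycoeff f j x) * h k ^ j"
      using h0[of k] by (simp add: G_def field_simps)
    ultimately have "norm (G k x - ycoeff f j x) * norm (h k) ^ j \<le> 2 * M * (2/r * norm (h k))^Suc j"
      by (simp only: norm_mult norm_power)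
    also have "\<dots> = (2 * M * (2/r)^Suc j * norm (h k)) * norm (h k) ^ j"
      unfolding power_mult_distrib by (simp only: power_Suc mult_ac)
    finally have "norm (G k x - ycoeff f j x) * norm (h k) ^ j \<le> \<dots>" .
    then show ?thesis by (rule mult_right_le_imp_le) (use h0[of k] in simp)
  qed
  have lim: "uniform_limit (ball 0 r) G (ycoeff f j) sequentially"
  proof (rule uniform_limitI)
    fix e :: real assume e: "e > 0"
    have "(\<lambda>k. 2 * M * (2/r)^Suc j * (r / (4 * (real k + 1)))) \<longlonglongrightarrow> 0" by real_asymp
    then have "\<forall>\<^sub>F k in sequentially. 2 * M * (2/r)^Suc j * (r / (4 * (real k + 1))) < e"
      by (rule order_tendstoD) (use e in auto)
    then show "\<forall>\<^sub>F k in sequentially. \<forall>x\<in>ball 0 r. dist (G k x) (ycoeff f j x) < e"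
    proof eventually_elim
      case (elim k)
      show ?case
      proof
        fix x :: complex assume x: "x \<in> ball 0 r"
        show "dist (G k x) (ycoeff f j x) < e"
          using bound[OF x, of k] elim unfolding dist_norm nh by linarith
      qed
    qed
  qed
  show ?case by (rule holomorphic_uniform_limit_open[OF open_ball hol lim])
qed

lemma taylor_coeff_eq:
  assumes f: "sep_holomorphic f r M"
  shows "taylor_coeff f i j = (deriv ^^ i) (ycoeff f j) 0 / fact i"
proof -
  note r = sep_holomorphicD(1)[OF f]
  have "(\<lambda>x. (deriv ^^ j) (\<lambda>y. f (x, y)) 0) holomorphic_on ball 0 r"
    using holomorphic_on_mult[OF ycoeff_holomorphic[OF f, of j] holomorphic_on_const[of "fact j"]]
    by (simp add: ycoeff_def[abs_def])
  from higher_deriv_divide_fact[OF this r, of i "fact j"] show ?thesis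
    by (simp add: taylor_coeff_def ycoeff_def[abs_def])
qed

text \<open>
  The number \<open>N j\<close> of terms kept in the coefficient of \<open>y\<^sup>j\<close> is arbitrary, so that the expansion can be
  cut off by total degree as well as by a weighted degree.
\<close>

lemma bivariate_taylor:
  assumes f: "sep_holomorphic f r M" and xy: "norm x \<le> r/4" "norm y \<le> r/4"
  shows "norm (f (x, y) - (\<Sum>j<n. \<Sum>i<N j. taylor_coeff f i j * x^i * y^j))
     \<le> 2 * M * ((2/r * norm y)^n + (\<Sum>j<n. (2/r * norm x)^N j * (2/r * norm y)^j))"
proof -
  note D = sep_holomorphicD[OF f]
  have yc: "norm (ycoeff f j x' ) \<le> M * (2/r)^j" if "norm x' < r" for j x'
    using taylor_remainder_bound(1)[of "\<lambda>y. f (x', y)" r M j] D that by (auto simp: ycoeff_def)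
  have xx: "norm x < r" using xy D(1) by auto
  have A: "norm (f (x, y) - (\<Sum>j<n. ycoeff f j x * y^j)) \<le> 2 * M * (2/r * norm y)^n"
    using taylor_remainder_bound(2)[of "\<lambda>y. f (x, y)" r M y n] D xy xx by (auto simp: ycoeff_def)
  have B: "norm (ycoeff f j x - (\<Sum>i<N j. taylor_coeff f i j * x^i)) \<le> 2 * (M * (2/r)^j) * (2/r * norm x)^N j" for j
    unfolding taylor_coeff_eq[OF f]
    by (rule taylor_remainder_bound(2)) (use ycoeff_holomorphic[OF f] yc D xy in auto)
  have "f (x, y) - (\<Sum>j<n. \<Sum>i<N j. taylor_coeff f i j * x^i * y^j)
     = (f (x, y) - (\<Sum>j<n. ycoeff f j x * y^j)) + (\<Sum>j<n. (ycoeff f j x - (\<Sum>i<N j. taylor_coeff f i j * x^i)) * y^j)"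
    by (simp add: sum_subtractf left_diff_distrib sum_distrib_right)
  also have "norm \<dots> \<le> 2 * M * (2/r * norm y)^n + (\<Sum>j<n. 2 * (M * (2/r)^j) * (2/r * norm x)^N j * norm y^j)"
    using A B by (intro order.trans[OF norm_triangle_ineq] add_mono order.trans[OF norm_sum] sum_mono)
      (auto simp: norm_mult norm_power intro!: mult_right_mono)
  also have "\<dots> = 2 * M * ((2/r * norm y)^n + (\<Sum>j<n. (2/r * norm x)^N j * (2/r * norm y)^j))"
    unfolding power_mult_distrib distrib_left sum_distrib_left by (simp only: mult_ac)
  finally show ?thesis .
qed

lemma lipschitz_from_bound:
  fixes g :: "complex \<Rightarrow> complex"
  assumes hol: "g holomorphic_on ball 0 (2 * s)" and bd: "\<And>w. norm w < 2 * s \<Longrightarrow> norm (g w) \<le> B"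
    and s: "s > 0" and uv: "norm u \<le> s" "norm v \<le> s"
  shows "norm (g u - g v) \<le> 2 * B / s * norm (u - v)"
proof (rule field_differentiable_bound[of "cball 0 s" g "deriv g"])
  fix z :: complex assume z: "z \<in> cball 0 s"
  then have z': "z \<in> ball 0 (2 * s)" using s by auto
  then have "(g has_field_derivative deriv g z) (at z)"
    using hol by (intro holomorphic_derivI[of _ "ball 0 (2 * s)"]) auto
  then show "(g has_field_derivative deriv g z) (at z within cball 0 s)"
    by (rule has_field_derivative_at_within)
  have sub: "cball z (s/2) \<subseteq> ball 0 (2 * s)"
  proof
    fix w assume "w \<in> cball z (s/2)"
    then have "norm (w - z) \<le> s/2" by (simp add: dist_norm norm_minus_commute)
    then show "w \<in> ball 0 (2 * s)" using z s norm_triangle_ineq[of "w - z" z] by simp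
  qed
  have "norm ((deriv ^^ 1) g z) \<le> fact 1 * B / (s/2)^1"
  proof (rule Cauchy_inequality)
    have h: "g holomorphic_on cball z (s/2)" using hol sub by (rule holomorphic_on_subset)
    then show "g holomorphic_on ball z (s/2)" by (rule holomorphic_on_subset) auto
    show "continuous_on (cball z (s/2)) g" using h by (rule holomorphic_on_imp_continuous_on)
    show "norm (g x) \<le> B" if "norm (z - x) = s/2" for x
      using that sub by (intro bd) (auto simp: dist_norm subset_iff)
  qed (use s in auto)
  then show "norm (deriv g z) \<le> 2 * B / s" by (simp add: mult.commute)
qed (use uv in auto)

text \<open>
  The Lipschitz estimate that a function of weighted order \<open>d + 2\<close> satisfies on
  \<open>\<bar>x\<bar> \<le> \<mu>\<close>, \<open>\<bar>y\<bar> \<le> \<mu>\<^sup>2\<close>: differentiating in \<open>x\<close> costs one power of \<open>\<mu>\<close>, differentiating in \<open>y\<close>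
  costs two.
\<close>

definition weighted_lipschitz :: "real \<Rightarrow> nat \<Rightarrow> real \<Rightarrow> (complex \<times> complex \<Rightarrow> complex) \<Rightarrow> bool" where
  "weighted_lipschitz \<mu>0 d C h \<longleftrightarrow> (\<forall>\<mu> x x' y y'. 0 < \<mu> \<and> \<mu> \<le> \<mu>0 \<and>
     norm x \<le> \<mu> \<and> norm x' \<le> \<mu> \<and> norm y \<le> \<mu>^2 \<and> norm y' \<le> \<mu>^2 \<longrightarrow>
     norm (h (x, y) - h (x', y')) \<le> C * (\<mu>^(d+1) * norm (x - x') + \<mu>^d * norm (y - y')))"

lemma weighted_lipschitzD:
  assumes "weighted_lipschitz \<mu>0 d C h" "0 < \<mu>" "\<mu> \<le> \<mu>0"
    "norm x \<le> \<mu>" "norm x' \<le> \<mu>" "norm y \<le> \<mu>^2" "norm y' \<le> \<mu>^2"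
  shows "norm (h (x, y) - h (x', y')) \<le> C * (\<mu>^(d+1) * norm (x - x') + \<mu>^d * norm (y - y'))"
  using assms unfolding weighted_lipschitz_def by blast

lemma weighted_lipschitz_mono:
  assumes "weighted_lipschitz \<mu>0 d C h" "C \<le> C'"
  shows "weighted_lipschitz \<mu>0 d C' h"
  unfolding weighted_lipschitz_def
proof (intro allI impI, elim conjE)
  fix \<mu> :: real and x x' y y' :: complex
  assume m: "0 < \<mu>" "\<mu> \<le> \<mu>0" "norm x \<le> \<mu>" "norm x' \<le> \<mu>" "norm y \<le> \<mu>^2" "norm y' \<le> \<mu>^2"
  show "norm (h (x, y) - h (x', y')) \<le> C' * (\<mu>^(d+1) * norm (x - x') + \<mu>^d * norm (y - y'))"
    using m(1) assms(2) by (intro order.trans[OF weighted_lipschitzD[OF assms(1) m]] mult_right_mono) auto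
qed

text \<open>
  Cauchy's inequality on discs of radius \<open>\<mu>\<close> in \<open>x\<close> and \<open>\<mu>\<^sup>2\<close> in \<open>y\<close>; the bound is therefore assumed
  on a region that is larger by a factor of \<open>2\<close>.
\<close>

lemma weighted_lipschitzI:
  assumes f: "sep_holomorphic f r M" and C: "C \<ge> 0" and \<mu>0: "\<mu>0 \<le> 1" "2 * \<mu>0 \<le> r"
    and bd: "\<And>\<mu> x y. 0 < \<mu> \<Longrightarrow> \<mu> \<le> \<mu>0 \<Longrightarrow> norm x \<le> 2 * \<mu> \<Longrightarrow> norm y \<le> 2 * \<mu>^2 \<Longrightarrow> norm (f (x, y)) \<le> C * \<mu>^(d + 2)"
  shows "weighted_lipschitz \<mu>0 d (2 * C) f"
  unfolding weighted_lipschitz_def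
proof (intro allI impI, elim conjE)
  fix \<mu> :: real and x x' y y' :: complex
  assume \<mu>: "0 < \<mu>" "\<mu> \<le> \<mu>0" and x: "norm x \<le> \<mu>" "norm x' \<le> \<mu>" and y: "norm y \<le> \<mu>^2" "norm y' \<le> \<mu>^2"
  have sq: "0 < \<mu>^2" "\<mu>^2 \<le> \<mu>" using \<mu> \<mu>0 power_decreasing[of 1 2 \<mu>] by simp_all
  have "norm (f (x, y) - f (x', y)) \<le> 2 * (C * \<mu>^(d+2)) / \<mu> * norm (x - x')"
  proof (rule lipschitz_from_bound[of "\<lambda>x. f (x, y)"])
    show "(\<lambda>x. f (x, y)) holomorphic_on ball 0 (2 * \<mu>)"
      using \<mu> \<mu>0 sq(2) y by (intro holomorphic_on_subset[OF sep_holomorphicD(2)[OF f]]) auto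
    show "norm (f (w, y)) \<le> C * \<mu>^(d+2)" if "norm w < 2 * \<mu>" for w
      by (rule bd[OF \<mu>]; use that y sq(1) in linarith)
  qed (use \<mu> x in auto)
  also have "\<dots> = 2 * C * (\<mu>^(d+1) * norm (x - x'))" using \<mu> by (simp add: field_simps)
  finally have 1: "norm (f (x, y) - f (x', y)) \<le> 2 * C * (\<mu>^(d+1) * norm (x - x'))" .
  have "norm (f (x', y) - f (x', y')) \<le> 2 * (C * \<mu>^(d+2)) / \<mu>^2 * norm (y - y')"
  proof (rule lipschitz_from_bound[of "\<lambda>y. f (x', y)"])
    show "(\<lambda>y. f (x', y)) holomorphic_on ball 0 (2 * \<mu>^2)"
      using \<mu> \<mu>0 sq(2) x by (intro holomorphic_on_subset[OF sep_holomorphicD(3)[OF f]]) auto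
    show "norm (f (x', w)) \<le> C * \<mu>^(d+2)" if "norm w < 2 * \<mu>^2" for w
      by (rule bd[OF \<mu>]; use that x \<mu> in linarith)
  qed (use sq y in auto)
  also have "\<dots> = 2 * C * (\<mu>^d * norm (y - y'))" using \<mu> by (simp add: field_simps power2_eq_square)
  finally have 2: "norm (f (x', y) - f (x', y')) \<le> 2 * C * (\<mu>^d * norm (y - y'))" .
  have "norm (f (x, y) - f (x', y')) \<le> norm (f (x, y) - f (x', y)) + norm (f (x', y) - f (x', y'))"
    using norm_triangle_ineq[of "f (x, y) - f (x', y)" "f (x', y) - f (x', y')"] by simp
  with 1 2 show "norm (f (x, y) - f (x', y')) \<le> 2 * C * (\<mu>^(d+1) * norm (x - x') + \<mu>^d * norm (y - y'))"
    by (simp add: distrib_left)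
qed

section \<open>Orders of decay at infinity\<close>

abbreviation right_inf :: "complex filter" where
  "right_inf \<equiv> filtercomap Re at_top"

lemma eventually_right_inf: "eventually P right_inf \<longleftrightarrow> (\<exists>R. \<forall>w. Re w > R \<longrightarrow> P w)"
  by (rule eventually_filtercomap_at_top_dense)

lemma eventually_right_inf_gt: "\<forall>\<^sub>F w in right_inf. Re w > R"
  by (auto simp: eventually_right_inf)

lemma eventually_right_inf_norm: "\<forall>\<^sub>F w in right_inf. norm w > R"
  using eventually_right_inf_gt[of R]
  by eventually_elim (use complex_Re_le_cmod less_le_trans in blast)

lemma filterlim_norm_right_inf: "filterlim (norm :: complex \<Rightarrow> real) at_top right_inf"
  unfolding filterlim_at_top_dense using eventually_right_inf_norm by auto

text \<open>
  \<open>soft_O s\<close> consists of the functions that are \<open>O(\<bar>w\<bar>\<^sup>-\<^sup>s)\<close> up to an arbitrarily small loss in the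
  exponent. The loss hides powers of logarithms, so that orders remain integers and simply add up
  under multiplication. The bounds hold on a half plane \<open>Re w > R\<close> but are in terms of \<open>\<bar>w\<bar>\<close>, which is
  what matters for approaching the origin along a curve in an arbitrary manner.
\<close>

definition soft_O :: "real \<Rightarrow> (complex \<Rightarrow> complex) set" where
  "soft_O s = {f. \<forall>e>0. (\<lambda>w. norm (f w)) \<in> O[right_inf](\<lambda>w. norm w powr (e - s))}"

text \<open>
  Losses below \<open>1\<close> are enough, because a larger loss gives a weaker bound.
\<close>

lemma softI:
  assumes "\<And>e. e > 0 \<Longrightarrow> e < 1 \<Longrightarrow> \<exists>C. \<forall>\<^sub>F w in right_inf. norm (f w) \<le> C * norm w powr (e - s)"
  shows "f \<in> soft_O s"
  unfolding soft_O_def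
proof (safe)
  fix e :: real assume e: "e > 0"
  define e' where "e' = min e (1/2)"
  have "e' > 0" "e' < 1" "e' \<le> e" using e by (auto simp: e'_def)
  from assms[OF this(1,2)] obtain C where C: "\<forall>\<^sub>F w in right_inf. norm (f w) \<le> C * norm w powr (e' - s)" ..
  have "\<forall>\<^sub>F w in right_inf. norm (f w) \<le> \<bar>C\<bar> * norm w powr (e - s)"
    using C eventually_right_inf_norm[of 1]
  proof eventually_elim
    case (elim w)
    have "C * norm w powr (e' - s) \<le> \<bar>C\<bar> * norm w powr (e - s)"
      using elim \<open>e' \<le> e\<close> by (intro mult_mono powr_mono) auto
    with elim show ?case by linarith
  qed
  then show "(\<lambda>w. norm (f w)) \<in> O[right_inf](\<lambda>w. norm w powr (e - s))"
    by (intro bigoI[of _ "\<bar>C\<bar>"]) (auto elim: eventually_mono)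
qed

lemma softD:
  assumes "f \<in> soft_O s" "s' < s"
  obtains C R where "C > 0" "R > 0" "\<And>w. Re w > R \<Longrightarrow> norm (f w) \<le> C * norm w powr (- s')"
proof -
  have "(\<lambda>w. norm (f w)) \<in> O[right_inf](\<lambda>w. norm w powr ((s - s') - s))"
    using assms(1)[unfolded soft_O_def mem_Collect_eq, rule_format, of "s - s'"] assms(2) by simp
  then obtain C where C: "C > 0" "\<forall>\<^sub>F w in right_inf. norm (norm (f w)) \<le> C * norm (norm w powr ((s - s') - s))"
    by (rule landau_o.bigE)
  from C(2) obtain R where "\<And>w. Re w > R \<Longrightarrow> norm (f w) \<le> C * norm w powr (- s')"
    unfolding eventually_right_inf by auto
  then show ?thesis using C(1) that[of C "max R 1"] by auto
qed

lemma powr_minus_nat: "0 < x \<Longrightarrow> x powr (- real n) = 1 / x ^ n"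
  by (simp add: powr_minus powr_realpow inverse_eq_divide)

lemma soft_small:
  assumes "f \<in> soft_O s" "real n < s" "c > 0"
  obtains R where "R \<ge> 1" "\<And>w. Re w > R \<Longrightarrow> norm (f w) \<le> c / norm w ^ n"
proof -
  define d where "d = (s - real n) / 2"
  have d: "d > 0" "real n + d < s" using assms(2) by (auto simp: d_def field_simps)
  obtain C R where C: "C > 0" "\<And>w. Re w > R \<Longrightarrow> norm (f w) \<le> C * norm w powr (- (real n + d))"
    using softD[OF assms(1) d(2)] by metis
  have "((\<lambda>x::real. C * x powr (- d)) \<longlongrightarrow> 0) at_top"
    using d by real_asymp
  then have "\<forall>\<^sub>F x in at_top. C * x powr (- d) < c" by (rule order_tendstoD) (use assms in auto)
  then obtain X where X: "\<And>x. x > X \<Longrightarrow> C * x powr (- d) < c"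
    unfolding eventually_at_top_dense by auto
  show ?thesis
  proof (rule that[of "max 1 (max R X)"])
    fix w assume t: "Re w > max 1 (max R X)"
    then have nt: "norm w > max 1 (max R X)" using complex_Re_le_cmod[of w] by linarith
    have "norm (f w) \<le> C * norm w powr (- (real n + d))" using t by (intro C) auto
    also have "\<dots> = C * norm w powr (- d) / norm w ^ n"
    proof -
      have "norm w powr (- (real n + d)) = norm w powr (- d) * norm w powr (- real n)"
        by (simp add: powr_add[symmetric] add.commute)
      moreover have "norm w > 0" using nt by linarith
      ultimately show ?thesis using powr_minus_nat[of "norm w" n] by simp
    qed
    also have "\<dots> \<le> c / norm w ^ n"
      using X[of "norm w"] nt by (intro divide_right_mono) auto
    finally show "norm (f w) \<le> c / norm w ^ n" .
  qed auto
qed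

lemma soft_transfer:
  assumes "f \<in> soft_O s" "\<forall>\<^sub>F w in right_inf. norm (g w) \<le> C * norm (f w)"
  shows "g \<in> soft_O s"
  unfolding soft_O_def
proof safe
  fix e :: real assume "e > 0"
  have "(\<lambda>w. norm (g w)) \<in> O[right_inf](\<lambda>w. norm (f w))"
    by (rule bigoI[of _ C]) (use assms(2) in auto)
  then show "(\<lambda>w. norm (g w)) \<in> O[right_inf](\<lambda>w. norm w powr (e - s))"
    by (rule landau_o.big.trans) (use assms(1)[unfolded soft_O_def mem_Collect_eq] \<open>e > 0\<close> in blast)
qed

lemma soft_cong:
  assumes "f \<in> soft_O s" "\<forall>\<^sub>F w in right_inf. g w = f w"
  shows "g \<in> soft_O s"
  by (rule soft_transfer[OF assms(1), of _ 1]) (use assms(2) in \<open>auto elim: eventually_mono\<close>)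

lemma soft_mono:
  assumes "f \<in> soft_O s" "s' \<le> s"
  shows "f \<in> soft_O s'"
proof (rule softI)
  fix e :: real assume e: "e > 0"
  have "s' - e < s" using assms e by auto
  with assms(1) obtain C R where "\<And>w. Re w > R \<Longrightarrow> norm (f w) \<le> C * norm w powr (- (s' - e))"
    using softD by metis
  then show "\<exists>C. \<forall>\<^sub>F w in right_inf. norm (f w) \<le> C * norm w powr (e - s')"
    unfolding eventually_right_inf by auto
qed

lemma soft_add:
  assumes "f \<in> soft_O s" "g \<in> soft_O s"
  shows "(\<lambda>w. f w + g w) \<in> soft_O s"
  unfolding soft_O_def
proof safe
  fix e :: real assume "e > 0"
  have "(\<lambda>w. norm (f w) + norm (g w)) \<in> O[right_inf](\<lambda>w. norm w powr (e - s))"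
    using assms \<open>e > 0\<close> by (intro sum_in_bigo) (auto simp: soft_O_def)
  moreover have "(\<lambda>w. norm (f w + g w)) \<in> O[right_inf](\<lambda>w. norm (f w) + norm (g w))"
    by (rule bigoI[of _ 1]) (simp add: norm_triangle_ineq)
  ultimately show "(\<lambda>w. norm (f w + g w)) \<in> O[right_inf](\<lambda>w. norm w powr (e - s))"
    by (rule landau_o.big.trans[rotated])
qed

lemma soft_mult:
  assumes "f \<in> soft_O s" "g \<in> soft_O t" "r \<le> s + t"
  shows "(\<lambda>w. f w * g w) \<in> soft_O r"
proof -
  have "(\<lambda>w. f w * g w) \<in> soft_O (s + t)"
    unfolding soft_O_def
  proof safe
    fix e :: real assume "e > 0"
    then have "(\<lambda>w. norm (f w) * norm (g w)) \<in> 
      O[right_inf](\<lambda>w. norm w powr (e/2 - s) * norm w powr (e/2 - t))"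
      using assms by (intro landau_o.big.mult) (auto simp: soft_O_def)
    then show "(\<lambda>w. norm (f w * g w)) \<in> O[right_inf](\<lambda>w. norm w powr (e - (s + t)))"
      by (simp add: norm_mult powr_add[symmetric] algebra_simps)
  qed
  then show ?thesis using assms(3) by (rule soft_mono)
qed

lemma soft_const: "(\<lambda>w. c) \<in> soft_O 0"
proof (rule softI)
  fix e :: real assume e: "e > 0"
  have "\<forall>\<^sub>F w in right_inf. norm c \<le> norm c * norm w powr (e - 0)"
    using eventually_right_inf_norm[of 1]
    by eventually_elim (use e in \<open>simp add: mult_le_cancel_left1 ge_one_powr_ge_zero\<close>)
  then show "\<exists>C. \<forall>\<^sub>F w in right_inf. norm c \<le> C * norm w powr (e - 0)" ..
qed

lemma soft_zero: "(\<lambda>w. 0) \<in> soft_O s"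
  by (rule softI) (auto intro!: exI[of _ 0])

lemma soft_cmult: "f \<in> soft_O s \<Longrightarrow> (\<lambda>w. c * f w) \<in> soft_O s"
  using soft_mult[OF soft_const[of c]] by simp

lemma soft_minus: "f \<in> soft_O s \<Longrightarrow> (\<lambda>w. - f w) \<in> soft_O s"
  using soft_cmult[of f s "-1"] by simp

lemma soft_diff: "f \<in> soft_O s \<Longrightarrow> g \<in> soft_O s \<Longrightarrow> (\<lambda>w. f w - g w) \<in> soft_O s"
  using soft_add[of f s "\<lambda>w. - g w"] soft_minus[of g s] by simp

lemma soft_inverse_power: "(\<lambda>w. 1 / w ^ n) \<in> soft_O (real n)"
proof (rule softI)
  fix e :: real assume e: "e > 0"
  have "\<forall>\<^sub>F w in right_inf. norm (1 / w ^ n) \<le> 1 * norm w powr (e - real n)"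
    using eventually_right_inf_norm[of 1]
  proof eventually_elim
    case (elim w)
    have "norm (1 / w ^ n) = norm w powr (- real n)"
      by (subst powr_minus_nat) (use elim in \<open>auto simp: norm_divide norm_power\<close>)
    also have "\<dots> \<le> norm w powr (e - real n)" using elim e by (intro powr_mono) auto
    finally show ?case by simp
  qed
  then show "\<exists>C. \<forall>\<^sub>F w in right_inf. norm (1 / w ^ n) \<le> C * norm w powr (e - real n)" ..
qed

lemma soft_divide_power:
  assumes "f \<in> soft_O s" "r \<le> s + real n"
  shows "(\<lambda>w. f w / w ^ n) \<in> soft_O r"
  using soft_mult[OF assms(1) soft_inverse_power assms(2)] by simp

lemma soft_times_id:
  assumes "f \<in> soft_O s"
  shows "(\<lambda>w. w * f w) \<in> soft_O (s - 1)"
proof -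
  have "(\<lambda>w. w) \<in> soft_O (-1)"
  proof (rule softI)
    fix e :: real assume e: "e > 0"
    have "\<forall>\<^sub>F w in right_inf. norm w \<le> 1 * norm w powr (e - (-1))"
      using eventually_right_inf_norm[of 1]
    proof eventually_elim
      case (elim w)
      have "norm w powr 1 \<le> norm w powr (e - (-1))" using elim e by (intro powr_mono) auto
      with elim show ?case by simp
    qed
    then show "\<exists>C. \<forall>\<^sub>F w in right_inf. norm w \<le> C * norm w powr (e - (-1))" ..
  qed
  from soft_mult[OF this assms] show ?thesis by simp
qed

lemma soft_Ln: "Ln \<in> soft_O 0"
proof (rule softI)
  fix e :: real assume e: "e > 0"
  have "(\<lambda>x. ln x + pi) \<in> O(\<lambda>x::real. x powr e)" using e by real_asymp
  then obtain C where C: "C > 0" "\<forall>\<^sub>F x in at_top. norm (ln x + pi) \<le> C * norm (x powr e)"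
    by (rule landau_o.bigE)
  have "\<forall>\<^sub>F w in right_inf. norm (ln (norm w) + pi) \<le> C * norm (norm w powr e)"
    using C(2) filterlim_norm_right_inf unfolding filterlim_iff by fast
  then have "\<forall>\<^sub>F w in right_inf. norm (Ln w) \<le> C * norm w powr (e - 0)"
    using eventually_right_inf_norm[of 1]
  proof eventually_elim
    case (elim w)
    have "norm (Ln w) \<le> \<bar>Re (Ln w)\<bar> + \<bar>Im (Ln w)\<bar>" by (rule cmod_le)
    also have "\<dots> \<le> ln (norm w) + pi"
    proof (rule add_mono)
      have "w \<noteq> 0" using elim by auto
      then show "\<bar>Re (Ln w)\<bar> \<le> ln (norm w)" "\<bar>Im (Ln w)\<bar> \<le> pi"
        using elim mpi_less_Im_Ln[of w] Im_Ln_le_pi[of w] by auto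
    qed
    finally show ?case using elim by simp
  qed
  then show "\<exists>C. \<forall>\<^sub>F w in right_inf. norm (Ln w) \<le> C * norm w powr (e - 0)" ..
qed

lemma soft_sum:
  "(\<And>i. i \<in> A \<Longrightarrow> f i \<in> soft_O s) \<Longrightarrow> (\<lambda>w. \<Sum>i\<in>A. f i w) \<in> soft_O s"
  by (induction A rule: infinite_finite_induct) (auto intro: soft_zero soft_add)

lemma soft_power: "f \<in> soft_O s \<Longrightarrow> (\<lambda>w. f w ^ n) \<in> soft_O (real n * s)"
  by (induction n) (auto intro!: soft_mult soft_const simp: algebra_simps)

section \<open>Polynomials in \<open>1 / w\<close> and \<open>log w\<close>\<close>

inductive_set log_polys :: "(complex \<Rightarrow> complex) set" where
  const: "(\<lambda>w. c) \<in> log_polys"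
| inv: "(\<lambda>w. 1 / w) \<in> log_polys"
| log: "Ln \<in> log_polys"
| add: "f \<in> log_polys \<Longrightarrow> g \<in> log_polys \<Longrightarrow> (\<lambda>w. f w + g w) \<in> log_polys"
| mult: "f \<in> log_polys \<Longrightarrow> g \<in> log_polys \<Longrightarrow> (\<lambda>w. f w * g w) \<in> log_polys"

lemma log_polys_power: "f \<in> log_polys \<Longrightarrow> (\<lambda>w. f w ^ n) \<in> log_polys"
  by (induction n) (auto intro: log_polys.intros)

lemma log_polys_divide_power: "f \<in> log_polys \<Longrightarrow> (\<lambda>w. f w / w ^ n) \<in> log_polys"
  using log_polys.mult[OF _ log_polys_power[OF log_polys.inv, of n], of f] by (simp add: power_divide)

lemma log_polys_diff: "f \<in> log_polys \<Longrightarrow> g \<in> log_polys \<Longrightarrow> (\<lambda>w. f w - g w) \<in> log_polys"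
  using log_polys.add[of f "\<lambda>w. (-1) * g w"] log_polys.mult[OF log_polys.const[of "-1"], of g] by simp

lemma log_polys_sum: "(\<And>i. i \<in> A \<Longrightarrow> f i \<in> log_polys) \<Longrightarrow> (\<lambda>w. \<Sum>i\<in>A. f i w) \<in> log_polys"
  by (induction A rule: infinite_finite_induct) (auto intro: log_polys.intros)

lemma log_polys_poly_Ln: "(\<lambda>w. poly P (Ln w)) \<in> log_polys"
proof (induction P)
  case (pCons c P)
  show ?case using log_polys.add[OF log_polys.const[of c] log_polys.mult[OF log_polys.log pCons.IH]] by simp
qed (simp add: log_polys.const)

lemma log_polys_soft: "f \<in> log_polys \<Longrightarrow> f \<in> soft_O 0"
proof (induction rule: log_polys.induct)
  case inv
  show ?case using soft_mono[OF soft_inverse_power[of 1]] by simp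
qed (auto intro: soft_const soft_Ln soft_add soft_mult)

lemma log_polys_derivative:
  assumes "f \<in> log_polys"
  shows "\<exists>g\<in>log_polys. \<forall>w. Re w > 0 \<longrightarrow> (f has_field_derivative g w / w) (at w)"
  using assms
proof (induction rule: log_polys.induct)
  case (const c)
  show ?case by (rule bexI[OF _ log_polys.const[of 0]]) auto
next
  case inv
  show ?case
    by (rule bexI[OF _ log_polys.mult[OF log_polys.const[of "-1"] log_polys.inv]])
       (auto intro!: derivative_eq_intros simp: field_simps)
next
  case log
  show ?case
    by (rule bexI[OF _ log_polys.const[of 1]])
       (auto intro!: has_field_derivative_Ln simp: complex_nonpos_Reals_iff divide_inverse)
next
  case (add f g)
  then obtain f' g' where D: "f' \<in> log_polys" "g' \<in> log_polys"
    "\<And>w. Re w > 0 \<Longrightarrow> (f has_field_derivative f' w / w) (at w)"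
    "\<And>w. Re w > 0 \<Longrightarrow> (g has_field_derivative g' w / w) (at w)" by blast
  show ?case
    by (rule bexI[OF _ log_polys.add[OF D(1,2)]]) (auto intro!: derivative_eq_intros D simp: add_divide_distrib)
next
  case (mult f g)
  then obtain f' g' where D: "f' \<in> log_polys" "g' \<in> log_polys"
    "\<And>w. Re w > 0 \<Longrightarrow> (f has_field_derivative f' w / w) (at w)"
    "\<And>w. Re w > 0 \<Longrightarrow> (g has_field_derivative g' w / w) (at w)" by blast
  show ?case
    by (rule bexI[OF _ log_polys.add[OF log_polys.mult[OF D(1) mult.hyps(2)] log_polys.mult[OF D(2) mult.hyps(1)]]])
       (auto intro!: derivative_eq_intros D simp: add_divide_distrib)
qed

lemma log_polys_over_power_derivative:
  assumes "g \<in> log_polys"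
  shows "\<exists>g'\<in>log_polys. \<forall>w. Re w > 0 \<longrightarrow> ((\<lambda>w. g w / w ^ n) has_field_derivative g' w / w ^ Suc n) (at w)"
proof -
  obtain g' where g': "g' \<in> log_polys" "\<And>w. Re w > 0 \<Longrightarrow> (g has_field_derivative g' w / w) (at w)"
    using log_polys_derivative[OF assms] by blast
  have "((\<lambda>w. g w / w ^ n) has_field_derivative (g' w - of_nat n * g w) / w ^ Suc n) (at w)" 
    if "Re w > 0" for w
  proof -
    have [simp]: "w \<noteq> 0" using that by auto
    show ?thesis
      by (rule derivative_eq_intros g'(2) refl that | simp)+
         (cases n; simp add: field_simps)
  qed
  then show ?thesis using g' assms
    by (intro bexI[of _ "\<lambda>w. g' w - of_nat n * g w"] log_polys_diff log_polys.mult log_polys.const) auto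
qed

lemma log_polys_higher_derivatives:
  assumes "g \<in> log_polys"
  shows "\<exists>D. D 0 = g \<and> (\<forall>k. D k \<in> log_polys) \<and> (\<forall>k w. Re w > 0 \<longrightarrow>
      ((\<lambda>w. D k w / w ^ (n + k)) has_field_derivative D (Suc k) w / w ^ Suc (n + k)) (at w))"
proof -
  define P where "P k f \<longleftrightarrow> f \<in> log_polys \<and> (k = 0 \<longrightarrow> f = g)" for k :: nat and f
  define Q where "Q k f h \<longleftrightarrow> (\<forall>w. Re w > 0 \<longrightarrow> 
      ((\<lambda>w. f w / w ^ (n + k)) has_field_derivative h w / w ^ Suc (n + k)) (at w))" for k f h
  have "\<exists>D. \<forall>k. P k (D k) \<and> Q k (D k) (D (Suc k))"
  proof (rule dependent_nat_choice)
    show "\<exists>f. P 0 f" using assms by (simp add: P_def)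
    fix f k assume "P k f"
    then have "f \<in> log_polys" by (simp add: P_def)
    from log_polys_over_power_derivative[OF this, of "n + k"] show "\<exists>h. P (Suc k) h \<and> Q k f h"
      unfolding P_def Q_def by blast
  qed
  then obtain D where D: "\<And>k. P k (D k)" "\<And>k. Q k (D k) (D (Suc k))" by blast
  show ?thesis
    using D by (intro exI[of _ D]) (simp add: P_def Q_def del: power_Suc)
qed

text \<open>
  The difference equation is compared with differential equations through Taylor's formula for the step
  from \<open>w\<close> to \<open>w + 1\<close>: each derivative of a polynomial in \<open>1 / w\<close> and \<open>log w\<close> gains one order, so the
  remainder is as small as desired.
\<close>

lemma shift_taylor:
  assumes D: "\<And>k w. k \<le> m \<Longrightarrow> Re w > 0 \<Longrightarrow>  (f k has_field_derivative f (Suc k) w) (at w)"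
    and s: "f (Suc m) \<in> soft_O s" "s \<ge> 1"
  shows "(\<lambda>w. f 0 (w + 1) - (\<Sum>k\<le>m. f k w / fact k)) \<in> soft_O s"
proof (rule softI)
  fix e :: real assume e: "e > 0" "e < 1"
  have "s - e < s" using e by auto
  then obtain C R where C: "C > 0" "R > 0" "\<And>w. Re w > R \<Longrightarrow> norm (f (Suc m) w) \<le> C * norm w powr (-(s - e))"
    using softD[OF s(1)] by blast
  have "norm (f 0 (w + 1) - (\<Sum>k\<le>m. f k w / fact k)) \<le> C * norm w powr (e - s)" if t: "Re w > R" for w
  proof -
    have seg: "Re \<sigma> \<ge> Re w \<and> norm \<sigma> \<ge> norm w" if sg: "\<sigma> \<in> closed_segment w (w + 1)" for \<sigma>
    proof -
      obtain u where u: "0 \<le> u" "u \<le> 1" "\<sigma> = w + of_real u"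
        using sg by (auto simp: in_segment algebra_simps scaleR_conv_of_real)
      have "norm w \<le> norm \<sigma>" using u t C(2) by (simp add: cmod_def power_mono)
      with u show ?thesis by auto
    qed
    have "norm (f 0 (w+1) - (\<Sum>i\<le>m. f i w * ((w+1) - w) ^ i / (fact i))) \<le> 
       (C * norm w powr (e - s)) * norm ((w+1) - w)^(Suc m) / fact m"
    proof (rule complex_Taylor[where f = f and n = m and z = "w + 1" and w = w and S = "closed_segment w (w + 1)"])
      fix i x assume x: "x \<in> closed_segment w (w + 1)" and i: "i \<le> m"
      have "Re w > 0" using t C(2) by (rule less_trans[rotated])
      then have "Re x > 0" by (rule less_le_trans) (rule conjunct1[OF seg[OF x]])
      show "(f i has_field_derivative f (Suc i) x) (at x within closed_segment w (w + 1))"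
        by (rule has_field_derivative_at_within, rule D[OF i \<open>Re x > 0\<close>])
    next
      fix x assume x: "x \<in> closed_segment w (w + 1)"
      have "norm (f (Suc m) x) \<le> C * norm x powr (-(s - e))"
        by (rule C(3), rule less_le_trans[OF t conjunct1[OF seg[OF x]]])
      also have "\<dots> \<le> C * norm w powr (-(s - e))"
      proof (intro mult_left_mono powr_mono2')
        show "0 < norm w" using t C(2) complex_Re_le_cmod[of w] by linarith
      qed (use seg[OF x] C(1) e s in auto)
      finally show "norm (f (Suc m) x) \<le> C * norm w powr (e - s)" by simp
    qed auto
    also have "\<dots> \<le> C * norm w powr (e - s)"
    proof -
      have "norm ((w + 1) - w) ^ Suc m / fact m \<le> (1::real)" by (simp add: divide_le_eq fact_ge_1)
      from mult_left_mono[OF this, of "C * norm w powr (e - s)"] show ?thesis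
        using C(1) by simp
    qed
    finally show ?thesis by simp
  qed
  then show "\<exists>C. \<forall>\<^sub>F w in right_inf. norm (f 0 (w + 1) - (\<Sum>k\<le>m. f k w / fact k)) \<le> C * norm w powr (e - s)"
    unfolding eventually_right_inf by blast
qed

text \<open>
  The functions with a complete asymptotic expansion in terms \<open>w\<^sup>-\<^sup>j (log w)\<^sup>i\<close>.
\<close>

definition log_expandable :: "(complex \<Rightarrow> complex) set" where
  "log_expandable = {f. \<forall>N::nat. \<exists>a\<in>log_polys. (\<lambda>w. f w - a w) \<in> soft_O (real N)}"

lemma log_expandable_diff: 
  assumes "f \<in> log_expandable" "g \<in> log_expandable" shows "(\<lambda>w. f w - g w) \<in> log_expandable"
  unfolding log_expandable_def
proof safe
  fix N :: nat
  obtain a b where ab: "a \<in> log_polys" "b \<in> log_polys" "(\<lambda>w. f w - a w) \<in> soft_O (real N)" "(\<lambda>w. g w - b w) \<in> soft_O (real N)"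
    using assms unfolding log_expandable_def by blast
  show "\<exists>a\<in>log_polys. (\<lambda>w. f w - g w - a w) \<in> soft_O (real N)"
    using soft_diff[OF ab(3,4)] by (intro bexI[OF _ log_polys_diff[OF ab(1,2)]]) (simp add: algebra_simps)
qed

lemma log_expandable_shift:
  assumes "g \<in> log_polys"
  shows "(\<lambda>w. g (w + 1)) \<in> log_expandable"
  unfolding log_expandable_def
proof safe
  fix N :: nat
  obtain D where D: "D 0 = g" "\<And>k. D k \<in> log_polys"
    "\<And>k w. Re w > 0 \<Longrightarrow>
      ((\<lambda>w. D k w / w ^ (0 + k)) has_field_derivative D (Suc k) w / w ^ Suc (0 + k)) (at w)"
    using log_polys_higher_derivatives[OF assms, of 0] by blast
  define f where "f k w = D k w / w ^ k" for k w
  have s: "(\<lambda>w. f 0 (w + 1) - (\<Sum>k\<le>N. f k w / fact k)) \<in> soft_O (real (Suc N))"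
  proof (rule shift_taylor[where f = f and m = N])
    show "f (Suc N) \<in> soft_O (real (Suc N))"
      unfolding f_def[abs_def] using log_polys_soft[OF D(2)] by (rule soft_divide_power) simp
  qed (use D(3) in \<open>auto simp: f_def[abs_def]\<close>)
  have l: "(\<lambda>w. \<Sum>k\<le>N. f k w / fact k) \<in> log_polys"
  proof (rule log_polys_sum)
    fix k
    show "(\<lambda>w. f k w / fact k) \<in> log_polys"
      using log_polys.mult[OF log_polys.const[of "1 / fact k"] log_polys_divide_power[OF D(2)[of k], of k]] by (simp add: f_def mult.commute)
  qed
  show "\<exists>a\<in>log_polys. (\<lambda>w. g (w + 1) - a w) \<in> soft_O (real N)"
    by (rule bexI[OF _ l]) (use soft_mono[OF s, of "real N"] in \<open>simp add: f_def D(1)\<close>)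
qed

lemma shift_first_order:
  assumes "g \<in> log_polys" and d: "\<And>w. Re w > 0 \<Longrightarrow> ((\<lambda>w. g w / w ^ n) has_field_derivative d w) (at w)"
  shows "(\<lambda>w. g (w + 1) / (w + 1) ^ n - g w / w ^ n - d w) \<in> soft_O (real n + 2)"
proof -
  obtain D where D: "D 0 = g" "\<And>k. D k \<in> log_polys"
    "\<And>k w. Re w > 0 \<Longrightarrow>
      ((\<lambda>w. D k w / w ^ (n + k)) has_field_derivative D (Suc k) w / w ^ Suc (n + k)) (at w)"
    using log_polys_higher_derivatives[OF assms(1), of n] by blast
  define f where "f k w = D k w / w ^ (n + k)" for k w
  have s: "(\<lambda>w. f 0 (w + 1) - (\<Sum>k\<le>1. f k w / fact k)) \<in> soft_O (real n + 2)"
  proof (rule shift_taylor[where f = f and m = 1])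
    have "(\<lambda>w. D (Suc 1) w / w ^ (n + Suc 1)) \<in> soft_O (real n + 2)" 
      using log_polys_soft[OF D(2)] by (rule soft_divide_power) simp
    then show "f (Suc 1) \<in> soft_O (real n + 2)" unfolding f_def[abs_def] .
  qed (use D(3) in \<open>auto simp: f_def[abs_def]\<close>)
  show ?thesis
  proof (rule soft_cong[OF s], use eventually_right_inf_gt[of 0] in eventually_elim)
    case (elim w)
    have "f (Suc 0) w = d w" using DERIV_unique[OF D(3)[OF elim, of 0]] d[OF elim] by (simp add: f_def D(1))
    then show ?case by (simp add: f_def D(1))
  qed
qed

text \<open>
  Sorting by powers of \<open>1 / w\<close>: the part of order zero is a polynomial in \<open>log w\<close>.
\<close>

lemma log_polys_split:
  assumes "f \<in> log_polys"
  shows "\<exists>P. \<exists>g\<in>log_polys. \<forall>w. Re w > 0 \<longrightarrow> f w = poly P (Ln w) + g w / w"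
  using assms
proof (induction rule: log_polys.induct)
  case (const c)
  show ?case by (rule exI[of _ "[:c:]"], rule bexI[OF _ log_polys.const[of 0]]) auto
next
  case inv
  show ?case by (rule exI[of _ 0], rule bexI[OF _ log_polys.const[of 1]]) auto
next
  case log
  show ?case by (rule exI[of _ "[:0, 1:]"], rule bexI[OF _ log_polys.const[of 0]]) auto
next
  case (add f g)
  then obtain P Q f' g' where D: "f' \<in> log_polys" "g' \<in> log_polys"
    "\<And>w. Re w > 0 \<Longrightarrow> f w = poly P (Ln w) + f' w / w"
    "\<And>w. Re w > 0 \<Longrightarrow> g w = poly Q (Ln w) + g' w / w" by blast
  show ?case
    by (rule exI[of _ "P + Q"], rule bexI[OF _ log_polys.add[OF D(1,2)]]) (auto simp: D add_divide_distrib)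
next
  case (mult f g)
  then obtain P Q f' g' where D: "f' \<in> log_polys" "g' \<in> log_polys"
    "\<And>w. Re w > 0 \<Longrightarrow> f w = poly P (Ln w) + f' w / w"
    "\<And>w. Re w > 0 \<Longrightarrow> g w = poly Q (Ln w) + g' w / w" by blast
  have "(\<lambda>w. poly P (Ln w) * g' w + (f' w * g w)) \<in> log_polys"
    using D(1,2) mult.hyps by (intro log_polys.add log_polys.mult log_polys_poly_Ln)
  then show ?case
    by (intro exI[of _ "P * Q"] bexI[of _ "\<lambda>w. poly P (Ln w) * g' w + (f' w * g w)"])
       (auto simp: D algebra_simps add_divide_distrib)
qed

text \<open>
  At the points \<open>w = exp k\<close> the polynomial is evaluated at \<open>k\<close>. A nonzero polynomial does not tend to
  \<open>0\<close> there.
\<close>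

lemma poly_Ln_soft_imp_zero:
  assumes "(\<lambda>w. poly P (Ln w)) \<in> soft_O 1"
  shows "P = 0"
proof -
  have lim: "(\<lambda>k. poly P (of_nat k)) \<longlonglongrightarrow> 0"
  proof -
    have "1/2 < (1::real)" by simp
    then obtain C R where C: "\<And>w. Re w > R \<Longrightarrow> norm (poly P (Ln w)) \<le> C * norm w powr (-(1/2))"
      using softD[OF assms] by metis
    have "\<forall>\<^sub>F k in sequentially. R < exp (real k)" by real_asymp
    then have "\<forall>\<^sub>F k in sequentially. norm (poly P (of_nat k)) \<le> C * exp (real k) powr (-(1/2))"
    proof eventually_elim
      case (elim k)
      have "Ln (of_real (exp (real k))) = of_real (ln (exp (real k)))" by (subst Ln_of_real) auto
      with C[of "of_real (exp (real k))"] elim show ?case by simp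
    qed
    moreover have "(\<lambda>k. C * exp (real k) powr (-(1/2))) \<longlonglongrightarrow> 0" by real_asymp
    ultimately show ?thesis by (rule Lim_null_comparison)
  qed
  obtain c q where P: "P = pCons c q" by (rule pCons_cases)
  show ?thesis
  proof (cases "q = 0")
    case True
    with lim P have "(\<lambda>k::nat. c) \<longlonglongrightarrow> 0" by simp
    then have "c = 0" by (simp add: LIMSEQ_const_iff)
    with True P show ?thesis by simp
  next
    case False
    then obtain r where r: "\<And>z. r \<le> norm z \<Longrightarrow> 1 \<le> norm (poly (pCons c q) z)"
      using poly_infinity[OF False, of 1 c] by blast
    have "\<forall>\<^sub>F k in sequentially. norm (poly P (of_nat k)) < 1"
      using order_tendstoD(2)[OF tendsto_norm[OF lim], of 1] by simp
    moreover have "\<forall>\<^sub>F k in sequentially. r \<le> real k" by real_asymp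
    ultimately have "\<forall>\<^sub>F k::nat in sequentially. False"
    proof eventually_elim
      case (elim k)
      then show ?case using r[of "of_nat k"] P by simp
    qed
    then show ?thesis by simp
  qed
qed

text \<open>
  Uniqueness of expansions: if the function decays, the part of order zero vanishes by
  \<open>poly_Ln_soft_imp_zero\<close>, and a factor \<open>1 / w\<close> can be split off.
\<close>

lemma log_polys_soft_factor:
  assumes "f \<in> log_polys" "f \<in> soft_O (real j)"
  shows "\<exists>g\<in>log_polys. \<forall>w. Re w > 0 \<longrightarrow> f w = g w / w ^ j"
  using assms
proof (induction j arbitrary: f)
  case (Suc j)
  obtain P g where g: "g \<in> log_polys" "\<And>w. Re w > 0 \<Longrightarrow> f w = poly P (Ln w) + g w / w"
    using log_polys_split[OF Suc.prems(1)] by blast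
  have g1: "(\<lambda>w. g w / w ^ 1) \<in> soft_O 1" by (rule soft_divide_power[OF log_polys_soft[OF g(1)]]) auto
  have "(\<lambda>w. f w - g w / w ^ 1) \<in> soft_O 1"
    by (rule soft_diff[OF soft_mono[OF Suc.prems(2)] g1]) auto
  then have "(\<lambda>w. poly P (Ln w)) \<in> soft_O 1"
    by (rule soft_cong) (use eventually_right_inf_gt[of 0] in eventually_elim, simp add: g)
  then have P: "P = 0" by (rule poly_Ln_soft_imp_zero)
  have "g \<in> soft_O (real (Suc j) - 1)"
    by (rule soft_cong[OF soft_times_id[OF Suc.prems(2)]])
       (use eventually_right_inf_gt[of 0] in eventually_elim, auto simp: g P)
  then have "g \<in> soft_O (real j)" by simp
  from Suc.IH[OF g(1) this] obtain h where "h \<in> log_polys" "\<And>w. Re w > 0 \<Longrightarrow> g w = h w / w ^ j" by blast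
  then show ?case using g P by (intro bexI[of _ h]) (auto simp: field_simps)
qed auto

text \<open>
  An order of decay of an expandable function forces the shape of its leading term. This is how the
  defect of an approximate solution is made explicit without computing the expansion of \<open>F\<close>.
\<close>

lemma log_expandable_leading_term:
  assumes "f \<in> log_expandable" "f \<in> soft_O (real j)"
  shows "\<exists>P. (\<lambda>w. f w - poly P (Ln w) / w ^ j) \<in> soft_O (real j + 1)"
proof -
  obtain a where a: "a \<in> log_polys" "(\<lambda>w. f w - a w) \<in> soft_O (real (Suc j))"
    using assms(1) unfolding log_expandable_def by blast
  have "(\<lambda>w. f w - (f w - a w)) \<in> soft_O (real j)"
    by (rule soft_diff[OF assms(2) soft_mono[OF a(2)]]) auto
  then have "a \<in> soft_O (real j)" by simp
  from log_polys_soft_factor[OF a(1) this] obtain g where g: "g \<in> log_polys" "\<And>w. Re w > 0 \<Longrightarrow> a w = g w / w ^ j" by blast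
  obtain P h where h: "h \<in> log_polys" "\<And>w. Re w > 0 \<Longrightarrow> g w = poly P (Ln w) + h w / w"
    using log_polys_split[OF g(1)] by blast
  have "(\<lambda>w. h w / w ^ Suc j) \<in> soft_O (real j + 1)"
    by (rule soft_divide_power[OF log_polys_soft[OF h(1)]]) auto
  moreover have "(\<lambda>w. f w - a w) \<in> soft_O (real j + 1)" using a(2) by (simp add: add.commute)
  ultimately have "(\<lambda>w. (f w - a w) + h w / w ^ Suc j) \<in> soft_O (real j + 1)" by (intro soft_add)
  then show ?thesis
    by (intro exI[of _ P], elim soft_cong)
       (use eventually_right_inf_gt[of 0] in eventually_elim, auto simp: g h add_divide_distrib)
qed

section \<open>Difference equations with decaying right-hand sides\<close>

abbreviation halfplane :: "real \<Rightarrow> complex set" where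
  "halfplane R \<equiv> {w. Re w > R}"

lemma open_halfplane: "open (halfplane R)"
  by (rule open_halfspace_Re_gt)

text \<open>
  The power of \<open>Re w\<close> makes the sums along \<open>w, w + 1, \<dots>\<close> small. The power of \<open>\<bar>w\<bar>\<close>, which increases
  along this sequence, keeps a decay that is uniform on the whole half plane, also
  near its boundary, where \<open>Re w\<close> stays bounded. The exponent \<open>4\<close> makes the correction negligible against the
  leading terms and against their derivatives.
\<close>

definition weight :: "nat \<Rightarrow> complex \<Rightarrow> real" where
  "weight j w = 1 / (norm w ^ 4 * Re w ^ j)"

lemma weight_pos: "Re w > 0 \<Longrightarrow> weight j w > 0"
  unfolding weight_def by (intro divide_pos_pos mult_pos_pos zero_less_power) auto

lemma weight_Suc: "weight (Suc j) w = weight j w / Re w"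
  by (simp add: weight_def)

lemma weight_le_one:
  assumes "Re w \<ge> 1" shows "weight j w \<le> 1"
proof -
  have "norm w \<ge> 1" using assms complex_Re_le_cmod[of w] by linarith
  then have "1 * 1 \<le> norm w ^ 4 * Re w ^ j"
    using assms by (intro mult_mono one_le_power) auto
  then show ?thesis by (simp add: weight_def)
qed

text \<open>
  A telescoping comparison with the integral of \<open>1 / x\<^sup>j\<^sup>+\<^sup>1\<close>; each step is Bernoulli's inequality
  \<open>1 + j / y \<le> (1 + 1 / y)\<^sup>j\<close>.
\<close>

lemma inverse_power_partial_sum:
  fixes x :: real
  assumes x: "x > 0" and j: "j \<ge> 1"
  shows "(\<Sum>k<Suc n. 1 / (x + real k) ^ Suc j)
      \<le> 1 / x ^ Suc j + (1 / x ^ j - 1 / (x + real n) ^ j) / real j"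
proof (induction n)
  case (Suc n)
  define y where "y = x + real n"
  have y: "y > 0" using x by (simp add: y_def)
  have "1 + real j / (y + 1) \<le> 1 + real j * (1 / y)" using y by (simp add: frac_le)
  also have "\<dots> \<le> (1 + 1 / y) ^ j" 
  proof (rule Bernoulli_inequality)
    have "0 \<le> 1 / y" using y by simp
    then show "-1 \<le> 1 / y" by linarith
  qed
  also have "1 + 1 / y = (y + 1) / y" using y by (simp add: field_simps)
  also have "((y + 1) / y) ^ j = (y + 1) ^ j / y ^ j" by (rule power_divide)
  finally have "(1 + real j / (y + 1)) / (y + 1) ^ j \<le> ((y + 1) ^ j / y ^ j) / (y + 1) ^ j"
    using y by (intro divide_right_mono) auto
  then have "1 / (y + 1) ^ j + real j / (y + 1) ^ Suc j \<le> 1 / y ^ j"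
    using y by (simp add: add_divide_distrib)
  then have "real j / (y + 1) ^ Suc j \<le> 1 / y ^ j - 1 / (y + 1) ^ j" by linarith
  from divide_right_mono[OF this, of "real j"]
  have "1 / (y + 1) ^ Suc j \<le> (1 / y ^ j - 1 / (y + 1) ^ j) / real j"
    using j by simp
  moreover have e: "x + real (Suc n) = y + 1" by (simp add: y_def)
  moreover have "(1 / x ^ j - 1 / (y + 1) ^ j) / real j =
     (1 / x ^ j - 1 / y ^ j) / real j + (1 / y ^ j - 1 / (y + 1) ^ j) / real j"
    by (simp add: diff_divide_distrib)
  ultimately show ?case using Suc.IH unfolding sum.lessThan_Suc[of _ "Suc n"] e y_def[symmetric] by linarith
qed simp

lemma inverse_power_sum:
  fixes x R :: real
  assumes x: "x \<ge> R" "R > 0" and j: "j \<ge> 1"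
  shows "summable (\<lambda>k. 1 / (x + real k) ^ Suc j)"
    and "(\<Sum>k. 1 / (x + real k) ^ Suc j) \<le> (1 / real j + 1 / R) / x ^ j"
proof -
  have b: "(\<Sum>k<n. 1 / (x + real k) ^ Suc j) \<le> (1 / real j + 1 / R) / x ^ j" for n
  proof -
    have "(\<Sum>k<n. 1 / (x + real k) ^ Suc j) \<le> (\<Sum>k<Suc n. 1 / (x + real k) ^ Suc j)"
      using x by simp
    also have "\<dots> \<le> 1 / x ^ Suc j + (1 / x ^ j - 1 / (x + real n) ^ j) / real j"
      using x j by (intro inverse_power_partial_sum) auto
    also have "\<dots> \<le> (1 / R) * (1 / x ^ j) + (1 / x ^ j) / real j"
    proof (intro add_mono divide_right_mono)
      have "1 / x \<le> 1 / R" using x by (simp add: frac_le)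
      from mult_right_mono[OF this, of "1 / x ^ j"] show "1 / x ^ Suc j \<le> (1 / R) * (1 / x ^ j)" using x by simp
    qed (use x in auto)
    also have "\<dots> = (1 / real j + 1 / R) / x ^ j" by (simp add: add_divide_distrib)
    finally show ?thesis .
  qed
  show s: "summable (\<lambda>k. 1 / (x + real k) ^ Suc j)"
    using x by (intro summableI_nonneg_bounded[OF _ b]) auto
  show "(\<Sum>k. 1 / (x + real k) ^ Suc j) \<le> (1 / real j + 1 / R) / x ^ j"
    using s b by (intro suminf_le_const) auto
qed

definition tail_sum :: "(complex \<Rightarrow> complex) \<Rightarrow> complex \<Rightarrow> complex" where
  "tail_sum f w = - (\<Sum>k. f (w + of_nat k))"

text \<open>
  The inverse of the difference operator \<open>u \<mapsto> u (w + 1) - u w\<close> on decaying functions. It loses one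
  power of \<open>Re w\<close> but gains the factor \<open>1 / j + 1 / R\<close>, which is small for large \<open>j\<close> and \<open>R\<close>.
\<close>

lemma tail_sum:
  assumes R: "R \<ge> 1" and j: "j \<ge> 1" and K: "K \<ge> 0"
    and hol: "f holomorphic_on halfplane R"
    and bd: "\<And>w. Re w > R \<Longrightarrow> norm (f w) \<le> K * weight (Suc j) w"
  shows tail_sum_summable: "Re w > R \<Longrightarrow> summable (\<lambda>k. f (w + of_nat k))"
    and tail_sum_bound: "Re w > R \<Longrightarrow> norm (tail_sum f w) \<le> K * (1 / real j + 1 / R) * weight j w"
    and tail_sum_shift: "Re w > R \<Longrightarrow> tail_sum f (w + 1) - tail_sum f w = f w"
    and tail_sum_holomorphic: "tail_sum f holomorphic_on halfplane R"
proof -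
  have tb: "norm (f (w + of_nat k)) \<le> K / norm w ^ 4 * (1 / (Re w + real k) ^ Suc j)"
    if t: "Re w > R" for w k
  proof -
    have nt: "0 < norm w" using t R complex_Re_le_cmod[of w] by linarith
    have le: "norm w \<le> norm (w + of_nat k)" using t R by (simp add: cmod_def power_mono)
    have "norm (f (w + of_nat k)) \<le> K * weight (Suc j) (w + of_nat k)" using t by (intro bd) auto
    also have "\<dots> = K / norm (w + of_nat k) ^ 4 * (1 / (Re w + real k) ^ Suc j)"
      by (simp add: weight_def)
    also have "\<dots> \<le> K / norm w ^ 4 * (1 / (Re w + real k) ^ Suc j)"
      using t R K nt le by (intro mult_right_mono divide_left_mono power_mono mult_pos_pos zero_less_power) auto
    finally show ?thesis .
  qed
  have sr: "summable (\<lambda>k. K / norm w ^ 4 * (1 / (Re w + real k) ^ Suc j))" if "Re w > R" for w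
    using that R j by (intro summable_mult inverse_power_sum(1)[of R]) auto
  have sn: "summable (\<lambda>k. norm (f (w + of_nat k)))" if "Re w > R" for w
    by (rule summable_comparison_test'[OF sr[OF that], of 0]) (use tb[OF that] in simp)
  then show s: "Re w > R \<Longrightarrow> summable (\<lambda>k. f (w + of_nat k))" for w by (rule summable_norm_cancel)
  show "norm (tail_sum f w) \<le> K * (1 / real j + 1 / R) * weight j w" if t: "Re w > R"
  proof -
    have "norm (tail_sum f w) \<le> (\<Sum>k. K / norm w ^ 4 * (1 / (Re w + real k) ^ Suc j))"
      unfolding tail_sum_def norm_minus_cancel using tb[OF t] sr[OF t] by (intro norm_suminf_le) auto
    also have "\<dots> = K / norm w ^ 4 * (\<Sum>k. (1 / (Re w + real k) ^ Suc j))"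
      using t R j by (intro suminf_mult inverse_power_sum(1)[of R]) auto
    also have "\<dots> \<le> K / norm w ^ 4 * ((1 / real j + 1 / R) / Re w ^ j)"
      using t R j K by (intro mult_left_mono inverse_power_sum(2)) auto
    finally show ?thesis by (simp add: weight_def)
  qed
  show "tail_sum f (w + 1) - tail_sum f w = f w" if t: "Re w > R"
    using suminf_split_head[OF s[OF t]] by (simp add: tail_sum_def add_ac)
  have "uniform_limit (halfplane R) (\<lambda>n w. \<Sum>k<n. f (w + of_nat k)) (\<lambda>w. \<Sum>k. f (w + of_nat k)) sequentially"
  proof (rule Weierstrass_m_test)
    show "summable (\<lambda>k. K * (1 / (R + real k) ^ Suc j))"
      using R j by (intro summable_mult inverse_power_sum(1)[of R]) auto
    fix k w assume "w \<in> halfplane R"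
    then have t: "Re w > R" by simp
    have "1 \<le> norm w" using t R complex_Re_le_cmod[of w] by linarith
    then have "K / norm w ^ 4 \<le> K / 1" using K by (intro divide_left_mono) (auto intro: one_le_power)
    then have "K / norm w ^ 4 * (1 / (Re w + real k) ^ Suc j) \<le> K * (1 / (R + real k) ^ Suc j)"
      using t R K by (intro mult_mono divide_left_mono power_mono mult_pos_pos zero_less_power) auto
    with tb[OF t, of k] show "norm (f (w + of_nat k)) \<le> K * (1 / (R + real k) ^ Suc j)" by linarith
  qed
  moreover have "(\<lambda>w. \<Sum>k<n. f (w + of_nat k)) holomorphic_on halfplane R" for n
  proof (intro holomorphic_intros)
    fix k
    have "(f \<circ> (\<lambda>w. w + of_nat k)) holomorphic_on halfplane R"
      by (intro holomorphic_on_compose_gen[OF _ hol] holomorphic_intros) auto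
    then show "(\<lambda>w. f (w + of_nat k)) holomorphic_on halfplane R" by (simp add: o_def)
  qed
  ultimately have "(\<lambda>w. \<Sum>k. f (w + of_nat k)) holomorphic_on halfplane R"
    by (rule holomorphic_uniform_limit_open[OF open_halfplane, rotated])
  then show "tail_sum f holomorphic_on halfplane R"
    unfolding tail_sum_def[abs_def] by (intro holomorphic_intros)
qed

lemma geometric_holomorphic_limit:
  fixes g :: "nat \<Rightarrow> complex \<Rightarrow> complex"
  assumes S: "open S" and hol: "\<And>n. g n holomorphic_on S"
    and bd: "\<And>n w. w \<in> S \<Longrightarrow> norm (g (Suc n) w - g n w) \<le> (1/2) ^ n * b w"
    and b: "\<And>w. w \<in> S \<Longrightarrow> b w \<le> 1"
  obtains h where "h holomorphic_on S" 
    "\<And>n w. w \<in> S \<Longrightarrow> norm (h w - g n w) \<le> 2 * (1/2) ^ n * b w"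
    "\<And>w. w \<in> S \<Longrightarrow> (\<lambda>n. g n w) \<longlonglongrightarrow> h w"
proof -
  define h where "h w = g 0 w + (\<Sum>n. g (Suc n) w - g n w)" for w
  have near: "norm (h w - g n w) \<le> 2 * (1/2) ^ n * b w" if t: "w \<in> S" for n w
  proof -
    have s: "summable (\<lambda>n. g (Suc n) w - g n w)"
      by (rule summable_comparison_test'[of "\<lambda>n. (1/2) ^ n * b w" 0])
         (use bd[OF t] in \<open>auto intro!: summable_mult2 summable_geometric\<close>)
    then have "(\<lambda>i. g (Suc (i + n)) w - g (i + n) w) sums
        ((\<Sum>n. g (Suc n) w - g n w) - (\<Sum>i<n. g (Suc i) w - g i w))"
      using sums_split_initial_segment[OF summable_sums[OF s], of n] by simp
    also have "(\<Sum>i<n. g (Suc i) w - g i w) = g n w - g 0 w" by (rule sum_lessThan_telescope)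
    finally have 1: "(\<lambda>i. g (Suc (i + n)) w - g (i + n) w) sums (h w - g n w)"
      by (simp add: h_def algebra_simps)
    have 2: "(\<lambda>i. (1/2)^i * ((1/2)^n * b w)) sums (2 * ((1/2)^n * b w))"
      using geometric_sums[of "1/2::real"] by (intro sums_mult2) auto
    have "norm (suminf (\<lambda>i. g (Suc (i + n)) w - g (i + n) w)) \<le> suminf (\<lambda>i. (1/2)^i * ((1/2)^n * b w))"
    proof (rule norm_suminf_le)
      show "norm (g (Suc (i + n)) w - g (i + n) w) \<le> (1/2)^i * ((1/2)^n * b w)" for i
        using bd[OF t, of "i + n"] unfolding power_add by (simp only: mult.assoc)
    qed (use 2 in \<open>simp add: sums_iff\<close>)
    then show ?thesis using 1 2 by (simp add: sums_iff)
  qed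
  have lim: "uniform_limit S g h sequentially"
  proof (rule uniform_limitI)
    fix e :: real assume e: "e > 0"
    have "(\<lambda>n. 2 * (1/2::real) ^ n) \<longlonglongrightarrow> 0" by real_asymp
    then have "\<forall>\<^sub>F n in sequentially. 2 * (1/2::real) ^ n < e" by (rule order_tendstoD) (use e in auto)
    then show "\<forall>\<^sub>F n in sequentially. \<forall>w\<in>S. dist (g n w) (h w) < e"
    proof eventually_elim
      case (elim n)
      show ?case
      proof
        fix w assume t: "w \<in> S"
        have "norm (h w - g n w) \<le> 2 * (1/2) ^ n * b w" by (rule near[OF t])
        also have "\<dots> \<le> 2 * (1/2) ^ n * 1" using b[OF t] by (intro mult_left_mono) auto
        finally show "dist (g n w) (h w) < e" using elim by (simp add: dist_norm norm_minus_commute)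
      qed
    qed
  qed
  show ?thesis
  proof (rule that)
    show "h holomorphic_on S"
      using S hol lim by (rule holomorphic_uniform_limit_open)
    show "(\<lambda>n. g n w) \<longlonglongrightarrow> h w" if "w \<in> S" for w
      using tendsto_uniform_limitI[OF lim that] .
  qed (rule near)
qed

text \<open>
  Picard iteration for the system \<open>p (w + 1) - p w = E1\<close>, \<open>q (w + 1) - q w = E2\<close>. The second
  component is expected to be smaller than the first by one power of \<open>w\<close>, as \<open>z2\<close> is compared to \<open>z1\<close>.
  The Lipschitz conditions are adapted to this: with the weights \<open>m\<close> and \<open>m + 1\<close> for \<open>p\<close> and \<open>q\<close>, both
  right-hand sides lose exactly the power of \<open>Re w\<close> that the summation needs, and the constant \<open>L\<close>
  remains the same for all \<open>m\<close>.
\<close>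

theorem shadowing:
  fixes E1 E2 :: "complex \<Rightarrow> complex \<Rightarrow> complex \<Rightarrow> complex" and L R :: real and m :: nat
  defines "good \<equiv> (\<lambda>p q. p holomorphic_on halfplane R \<and> q holomorphic_on halfplane R \<and>
      (\<forall>w. Re w > R \<longrightarrow> norm (p w) \<le> weight m w \<and> norm (q w) \<le> weight (Suc m) w))"
  assumes R: "R \<ge> 1" and m: "m \<ge> 1" and L: "L \<ge> 0" "L * (1 / real m + 1 / R) \<le> 1/4"
    and hol: "\<And>p q. good p q \<Longrightarrow> (\<lambda>w. E1 w (p w) (q w)) holomorphic_on halfplane R"
      "\<And>p q. good p q \<Longrightarrow> (\<lambda>w. E2 w (p w) (q w)) holomorphic_on halfplane R"
    and lip: "\<And>w p q p' q'. Re w > R \<Longrightarrow> norm p \<le> weight m w \<Longrightarrow> norm p' \<le> weight m w \<Longrightarrow>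
        norm q \<le> weight (Suc m) w \<Longrightarrow> norm q' \<le> weight (Suc m) w \<Longrightarrow>
        norm (E1 w p q - E1 w p' q') \<le> L * (norm (q - q') + norm (p - p') / Re w) \<and>
        norm (E2 w p q - E2 w p' q') \<le> L * (norm (q - q') / Re w + norm (p - p') / (Re w)^2)"
    and zero: "\<And>w. Re w > R \<Longrightarrow> norm (E1 w 0 0) \<le> 2 * L * weight (Suc m) w \<and>
        norm (E2 w 0 0) \<le> 2 * L * weight (Suc (Suc m)) w"
  shows "\<exists>p q. good p q \<and> (\<forall>w. Re w > R \<longrightarrow>
      p (w + 1) - p w = E1 w (p w) (q w) \<and> q (w + 1) - q w = E2 w (p w) (q w))"
proof -
  define \<theta> where "\<theta> = 1 / real m + 1 / R"
  have \<theta>: "\<theta> \<ge> 0" "2 * L * \<theta> \<le> 1/2" and \<theta>': "1 / real (Suc m) + 1 / R \<le> \<theta>"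
  proof -
    show "2 * L * \<theta> \<le> 1/2" using L(2) unfolding \<theta>_def by linarith
  qed (use R m in \<open>auto simp: \<theta>_def frac_le\<close>)
  have wp: "Re w > R \<Longrightarrow> 0 < weight j w" for j w using R by (intro weight_pos) auto
  define G1 where "G1 p q = (\<lambda>w. E1 w (p w) (q w))" for p q
  define G2 where "G2 p q = (\<lambda>w. E2 w (p w) (q w))" for p q
  define close where "close K p q p' q' \<longleftrightarrow> (\<forall>w. Re w > R \<longrightarrow>
      norm (p w - p' w) \<le> K * weight m w \<and> norm (q w - q' w) \<le> K * weight (Suc m) w)"
    for K :: real and p q p' q' :: "complex \<Rightarrow> complex"
  have good0: "good (\<lambda>_. 0) (\<lambda>_. 0)"
    unfolding good_def using wp by (auto intro: less_imp_le)
  have Glip: "norm (G1 p q w - G1 p' q' w) \<le> 2 * L * K * weight (Suc m) w \<and> 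
       norm (G2 p q w - G2 p' q' w) \<le> 2 * L * K * weight (Suc (Suc m)) w"
    if "good p q" "good p' q'" "close K p q p' q'" "Re w > R" for p q p' q' K w
  proof -
    have Rt: "Re w > 0" using R that by linarith
    have c: "norm (p w - p' w) \<le> K * weight m w" "norm (q w - q' w) \<le> K * weight (Suc m) w"
      using that by (auto simp: close_def)
    have l: "norm (G1 p q w - G1 p' q' w) \<le> L * (norm (q w - q' w) + norm (p w - p' w) / Re w)"
      "norm (G2 p q w - G2 p' q' w) \<le> L * (norm (q w - q' w) / Re w + norm (p w - p' w) / (Re w)^2)"
      using lip[of w "p w" "p' w" "q w" "q' w"] that by (auto simp: good_def G1_def G2_def)
    have "L * (norm (q w - q' w) + norm (p w - p' w) / Re w) \<le> L * (K * weight (Suc m) w + K * weight m w / Re w)"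
      using c L(1) Rt by (intro mult_left_mono add_mono divide_right_mono) auto
    moreover have "L * (norm (q w - q' w) / Re w + norm (p w - p' w) / (Re w)^2) \<le> 
        L * (K * weight (Suc m) w / Re w + K * weight m w / (Re w)^2)"
      using c L(1) Rt by (intro mult_left_mono add_mono divide_right_mono) auto
    ultimately show ?thesis using l by (simp add: weight_Suc power2_eq_square algebra_simps)
  qed
  have G0: "norm (G1 (\<lambda>_. 0) (\<lambda>_. 0) w) \<le> 2 * L * weight (Suc m) w"
    "norm (G2 (\<lambda>_. 0) (\<lambda>_. 0) w) \<le> 2 * L * weight (Suc (Suc m)) w" if "Re w > R" for w
    using zero[OF that] by (auto simp: G1_def G2_def)
  have good_close: "close 1 p q (\<lambda>_. 0) (\<lambda>_. 0)" if "good p q" for p q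
    using that by (auto simp: good_def close_def)
  have Gbd: "norm (G1 p q w) \<le> 4 * L * weight (Suc m) w"
    "norm (G2 p q w) \<le> 4 * L * weight (Suc (Suc m)) w" if "good p q" "Re w > R" for p q w
    using Glip[OF that(1) good0 good_close[OF that(1)] that(2)] G0[OF that(2)]
      norm_triangle_sub[of "G1 p q w" "G1 (\<lambda>_. 0) (\<lambda>_. 0) w"]
      norm_triangle_sub[of "G2 p q w" "G2 (\<lambda>_. 0) (\<lambda>_. 0) w"] by linarith+
  have Ghol: "G1 p q holomorphic_on halfplane R" "G2 p q holomorphic_on halfplane R" if "good p q" for p q
    using hol[OF that] by (simp_all add: G1_def G2_def)
  define T1 where "T1 p q = tail_sum (G1 p q)" for p q
  define T2 where "T2 p q = tail_sum (G2 p q)" for p q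
  note ts1 = tail_sum[OF R m, of "4 * L"] and ts2 = tail_sum[OF R le_SucI[OF m], of "4 * L"]
  have L4: "4 * L \<ge> 0" using L by simp
  have bound_half: "C * (1 / real j + 1 / R) * w \<le> (K / 2) * w"
    if "C = 2 * L * K" "K \<ge> 0" "w \<ge> 0" "j = m \<or> j = Suc m" for C K w :: real and j
  proof -
    have "1 / real j + 1 / R \<le> \<theta>" using that \<theta>' by (auto simp: \<theta>_def)
    then have "C * (1 / real j + 1 / R) \<le> C * \<theta>" using that L by (intro mult_left_mono) auto
    also have "\<dots> = K * (2 * L * \<theta>)" using that by simp
    also have "\<dots> \<le> K * (1/2)" using that \<theta> by (intro mult_left_mono) auto
    finally show ?thesis using that by (intro mult_right_mono) auto
  qed
  have Tlip: "close (K / 2) (T1 p q) (T2 p q) (T1 p' q') (T2 p' q')"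
    if g: "good p q" "good p' q'" and c: "close K p q p' q'" and K: "K \<ge> 0" for p q p' q' K
    unfolding close_def
  proof (intro allI impI conjI)
    fix w assume t: "Re w > R"
    have K': "0 \<le> 2 * L * K" using L K by simp
    have "T1 p q w - T1 p' q' w = tail_sum (\<lambda>w. G1 p q w - G1 p' q' w) w"
      unfolding T1_def tail_sum_def minus_diff_minus
      using suminf_diff[OF ts1(1)[OF L4 Ghol(1)[OF g(1)] Gbd(1)[OF g(1)] t] ts1(1)[OF L4 Ghol(1)[OF g(2)] Gbd(1)[OF g(2)] t]] 
      by simp
    also have "norm \<dots> \<le> 2 * L * K * (1 / real m + 1 / R) * weight m w"
      using Glip[OF g c] Ghol[OF g(1)] Ghol[OF g(2)]
      by (intro tail_sum_bound[OF R m K' _ _ t] holomorphic_intros) auto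
    also have "\<dots> \<le> K / 2 * weight m w" using K wp[OF t, of m] by (intro bound_half) auto
    finally show "norm (T1 p q w - T1 p' q' w) \<le> K / 2 * weight m w" .
    have "T2 p q w - T2 p' q' w = tail_sum (\<lambda>w. G2 p q w - G2 p' q' w) w"
      unfolding T2_def tail_sum_def minus_diff_minus
      using suminf_diff[OF ts2(1)[OF L4 Ghol(2)[OF g(1)] Gbd(2)[OF g(1)] t] ts2(1)[OF L4 Ghol(2)[OF g(2)] Gbd(2)[OF g(2)] t]] 
      by simp
    also have "norm \<dots> \<le> 2 * L * K * (1 / real (Suc m) + 1 / R) * weight (Suc m) w"
      using Glip[OF g c] Ghol[OF g(1)] Ghol[OF g(2)]
      by (intro tail_sum_bound[OF R le_SucI[OF m] K' _ _ t] holomorphic_intros) auto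
    also have "\<dots> \<le> K / 2 * weight (Suc m) w" using K wp[OF t, of "Suc m"] by (intro bound_half) auto
    finally show "norm (T2 p q w - T2 p' q' w) \<le> K / 2 * weight (Suc m) w" .
  qed
  have Tgood: "good (T1 p q) (T2 p q)" if g: "good p q" for p q
    unfolding good_def
  proof (intro conjI allI impI)
    show "T1 p q holomorphic_on halfplane R" unfolding T1_def
      by (rule ts1(4)[OF L4 Ghol(1)[OF g] Gbd(1)[OF g]])
    show "T2 p q holomorphic_on halfplane R" unfolding T2_def
      by (rule ts2(4)[OF L4 Ghol(2)[OF g] Gbd(2)[OF g]])
    fix w assume t: "Re w > R"
    have "norm (T1 p q w) \<le> 4 * L * (1 / real m + 1 / R) * weight m w" unfolding T1_def
      by (rule ts1(2)[OF L4 Ghol(1)[OF g] Gbd(1)[OF g] t])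
    also have "\<dots> \<le> 2 / 2 * weight m w" using wp[OF t, of m] by (intro bound_half) auto
    finally show "norm (T1 p q w) \<le> weight m w" by simp
    have "norm (T2 p q w) \<le> 4 * L * (1 / real (Suc m) + 1 / R) * weight (Suc m) w" unfolding T2_def
      by (rule ts2(2)[OF L4 Ghol(2)[OF g] Gbd(2)[OF g] t])
    also have "\<dots> \<le> 2 / 2 * weight (Suc m) w" using wp[OF t, of "Suc m"] by (intro bound_half) auto
    finally show "norm (T2 p q w) \<le> weight (Suc m) w" by simp
  qed
  \<comment> \<open>Picard iteration from zero; successive iterates differ by at most \<open>(1/2)\<^sup>n\<close> times the weights.\<close>
  define u where "u = rec_nat ((\<lambda>_. 0), (\<lambda>_. 0)) (\<lambda>_ v. (T1 (fst v) (snd v), T2 (fst v) (snd v)))"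
  define P where "P n = fst (u n)" for n
  define Q where "Q n = snd (u n)" for n
  have PQ0: "P 0 = (\<lambda>_. 0)" "Q 0 = (\<lambda>_. 0)" by (simp_all add: P_def Q_def u_def)
  have PQS: "P (Suc n) = T1 (P n) (Q n)" "Q (Suc n) = T2 (P n) (Q n)" for n by (simp_all add: P_def Q_def u_def)
  have gPQ: "good (P n) (Q n)" for n
    by (induction n) (auto simp: PQ0 PQS good0 intro: Tgood)
  have cPQ: "close ((1/2) ^ n) (P (Suc n)) (Q (Suc n)) (P n) (Q n)" for n
  proof (induction n)
    case 0
    show ?case using good_close[OF gPQ[of "Suc 0"]] by (simp add: PQ0)
  next
    case (Suc n)
    show ?case using Tlip[OF gPQ gPQ Suc.IH] by (simp add: PQS)
  qed
  have w1: "w \<in> halfplane R \<Longrightarrow> weight j w \<le> 1" for w j using R by (intro weight_le_one) auto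
  obtain p where p: "p holomorphic_on halfplane R" 
    "\<And>n w. w \<in> halfplane R \<Longrightarrow> norm (p w - P n w) \<le> 2 * (1/2) ^ n * weight m w"
    "\<And>w. w \<in> halfplane R \<Longrightarrow> (\<lambda>n. P n w) \<longlonglongrightarrow> p w"
    by (rule geometric_holomorphic_limit[of "halfplane R" P "weight m"])
       (use gPQ cPQ w1 in \<open>auto simp: open_halfplane good_def close_def\<close>)
  obtain q where q: "q holomorphic_on halfplane R" 
    "\<And>n w. w \<in> halfplane R \<Longrightarrow> norm (q w - Q n w) \<le> 2 * (1/2) ^ n * weight (Suc m) w"
    "\<And>w. w \<in> halfplane R \<Longrightarrow> (\<lambda>n. Q n w) \<longlonglongrightarrow> q w"
    by (rule geometric_holomorphic_limit[of "halfplane R" Q "weight (Suc m)"])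
       (use gPQ cPQ w1 in \<open>auto simp: open_halfplane good_def close_def\<close>)
  have gpq: "good p q"
    unfolding good_def
  proof (intro conjI allI impI p(1) q(1))
    fix w assume "Re w > R"
    then have t: "w \<in> halfplane R" by simp
    show "norm (p w) \<le> weight m w"
      by (rule LIMSEQ_le_const2[OF tendsto_norm[OF p(3)[OF t]]]) (use gPQ t in \<open>auto simp: good_def\<close>)
    show "norm (q w) \<le> weight (Suc m) w"
      by (rule LIMSEQ_le_const2[OF tendsto_norm[OF q(3)[OF t]]]) (use gPQ t in \<open>auto simp: good_def\<close>)
  qed
  have cl: "close (2 * (1/2)^n) (T1 p q) (T2 p q) (P (Suc n)) (Q (Suc n))" for n
  proof -
    have "close (2 * (2 * (1/2)^n) / 2) (T1 p q) (T2 p q) (T1 (P n) (Q n)) (T2 (P n) (Q n))"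
    proof (rule Tlip[OF gpq gPQ])
      have le: "2 * (1/2)^n * weight j w \<le> 2 * (2 * (1/2)^n) * weight j w" if "Re w > R" for j w
        using wp[OF that, of j] by (intro mult_right_mono) auto
      show "close (2 * (2 * (1/2)^n)) p q (P n) (Q n)"
        unfolding close_def
      proof (intro allI impI conjI)
        fix w assume t: "Re w > R"
        show "norm (p w - P n w) \<le> 2 * (2 * (1/2)^n) * weight m w"
          by (rule order.trans[OF p(2) le]) (use t in auto)
        show "norm (q w - Q n w) \<le> 2 * (2 * (1/2)^n) * weight (Suc m) w"
          by (rule order.trans[OF q(2) le]) (use t in auto)
      qed
    qed auto
    then show ?thesis by (simp add: PQS)
  qed
  have lim0: "(\<lambda>n. 2 * (1/2::real)^n * w) \<longlonglongrightarrow> 0" for w by real_asymp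
  have fix1: "T1 p q w = p w" and fix2: "T2 p q w = q w" if t: "Re w > R" for w
  proof -
    have "(\<lambda>n. T1 p q w - P (Suc n) w) \<longlonglongrightarrow> 0"
      by (rule Lim_null_comparison[OF _ lim0[of "weight m w"]]) (use cl t in \<open>auto simp: close_def\<close>)
    moreover have "(\<lambda>n. T1 p q w - P (Suc n) w) \<longlonglongrightarrow> T1 p q w - p w"
      by (intro tendsto_intros LIMSEQ_Suc p(3)) (use t in auto)
    ultimately show "T1 p q w = p w" using LIMSEQ_unique by fastforce
    have "(\<lambda>n. T2 p q w - Q (Suc n) w) \<longlonglongrightarrow> 0"
      by (rule Lim_null_comparison[OF _ lim0[of "weight (Suc m) w"]]) (use cl t in \<open>auto simp: close_def\<close>)
    moreover have "(\<lambda>n. T2 p q w - Q (Suc n) w) \<longlonglongrightarrow> T2 p q w - q w"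
      by (intro tendsto_intros LIMSEQ_Suc q(3)) (use t in auto)
    ultimately show "T2 p q w = q w" using LIMSEQ_unique by fastforce
  qed
  show ?thesis
  proof (rule exI[of _ p], rule exI[of _ q], rule conjI[OF gpq], intro allI impI conjI)
    fix w assume t: "Re w > R"
    then have t1: "Re (w + 1) > R" by simp
    show "p (w + 1) - p w = E1 w (p w) (q w)"
      using ts1(3)[OF L4 Ghol(1)[OF gpq] Gbd(1)[OF gpq] t] fix1[OF t] fix1[OF t1] by (simp add: T1_def G1_def)
    show "q (w + 1) - q w = E2 w (p w) (q w)"
      using ts2(3)[OF L4 Ghol(2)[OF gpq] Gbd(2)[OF gpq] t] fix2[OF t] fix2[OF t1] by (simp add: T2_def G2_def)
  qed
qed

section \<open>Approximate solutions of any order\<close>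

text \<open>
  For \<open>l = 0\<close> this is integration. For \<open>l \<noteq> 0\<close> the polynomial \<open>- Q / l\<close> solves the equation up to a term of smaller
  degree.
\<close>

lemma pderiv_shift_surj:
  fixes Q :: "complex poly"
  shows "\<exists>P. pderiv P - Polynomial.smult l P = Q"
proof (cases "l = 0")
  case True
  define P where "P = (\<Sum>i\<le>Polynomial.degree Q. Polynomial.monom (Polynomial.coeff Q i / of_nat (Suc i)) (Suc i))"
  have "pderiv P = (\<Sum>i\<le>Polynomial.degree Q. Polynomial.monom (Polynomial.coeff Q i) i)"
    unfolding P_def higher_pderiv_sum[of 1, simplified] pderiv_monom
    by (intro sum.cong refl) (simp del: of_nat_Suc)
  also have "\<dots> = Q" by (rule poly_as_sum_of_monoms)
  finally show ?thesis using True by auto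
next
  case False
  show ?thesis
  proof (induction "Polynomial.degree Q" arbitrary: Q rule: less_induct)
    case (less Q)
    obtain P where P: "pderiv P - Polynomial.smult l P = Polynomial.smult (1/l) (pderiv Q)"
    proof (cases "Polynomial.degree Q = 0")
      case True
      then have "pderiv Q = 0" by (simp add: pderiv_eq_0_iff)
      then show ?thesis using that[of 0] by simp
    next
      case nz: False
      have "Polynomial.degree (Polynomial.smult (1/l) (pderiv Q)) < Polynomial.degree Q" using nz False by (simp add: degree_pderiv)
      from less.hyps[OF this] that show ?thesis by blast
    qed
    have "pderiv (P - Polynomial.smult (1/l) Q) - Polynomial.smult l (P - Polynomial.smult (1/l) Q) = 
      (pderiv P - Polynomial.smult l P) - (Polynomial.smult (1/l) (pderiv Q) - Q)"
      using False by (simp add: pderiv_diff pderiv_smult smult_diff_right)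
    also have "\<dots> = Q" by (simp add: P)
    finally show ?case by blast
  qed
qed

text \<open>
  With \<open>D\<close> the differentiation and \<open>A\<close> the matrix of the system, the adjugate of \<open>D - A\<close> reduces the
  system to two equations \<open>\<chi>(D) v = P\<close>, \<open>\<chi>(D) w = Q\<close>, where \<open>\<chi>\<close> is the characteristic polynomial of
  \<open>A\<close>. It splits into linear factors, to which \<open>pderiv_shift_surj\<close> applies.
\<close>

lemma poly_linear_system:
  fixes A11 A12 A21 A22 :: complex and P Q :: "complex poly"
  shows "\<exists>p q. pderiv p = Polynomial.smult A11 p + Polynomial.smult A12 q + P \<and> pderiv q = Polynomial.smult A21 p + Polynomial.smult A22 q + Q"
proof -
  define S where "S = A11 + A22"
  define D where "D = A11 * A22 - A12 * A21"
  define d where "d = csqrt (S^2 - 4 * D)"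
  define l1 where "l1 = (S + d) / 2"
  define l2 where "l2 = (S - d) / 2"
  have dd: "d * d = S * S - 4 * D" unfolding d_def using power2_csqrt[of "S^2 - 4 * D"] by (simp add: power2_eq_square)
  have l: "l1 + l2 = S" "l1 * l2 = D"
    using dd by (auto simp: l1_def l2_def field_simps)
  have chi: "\<exists>w. pderiv (pderiv w) = Polynomial.smult S (pderiv w) - Polynomial.smult D w + Q" for Q
  proof -
    obtain v where v: "pderiv v - Polynomial.smult l1 v = Q" using pderiv_shift_surj by blast
    obtain w where w: "pderiv w - Polynomial.smult l2 w = v" using pderiv_shift_surj by blast
    have "Q = pderiv (pderiv w) - Polynomial.smult (l1 + l2) (pderiv w) + Polynomial.smult (l1 * l2) w"
      unfolding v[symmetric] w[symmetric]
      by (simp add: pderiv_diff pderiv_smult smult_diff_right smult_add_left)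
    then show ?thesis unfolding l by (intro exI[of _ w]) simp
  qed
  obtain v where v: "pderiv (pderiv v) = Polynomial.smult S (pderiv v) - Polynomial.smult D v + P" using chi by blast
  obtain w where w: "pderiv (pderiv w) = Polynomial.smult S (pderiv w) - Polynomial.smult D w + Q" using chi by blast
  define p where "p = pderiv v - Polynomial.smult A22 v + Polynomial.smult A12 w"
  define q where "q = Polynomial.smult A21 v + pderiv w - Polynomial.smult A11 w"
  have "pderiv p = Polynomial.smult A11 p + Polynomial.smult A12 q + P" "pderiv q = Polynomial.smult A21 p + Polynomial.smult A22 q + Q"
    unfolding p_def q_def
    by (simp_all add: pderiv_diff pderiv_add pderiv_smult v w poly_eq_iff coeff_add S_def D_def algebra_simps
         smult_add_left smult_add_right smult_diff_left smult_diff_right)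
  then show ?thesis by blast
qed

lemma poly_Ln_over_power_derivative:
  assumes "Re w > 0"
  shows "((\<lambda>w. poly P (Ln w) / w ^ n) has_field_derivative
     (poly (pderiv P) (Ln w) - of_nat n * poly P (Ln w)) / w ^ Suc n) (at w)"
proof -
  have [simp]: "w \<noteq> 0" and nn: "w \<notin> \<real>\<^sub>\<le>\<^sub>0" using assms by (auto simp: complex_nonpos_Reals_iff)
  have L: "((\<lambda>w. poly P (Ln w)) has_field_derivative poly (pderiv P) (Ln w) * (1 / w)) (at w)"
    by (rule DERIV_chain2[OF poly_DERIV]) (use nn in \<open>auto intro!: derivative_eq_intros simp: divide_inverse\<close>)
  show ?thesis
    by (rule derivative_eq_intros L refl | simp)+ (cases n; simp add: field_simps)
qed

lemma soft_norm: "f \<in> soft_O s \<Longrightarrow> (\<lambda>w. of_real (norm (f w))) \<in> soft_O s"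
  by (rule soft_transfer[of f s _ 1]) auto

text \<open>
  The setting for a fixed solution \<open>t\<close> of the quadratic equation: \<open>f1\<close> and \<open>f2\<close> agree with
  \<open>x + y + a x\<^sup>2\<close> up to weighted order \<open>3\<close> and with \<open>y + 2 b x y + c x\<^sup>3\<close> up to weighted order \<open>4\<close>.
  The equations for \<open>\<kappa>\<close> and \<open>t\<close> say that \<open>(\<kappa> / w, t \<kappa>\<^sup>2 / w\<^sup>2)\<close> solves
  \<open>z (w + 1) = F (z w)\<close> in the lowest order.
\<close>

locale parabolic_direction =
  fixes f1 f2 :: "complex \<times> complex \<Rightarrow> complex" and a b c t \<kappa> :: complex and C \<mu>0 :: real
  assumes f0: "f1 (0, 0) = 0" "f2 (0, 0) = 0"
    and expansion: "\<And>z1 z2. z1 \<in> log_polys \<Longrightarrow> z2 \<in> log_polys \<Longrightarrow> z1 \<in> soft_O 1 \<Longrightarrow> z2 \<in> soft_O 1 \<Longrightarrow> (\<lambda>w. f1 (z1 w, z2 w)) \<in> log_expandable"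
      "\<And>z1 z2. z1 \<in> log_polys \<Longrightarrow> z2 \<in> log_polys \<Longrightarrow> z1 \<in> soft_O 1 \<Longrightarrow> z2 \<in> soft_O 1 \<Longrightarrow> (\<lambda>w. f2 (z1 w, z2 w)) \<in> log_expandable"
    and C: "C \<ge> 0" "\<mu>0 > 0"
    and lip1: "weighted_lipschitz \<mu>0 1 C (\<lambda>(x, y). f1 (x, y) - x - y - a * x^2)"
    and lip2: "weighted_lipschitz \<mu>0 2 C (\<lambda>(x, y). f2 (x, y) - y - 2 * b * x * y - c * x^3)"
    and direction: "(a + t) * \<kappa> = -1" "2 * b * t + c = 2 * t * (a + t)"
begin

definition "r1 x y = f1 (x, y) - x - y - a * x^2"
definition "r2 x y = f2 (x, y) - y - 2 * b * x * y - c * x^3"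

text \<open>
  A constant with \<open>\<bar>z1 w\<bar> \<le> K / \<bar>w\<bar>\<close> and \<open>\<bar>z2 w\<bar> \<le> (K / \<bar>w\<bar>)\<^sup>2\<close> for all approximate solutions,
  whatever their order.
\<close>

definition K :: real where "K = norm \<kappa> + norm t * norm \<kappa> ^ 2 + 1"

lemma K_ge: "K \<ge> 1" by (simp add: K_def)

lemma leading_bound:
  assumes "(\<lambda>w. z1 w - \<kappa> / w) \<in> soft_O 2" "(\<lambda>w. z2 w - t * \<kappa>^2 / w^2) \<in> soft_O 3"
  shows "\<forall>\<^sub>F w in right_inf. norm (z1 w) \<le> K / norm w \<and> norm (z2 w) \<le> (K / norm w)^2"
proof -
  obtain R1 where R1: "R1 \<ge> 1" "\<And>w. Re w > R1 \<Longrightarrow> norm (z1 w - \<kappa> / w) \<le> 1 / norm w ^ 1"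
    using soft_small[OF assms(1), of 1 1] by auto
  obtain R2 where R2: "R2 \<ge> 1" "\<And>w. Re w > R2 \<Longrightarrow> norm (z2 w - t * \<kappa>^2 / w^2) \<le> 1 / norm w ^ 2"
    using soft_small[OF assms(2), of 2 1] by auto
  show ?thesis unfolding eventually_right_inf
  proof (intro exI[of _ "max R1 R2"] allI impI)
    fix w assume t: "Re w > max R1 R2"
    have nt: "norm w > 0" using t R1 R2 complex_Re_le_cmod[of w] by auto
    have "norm (z1 w) \<le> norm (\<kappa> / w) + norm (z1 w - \<kappa> / w)" by (rule norm_triangle_sub)
    also have "\<dots> \<le> norm \<kappa> / norm w + 1 / norm w" using R1(2)[of w] t by (simp add: norm_divide)
    also have "\<dots> = (norm \<kappa> + 1) / norm w" by (simp add: add_divide_distrib)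
    also have "\<dots> \<le> K / norm w" by (intro divide_right_mono) (auto simp: K_def)
    finally have 1: "norm (z1 w) \<le> K / norm w" .
    have "norm (z2 w) \<le> norm (t * \<kappa>^2 / w^2) + norm (z2 w - t * \<kappa>^2 / w^2)" by (rule norm_triangle_sub)
    also have "\<dots> \<le> norm t * norm \<kappa>^2 / norm w^2 + 1 / norm w^2" using R2(2)[of w] t by (simp add: norm_divide norm_mult norm_power)
    also have "\<dots> = (norm t * norm \<kappa>^2 + 1) / norm w^2" by (simp add: add_divide_distrib)
    also have "\<dots> \<le> K^2 / norm w^2"
    proof (intro divide_right_mono)
      have "K * 1 \<le> K * K" using K_ge by (intro mult_left_mono) auto
      moreover have "norm t * norm \<kappa>^2 + 1 \<le> K" by (simp add: K_def)
      ultimately show "norm t * norm \<kappa>^2 + 1 \<le> K^2" by (simp add: power2_eq_square)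
    qed auto
    finally show "norm (z1 w) \<le> K / norm w \<and> norm (z2 w) \<le> (K / norm w)^2" using 1 by (simp add: power_divide)
  qed
qed

text \<open>
  A perturbation of order \<open>s\<close> in \<open>z1\<close> and \<open>s + 1\<close> in \<open>z2\<close> changes a function of weighted order \<open>d + 3\<close>
  in the order \<open>s + d + 2\<close>. For the remainders of \<open>f1\<close> and \<open>f2\<close> this is one order more than that of the
  terms that determine the next coefficients.
\<close>

lemma weighted_lipschitz_soft:
  assumes h: "weighted_lipschitz \<mu>0 (Suc d) C h"
    and z: "\<forall>\<^sub>F w in right_inf. norm (z1 w) \<le> K / norm w \<and> norm (z2 w) \<le> (K / norm w)^2"
    and y: "\<forall>\<^sub>F w in right_inf. norm (y1 w) \<le> K / norm w \<and> norm (y2 w) \<le> (K / norm w)^2"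
    and p: "(\<lambda>w. y1 w - z1 w) \<in> soft_O s" and q: "(\<lambda>w. y2 w - z2 w) \<in> soft_O (s + 1)"
  shows "(\<lambda>w. h (y1 w, y2 w) - h (z1 w, z2 w)) \<in> soft_O (s + real d + 2)"
proof -
  define g :: "complex \<Rightarrow> complex" where "g w = of_real (norm ((y1 w - z1 w) / w ^ (d + 2))) + of_real (norm ((y2 w - z2 w) / w ^ (d + 1)))" for w
  have g: "g \<in> soft_O (s + real d + 2)"
    unfolding g_def[abs_def] by (intro soft_add soft_norm soft_divide_power[OF p] soft_divide_power[OF q]) auto
  have K0: "K > 0" using K_ge by simp
  show ?thesis
  proof (rule soft_transfer[OF g, of _ "C * K ^ (d + 2)"])
    show "\<forall>\<^sub>F w in right_inf. norm (h (y1 w, y2 w) - h (z1 w, z2 w)) \<le> C * K ^ (d + 2) * norm (g w)"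
      using z y eventually_right_inf_norm[of "K / \<mu>0"] eventually_right_inf_norm[of 1]
    proof eventually_elim
      case (elim w)
      have "norm w > 0" using elim(4) by linarith
      moreover have "K < norm w * \<mu>0" using elim(3) C by (simp add: pos_divide_less_eq)
      ultimately have \<mu>: "0 < K / norm w" "K / norm w \<le> \<mu>0" using K0 by (simp_all add: pos_divide_le_eq mult.commute)
      have "norm (h (y1 w, y2 w) - h (z1 w, z2 w))
          \<le> C * ((K / norm w) ^ (d + 2) * norm (y1 w - z1 w) + (K / norm w) ^ (d + 1) * norm (y2 w - z2 w))"
        using weighted_lipschitzD[OF h \<mu>, of "y1 w" "z1 w" "y2 w" "z2 w"] elim by simp
      also have "\<dots> \<le> C * ((K / norm w) ^ (d + 2) * norm (y1 w - z1 w) + (K ^ (d + 2) / norm w ^ (d + 1)) * norm (y2 w - z2 w))"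
        unfolding power_divide[of K _ "d + 1"] using C K_ge power_increasing[of "d + 1" "d + 2" K]
        by (intro mult_left_mono add_left_mono mult_right_mono divide_right_mono) auto
      also have "\<dots> = C * K ^ (d + 2) * (norm ((y1 w - z1 w) / w ^ (d + 2)) + norm ((y2 w - z2 w) / w ^ (d + 1)))"
        by (simp only: norm_divide norm_power power_divide distrib_left times_divide_eq_left times_divide_eq_right mult_ac)
      also have "\<dots> = C * K ^ (d + 2) * norm (g w)"
        unfolding g_def of_real_add[symmetric] norm_of_real by simp
      finally show ?case .
    qed
  qed
qed

lemma remainder_soft:
  assumes "\<forall>\<^sub>F w in right_inf. norm (z1 w) \<le> K / norm w \<and> norm (z2 w) \<le> (K / norm w)^2"
    "\<forall>\<^sub>F w in right_inf. norm (y1 w) \<le> K / norm w \<and> norm (y2 w) \<le> (K / norm w)^2"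
    "(\<lambda>w. y1 w - z1 w) \<in> soft_O s" "(\<lambda>w. y2 w - z2 w) \<in> soft_O (s + 1)"
  shows "(\<lambda>w. r1 (y1 w) (y2 w) - r1 (z1 w) (z2 w)) \<in> soft_O (s + 2)"
    and "(\<lambda>w. r2 (y1 w) (y2 w) - r2 (z1 w) (z2 w)) \<in> soft_O (s + 3)"
  using weighted_lipschitz_soft[OF lip1[unfolded One_nat_def] assms]
    weighted_lipschitz_soft[OF lip2[unfolded numeral_2_eq_2] assms]
  by (simp_all add: r1_def r2_def add.assoc)

definition approx_solution :: "nat \<Rightarrow> (complex \<Rightarrow> complex) \<Rightarrow> (complex \<Rightarrow> complex) \<Rightarrow> bool" where
  "approx_solution n g1 g2 \<longleftrightarrow> g1 \<in> log_polys \<and> g2 \<in> log_polys \<and> (\<exists>z1 z2.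
     z1 = (\<lambda>w. \<kappa> / w + g1 w / w^2) \<and> z2 = (\<lambda>w. t * \<kappa>^2 / w^2 + g2 w / w^3) \<and>
     (\<lambda>w. f1 (z1 w, z2 w) - z1 (w + 1)) \<in> soft_O (real n + 1) \<and>
     (\<lambda>w. f2 (z1 w, z2 w) - z2 (w + 1)) \<in> soft_O (real n + 2))"

lemma leading_form:
  assumes "g1 \<in> log_polys" "g2 \<in> log_polys"
    and z1_def: "z1 = (\<lambda>w. \<kappa> / w + g1 w / w^2)" and z2_def: "z2 = (\<lambda>w. t * \<kappa>^2 / w^2 + g2 w / w^3)"
  shows "z1 \<in> log_polys" "z2 \<in> log_polys" "z1 \<in> soft_O 1" "z2 \<in> soft_O 2"
    "(\<lambda>w. z1 w - \<kappa> / w) \<in> soft_O 2" "(\<lambda>w. z2 w - t * \<kappa>^2 / w^2) \<in> soft_O 3"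
proof -
  have e: "z1 = (\<lambda>w. \<kappa> / w^1 + g1 w / w^2)" by (simp add: z1_def)
  note soft_quot = soft_divide_power[OF log_polys_soft]
  show "z1 \<in> log_polys" unfolding e
    by (rule log_polys.add[OF log_polys_divide_power[OF log_polys.const] log_polys_divide_power[OF assms(1)]])
  show "z2 \<in> log_polys" unfolding z2_def
    by (rule log_polys.add[OF log_polys_divide_power[OF log_polys.const] log_polys_divide_power[OF assms(2)]])
  show "z1 \<in> soft_O 1" unfolding e
    by (rule soft_add[OF soft_quot[OF log_polys.const] soft_quot[OF assms(1)]]) simp_all
  show "z2 \<in> soft_O 2" unfolding z2_def
    by (rule soft_add[OF soft_quot[OF log_polys.const] soft_quot[OF assms(2)]]) simp_all
  show "(\<lambda>w. z1 w - \<kappa> / w) \<in> soft_O 2"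
    unfolding z1_def add_diff_cancel_left' by (rule soft_quot[OF assms(1)]) simp
  show "(\<lambda>w. z2 w - t * \<kappa>^2 / w^2) \<in> soft_O 3"
    unfolding z2_def add_diff_cancel_left' by (rule soft_quot[OF assms(2)]) simp
qed

lemma approx_solution_base: "approx_solution 2 (\<lambda>_. 0) (\<lambda>_. 0)"
proof -
  define z1 where "z1 = (\<lambda>w. \<kappa> / w + 0 / w^2)"
  define z2 where "z2 = (\<lambda>w. t * \<kappa>^2 / w^2 + 0 / w^3)"
  note lf = leading_form[OF log_polys.const[of 0] log_polys.const[of 0] z1_def z2_def]
  have r: "(\<lambda>w. r1 (z1 w) (z2 w) - r1 0 0) \<in> soft_O (1 + 2)" "(\<lambda>w. r2 (z1 w) (z2 w) - r2 0 0) \<in> soft_O (1 + 3)"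
  proof -
    have z0: "\<forall>\<^sub>F w in right_inf. norm (0::complex) \<le> K / norm w \<and> norm (0::complex) \<le> (K / norm w)^2"
      using K_ge by (simp add: zero_le_power)
    have d: "(\<lambda>w. z1 w - 0) \<in> soft_O 1" "(\<lambda>w. z2 w - 0) \<in> soft_O (1 + 1)" using lf(3,4) by simp_all
    note rs = remainder_soft[where ?z1.0 = "\<lambda>_. 0" and ?z2.0 = "\<lambda>_. 0", OF z0 leading_bound[OF lf(5,6)] d]
    show "(\<lambda>w. r1 (z1 w) (z2 w) - r1 0 0) \<in> soft_O (1 + 2)" by (rule rs(1))
    show "(\<lambda>w. r2 (z1 w) (z2 w) - r2 0 0) \<in> soft_O (1 + 3)" by (rule rs(2))
  qed
  have e3: "1 + 2 = (3::real)" "real 1 + 2 = 3" and e4: "1 + 3 = (4::real)" "real 2 + 2 = 4" by simp_all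
  have r0: "r1 0 0 = 0" "r2 0 0 = 0" using f0 by (auto simp: r1_def r2_def)
  have s1: "(\<lambda>w. \<kappa> / (w + 1)^1 - \<kappa> / w^1 - (- \<kappa> / w^2)) \<in> soft_O (real 1 + 2)"
    by (rule shift_first_order[OF log_polys.const])
       (auto intro!: derivative_eq_intros simp: field_simps power2_eq_square)
  have s2: "(\<lambda>w. (t * \<kappa>^2) / (w + 1)^2 - (t * \<kappa>^2) / w^2 - (- 2 * t * \<kappa>^2 / w^3)) \<in> soft_O (real 2 + 2)"
    by (rule shift_first_order[OF log_polys.const])
       (auto intro!: derivative_eq_intros simp: field_simps power2_eq_square power3_eq_cube)
  have "(\<lambda>w. f1 (z1 w, z2 w) - z1 (w + 1)) \<in> soft_O 3"
  proof (rule soft_cong)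
    show "(\<lambda>w. (r1 (z1 w) (z2 w) - r1 0 0) - (\<kappa> / (w + 1)^1 - \<kappa> / w^1 - (- \<kappa> / w^2))) \<in> soft_O 3" (is "?h \<in> _")
      by (rule soft_diff[OF r(1)[unfolded e3] s1[unfolded e3]])
    show "\<forall>\<^sub>F w in right_inf. f1 (z1 w, z2 w) - z1 (w + 1) = ?h w"
      using eventually_right_inf_gt[of 0]
    proof eventually_elim
      case (elim w)
      have "z2 w + a * (z1 w)^2 + \<kappa> / w^2 = \<kappa> * ((a + t) * \<kappa> + 1) / w^2"
        by (simp add: z1_def z2_def power_divide add_divide_distrib[symmetric] power2_eq_square algebra_simps)
      then have "z2 w + a * (z1 w)^2 + \<kappa> / w^2 = 0" by (simp add: direction)
      then show ?case unfolding r0 by (simp add: r1_def z1_def algebra_simps)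
    qed
  qed
  moreover have "(\<lambda>w. f2 (z1 w, z2 w) - z2 (w + 1)) \<in> soft_O 4"
  proof (rule soft_cong)
    show "(\<lambda>w. (r2 (z1 w) (z2 w) - r2 0 0) - ((t * \<kappa>^2) / (w + 1)^2 - (t * \<kappa>^2) / w^2 - (- 2 * t * \<kappa>^2 / w^3))) \<in> soft_O 4" (is "?h \<in> _")
      by (rule soft_diff[OF r(2)[unfolded e4] s2[unfolded e4]])
    show "\<forall>\<^sub>F w in right_inf. f2 (z1 w, z2 w) - z2 (w + 1) = ?h w"
      using eventually_right_inf_gt[of 0]
    proof eventually_elim
      case (elim w)
      have "2 * b * z1 w * z2 w + c * (z1 w)^3 + 2 * t * \<kappa>^2 / w^3 = \<kappa>^2 * ((2 * b * t + c) * \<kappa> + 2 * t) / w^3"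
        by (simp add: z1_def z2_def power_divide add_divide_distrib[symmetric] power2_eq_square power3_eq_cube algebra_simps)
      also have "(2 * b * t + c) * \<kappa> + 2 * t = 2 * t * ((a + t) * \<kappa> + 1)" unfolding direction(2) by (simp add: algebra_simps)
      finally have "2 * b * z1 w * z2 w + c * (z1 w)^3 + 2 * t * \<kappa>^2 / w^3 = 0" by (simp add: direction)
      then show ?case unfolding r0 by (simp add: r2_def z2_def algebra_simps)
    qed
  qed
  ultimately show ?thesis
    unfolding approx_solution_def using log_polys.const z1_def z2_def by (intro conjI exI[of _ z1] exI[of _ z2]) simp_all
qed

text \<open>
  The leading terms \<open>P / w\<^sup>n\<^sup>+\<^sup>1\<close> and \<open>Q / w\<^sup>n\<^sup>+\<^sup>2\<close> of the defects are removed by adding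
  \<open>p = u / w\<^sup>n\<close> to \<open>z1\<close> and \<open>q = v / w\<^sup>n\<^sup>+\<^sup>1\<close> to \<open>z2\<close>, where \<open>u\<close> and \<open>v\<close> are polynomials in \<open>log w\<close>. Up to
  higher order, the shift contributes the derivatives \<open>p'\<close> and \<open>q'\<close>, and \<open>F\<close> contributes
  \<open>q + 2 a (\<kappa> / w) p\<close> and \<open>2 b ((\<kappa> / w) q + (t \<kappa>\<^sup>2 / w\<^sup>2) p) + 3 c (\<kappa> / w)\<^sup>2 p\<close>. Comparing
  coefficients gives a linear system for \<open>u\<close> and \<open>v\<close> with constant coefficients.
\<close>

lemma approx_solution_step:
  assumes n: "n \<ge> 2" and ap: "approx_solution n g1 g2"
  shows "\<exists>h1 h2. approx_solution (Suc n) h1 h2"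
proof -
  define z1 where "z1 = (\<lambda>w. \<kappa> / w + g1 w / w^2)"
  define z2 where "z2 = (\<lambda>w. t * \<kappa>^2 / w^2 + g2 w / w^3)"
  have g: "g1 \<in> log_polys" "g2 \<in> log_polys" using ap by (auto simp: approx_solution_def)
  note lf = leading_form[OF g z1_def z2_def]
  define d1 where "d1 = (\<lambda>w. f1 (z1 w, z2 w) - z1 (w + 1))"
  define d2 where "d2 = (\<lambda>w. f2 (z1 w, z2 w) - z2 (w + 1))"
  have d: "d1 \<in> soft_O (real (n + 1))" "d2 \<in> soft_O (real (n + 2))"
  proof -
    have e: "real (n + 1) = real n + 1" "real (n + 2) = real n + 2" by simp_all
    show "d1 \<in> soft_O (real (n + 1))" "d2 \<in> soft_O (real (n + 2))"
      unfolding e using ap by (auto simp: approx_solution_def z1_def z2_def d1_def d2_def)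
  qed
  have "z2 \<in> soft_O 1" by (rule soft_mono[OF lf(4)]) simp
  note ex = expansion(1)[OF lf(1-3) this] expansion(2)[OF lf(1-3) this]
  have he: "d1 \<in> log_expandable" "d2 \<in> log_expandable" unfolding d1_def d2_def
    by (rule log_expandable_diff[OF ex(1) log_expandable_shift[OF lf(1)]], rule log_expandable_diff[OF ex(2) log_expandable_shift[OF lf(2)]])
  obtain P where P: "(\<lambda>w. d1 w - poly P (Ln w) / w ^ (n + 1)) \<in> soft_O (real n + 2)"
    using log_expandable_leading_term[OF he(1) d(1)] by (auto simp: algebra_simps)
  obtain Q where Q: "(\<lambda>w. d2 w - poly Q (Ln w) / w ^ (n + 2)) \<in> soft_O (real n + 3)"
    using log_expandable_leading_term[OF he(2) d(2)] by (auto simp: algebra_simps)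
  obtain u v where u: "pderiv u = Polynomial.smult (of_nat n + 2 * a * \<kappa>) u + Polynomial.smult 1 v + P"
    and v: "pderiv v = Polynomial.smult ((2 * b * t + 3 * c) * \<kappa>^2) u + Polynomial.smult (of_nat (n + 1) + 2 * b * \<kappa>) v + Q"
    using poly_linear_system by blast
  define p where "p = (\<lambda>w. poly u (Ln w) / w ^ n)"
  define q where "q = (\<lambda>w. poly v (Ln w) / w ^ (n + 1))"
  define p' where "p' = (\<lambda>w. (poly (pderiv u) (Ln w) - of_nat n * poly u (Ln w)) / w ^ Suc n)"
  define q' where "q' = (\<lambda>w. (poly (pderiv v) (Ln w) - of_nat (n + 1) * poly v (Ln w)) / w ^ Suc (n + 1))"
  have sp: "(\<lambda>w. p (w + 1) - p w - p' w) \<in> soft_O (real n + 2)"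
    unfolding p_def p'_def by (rule shift_first_order[OF log_polys_poly_Ln poly_Ln_over_power_derivative])
  have sq: "(\<lambda>w. q (w + 1) - q w - q' w) \<in> soft_O (real n + 3)"
    using shift_first_order[OF log_polys_poly_Ln poly_Ln_over_power_derivative, of v "n + 1"]
    by (simp add: q_def q'_def add_ac)
  have p: "p \<in> soft_O (real n)" unfolding p_def by (rule soft_divide_power[OF log_polys_soft[OF log_polys_poly_Ln]]) simp
  have q: "q \<in> soft_O (real n + 1)" unfolding q_def by (rule soft_divide_power[OF log_polys_soft[OF log_polys_poly_Ln]]) simp
  \<comment> \<open>The corrections have to fit into the forms \<open>\<kappa> / w + g / w\<^sup>2\<close> and \<open>t \<kappa>\<^sup>2 / w\<^sup>2 + g / w\<^sup>3\<close>;
    this is where \<open>n \<ge> 2\<close> enters.\<close>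
  define h1 where "h1 = (\<lambda>w. g1 w + poly u (Ln w) / w ^ (n - 2))"
  define h2 where "h2 = (\<lambda>w. g2 w + poly v (Ln w) / w ^ (n - 2))"
  have h: "h1 \<in> log_polys" "h2 \<in> log_polys" unfolding h1_def h2_def by (intro log_polys.add g log_polys_divide_power log_polys_poly_Ln)+
  define y1 where "y1 = (\<lambda>w. \<kappa> / w + h1 w / w^2)"
  define y2 where "y2 = (\<lambda>w. t * \<kappa>^2 / w^2 + h2 w / w^3)"
  note lw = leading_form[OF h y1_def y2_def]
  have pow: "w ^ n = w ^ (n - 2) * w^2" "w ^ (n + 1) = w ^ (n - 2) * w^3" for w :: complex
  proof -
    have "n = (n - 2) + 2" "n + 1 = (n - 2) + 3" using n by simp_all
    then show "w ^ n = w ^ (n - 2) * w^2" "w ^ (n + 1) = w ^ (n - 2) * w^3"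
      by (metis power_add)+
  qed
  have y1: "y1 w = z1 w + p w" and y2: "y2 w = z2 w + q w" for w
    unfolding y1_def z1_def p_def h1_def y2_def z2_def q_def h2_def pow by (simp_all add: add_divide_distrib)
  have r: "(\<lambda>w. r1 (y1 w) (y2 w) - r1 (z1 w) (z2 w)) \<in> soft_O (real n + 2)"
    "(\<lambda>w. r2 (y1 w) (y2 w) - r2 (z1 w) (z2 w)) \<in> soft_O (real n + 3)"
  proof -
    have d: "(\<lambda>w. y1 w - z1 w) \<in> soft_O (real n)" "(\<lambda>w. y2 w - z2 w) \<in> soft_O (real n + 1)"
      unfolding y1 y2 add_diff_cancel_left' by (rule p, rule q)
    note rs = remainder_soft[OF leading_bound[OF lf(5,6)] leading_bound[OF lw(5,6)] d]
    show "(\<lambda>w. r1 (y1 w) (y2 w) - r1 (z1 w) (z2 w)) \<in> soft_O (real n + 2)" by (rule rs(1))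
    show "(\<lambda>w. r2 (y1 w) (y2 w) - r2 (z1 w) (z2 w)) \<in> soft_O (real n + 3)" by (rule rs(2))
  qed
  have n2: "real n \<ge> 2" using n by simp
  have g1p: "(\<lambda>w. (g1 w * p w) / w^2) \<in> soft_O (real n + 2)"
    by (rule soft_divide_power[OF soft_mult[OF log_polys_soft[OF g(1)] p order.refl]]) simp
  have pp: "(\<lambda>w. p w * p w) \<in> soft_O (real n + 2)" by (rule soft_mult[OF p p]) (use n2 in simp)
  have g1q: "(\<lambda>w. (g1 w * q w) / w^2) \<in> soft_O (real n + 3)"
    by (rule soft_divide_power[OF soft_mult[OF log_polys_soft[OF g(1)] q order.refl]]) simp
  have g2p: "(\<lambda>w. (g2 w * p w) / w^3) \<in> soft_O (real n + 3)"
    by (rule soft_divide_power[OF soft_mult[OF log_polys_soft[OF g(2)] p order.refl]]) simp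
  have pq: "(\<lambda>w. p w * q w) \<in> soft_O (real n + 3)" by (rule soft_mult[OF p q]) (use n2 in simp)
  have zpp: "(\<lambda>w. (3 * z1 w + p w) * (p w * p w)) \<in> soft_O (real n + 3)"
  proof (rule soft_mult[OF _ soft_mult[OF p p order.refl]])
    show "(\<lambda>w. 3 * z1 w + p w) \<in> soft_O 1"
      by (intro soft_add soft_cmult lf(3) soft_mono[OF p]) (use n2 in simp)
  qed (use n2 in simp)
  have zg: "(\<lambda>w. ((z1 w + \<kappa> / w^1) * g1 w * p w) / w^2) \<in> soft_O (real n + 3)"
  proof (rule soft_divide_power)
    show "(\<lambda>w. (z1 w + \<kappa> / w^1) * g1 w * p w) \<in> soft_O (1 + 0 + real n)"
      by (intro soft_mult[OF soft_mult[OF soft_add[OF lf(3) soft_divide_power[OF soft_const]] log_polys_soft[OF g(1)]] p]) auto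
  qed simp
  have "(\<lambda>w. f1 (y1 w, y2 w) - y1 (w + 1)) \<in> soft_O (real n + 2)"
  proof (rule soft_cong)
    show "(\<lambda>w. (d1 w - poly P (Ln w) / w ^ (n + 1)) + (r1 (y1 w) (y2 w) - r1 (z1 w) (z2 w))
       - (p (w + 1) - p w - p' w) + ((2 * a) * ((g1 w * p w) / w^2) + a * (p w * p w))) \<in> soft_O (real n + 2)" (is "?h \<in> _")
      by (intro soft_add soft_diff soft_cmult P r sp g1p pp)
    show "\<forall>\<^sub>F w in right_inf. f1 (y1 w, y2 w) - y1 (w + 1) = ?h w"
      using eventually_right_inf_gt[of 0]
    proof eventually_elim
      case (elim w)
      then have t0: "w \<noteq> 0" by auto
      have "p' w = (2 * a * \<kappa> * poly u (Ln w) + poly v (Ln w) + poly P (Ln w)) / w ^ (n + 1)"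
        by (simp add: p'_def u algebra_simps)
      also have "\<dots> = 2 * a * (\<kappa> / w) * p w + q w + poly P (Ln w) / w ^ (n + 1)"
        using t0 by (simp add: p_def q_def add_divide_distrib)
      finally have e: "p' w = \<dots>" .
      have zz: "\<kappa> / w = z1 w - g1 w / w^2" by (simp add: z1_def)
      show ?case unfolding e zz d1_def r1_def y1 y2
        by (simp add: algebra_simps power2_eq_square)
    qed
  qed
  moreover have "(\<lambda>w. f2 (y1 w, y2 w) - y2 (w + 1)) \<in> soft_O (real n + 3)"
  proof (rule soft_cong)
    show "(\<lambda>w. (d2 w - poly Q (Ln w) / w ^ (n + 2)) + (r2 (y1 w) (y2 w) - r2 (z1 w) (z2 w))
       - (q (w + 1) - q w - q' w) + (2 * b) * ((g1 w * q w) / w^2 + (g2 w * p w) / w^3 + p w * q w)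
       + c * ((3 * z1 w + p w) * (p w * p w)) + (3 * c) * (((z1 w + \<kappa> / w^1) * g1 w * p w) / w^2)) \<in> soft_O (real n + 3)" (is "?h \<in> _")
      by (intro soft_add soft_diff soft_cmult Q r sq g1q g2p pq zpp zg)
    show "\<forall>\<^sub>F w in right_inf. f2 (y1 w, y2 w) - y2 (w + 1) = ?h w"
      using eventually_right_inf_gt[of 0]
    proof eventually_elim
      case (elim w)
      then have t0: "w \<noteq> 0" by auto
      define k where "k = \<kappa> / w"
      define g where "g = g1 w / w^2"
      define h where "h = g2 w / w^3"
      have "q' w = ((2 * b * t + 3 * c) * \<kappa>^2 * poly u (Ln w) + 2 * b * \<kappa> * poly v (Ln w) + poly Q (Ln w)) / w ^ (n + 2)"
        by (simp add: q'_def v algebra_simps)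
      also have "\<dots> = (2 * b * t + 3 * c) * k^2 * p w + 2 * b * k * q w + poly Q (Ln w) / w ^ (n + 2)"
        using t0 by (simp add: p_def q_def k_def add_divide_distrib power_divide power_add power2_eq_square)
      finally have e: "q' w = \<dots>" .
      have z: "z1 w = k + g" "z2 w = t * k^2 + h" by (simp_all add: z1_def z2_def k_def g_def h_def power_divide)
      have m: "(g1 w * q w) / w^2 = g * q w" "(g2 w * p w) / w^3 = h * p w"
         "((z1 w + \<kappa> / w^1) * g1 w * p w) / w^2 = (z1 w + k) * g * p w"
        by (simp_all add: g_def h_def k_def)
      show ?case unfolding m unfolding e d2_def r2_def y1 y2 unfolding z
        by (simp add: algebra_simps power2_eq_square power3_eq_cube)
    qed
  qed
  ultimately have "approx_solution (Suc n) h1 h2"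
    unfolding approx_solution_def using h
    by (intro conjI exI[of _ y1] exI[of _ y2]) (simp_all add: y1_def y2_def add_ac)
  then show ?thesis by blast
qed

theorem approx_solution_exists: "n \<ge> 2 \<Longrightarrow> \<exists>g1 g2. approx_solution n g1 g2"
proof (induction n rule: dec_induct)
  case base
  show ?case using approx_solution_base by blast
next
  case (step n)
  then show ?case using approx_solution_step by blast
qed

end

section \<open>Solutions of the conjugacy equation\<close>

lemma log_polys_holomorphic:
  assumes "f \<in> log_polys" "S \<subseteq> {w. Re w > 0}"
  shows "f holomorphic_on S"
proof -
  obtain g where "\<And>w. Re w > 0 \<Longrightarrow> (f has_field_derivative g w / w) (at w)"
    using log_polys_derivative[OF assms(1)] by blast
  then have "\<exists>d. (f has_field_derivative d) (at w)" if "w \<in> {w. Re w > 0}" for w using that by blast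
  then have "f holomorphic_on {w. Re w > 0}"
    by (subst holomorphic_on_open) (auto simp: open_halfspace_Re_gt)
  then show ?thesis using assms(2) by (rule holomorphic_on_subset)
qed

text \<open>
  If \<open>z (w1 + k) = z (w2 + k)\<close> for all \<open>k\<close>, the explicit part of \<open>z\<close> has a difference asymptotic
  to \<open>\<kappa> (w2 - w1) / k\<^sup>2\<close>, while everything else is of smaller order.
\<close>

lemma shift_separates:
  fixes z :: "complex \<Rightarrow> complex"
  assumes g: "g \<in> log_polys" and k0: "\<kappa> \<noteq> 0" and R: "R \<ge> 1"
    and z: "\<And>w. Re w > R \<Longrightarrow> norm (z w - \<kappa> / w - g w / w^2) \<le> 1 / norm w ^ 4"
    and t: "Re w1 > R" "Re w2 > R" and eq: "\<And>k::nat. z (w1 + of_nat k) = z (w2 + of_nat k)"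
  shows "w1 = w2"
proof -
  obtain g' where g': "g' \<in> log_polys" "\<And>w. Re w > 0 \<Longrightarrow> ((\<lambda>w. g w / w ^ 2) has_field_derivative g' w / w ^ Suc 2) (at w)"
    using log_polys_over_power_derivative[OF g, of 2] by blast
  have s3: "(\<lambda>w. g' w / w ^ Suc 2) \<in> soft_O 3" by (rule soft_divide_power[OF log_polys_soft[OF g'(1)]]) simp
  obtain C R' where C: "C > 0" "R' > 0" "\<And>w. Re w > R' \<Longrightarrow> norm (g' w / w ^ Suc 2) \<le> C * norm w powr (- (5/2))"
    by (rule softD[OF s3, of "5/2"]) auto
  define d where "d = norm (w1 - w2)"
  have key: "norm \<kappa> * d \<le> (norm w1 + real k) * (norm w2 + real k) * (C * real k powr (-(5/2)) * d + 2 / real k ^ 4)"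
    if k: "real k > R'" "k \<ge> 1" for k :: nat
  proof -
    define s1 where "s1 = w1 + of_nat k"
    define s2 where "s2 = w2 + of_nat k"
    have re: "Re s1 > real k" "Re s2 > real k" "Re s1 > R" "Re s2 > R" using t R by (auto simp: s1_def s2_def)
    have ns: "norm s1 \<ge> real k" "norm s2 \<ge> real k" 
      using re complex_Re_le_cmod[of s1] complex_Re_le_cmod[of s2] by linarith+
    have "0 < real k" using k(2) by simp
    then have "0 < norm s1" "0 < norm s2" using ns by linarith+
    then have nz: "s1 \<noteq> 0" "s2 \<noteq> 0" by simp_all
    have "norm (g s1 / s1^2 - g s2 / s2^2) \<le> C * real k powr (-(5/2)) * norm (s1 - s2)"
    proof (rule field_differentiable_bound[of "{w. Re w > real k}" "\<lambda>w. g w / w^2" "\<lambda>w. g' w / w ^ Suc 2" _ s1 s2])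
      fix w assume t: "w \<in> {w. Re w > real k}"
      then show "((\<lambda>w. g w / w^2) has_field_derivative g' w / w ^ Suc 2) (at w within {w. Re w > real k})"
        by (intro has_field_derivative_at_within[OF g'(2)]) auto
      have "norm (g' w / w ^ Suc 2) \<le> C * norm w powr (- (5/2))" using t k by (intro C(3)) auto
      also have "\<dots> \<le> C * real k powr (- (5/2))"
        using t k C(1) complex_Re_le_cmod[of w] by (intro mult_left_mono powr_mono2') auto
      finally show "norm (g' w / w ^ Suc 2) \<le> C * real k powr (- (5/2))" .
    qed (use re in \<open>auto simp: convex_halfspace_Re_gt\<close>)
    then have 1: "norm (g s1 / s1^2 - g s2 / s2^2) \<le> C * real k powr (-(5/2)) * d"
      by (simp add: d_def s1_def s2_def)
    have small: "1 / norm s ^ 4 \<le> 1 / real k ^ 4" if "norm s \<ge> real k" for s :: complex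
      using that k by (intro divide_left_mono power_mono mult_pos_pos zero_less_power) auto
    have "z s1 = z s2" using eq by (simp add: s1_def s2_def)
    then have "\<kappa> / s1 - \<kappa> / s2 = (g s2 / s2^2 - g s1 / s1^2) + ((z s2 - \<kappa> / s2 - g s2 / s2^2) - (z s1 - \<kappa> / s1 - g s1 / s1^2))"
      by (simp add: algebra_simps)
    also have "norm \<dots> \<le> norm (g s2 / s2^2 - g s1 / s1^2) + (norm (z s2 - \<kappa> / s2 - g s2 / s2^2) + norm (z s1 - \<kappa> / s1 - g s1 / s1^2))"
      by (intro order.trans[OF norm_triangle_ineq] add_left_mono norm_triangle_ineq4)
    also have "\<dots> \<le> C * real k powr (-(5/2)) * d + (1 / real k ^ 4 + 1 / real k ^ 4)"
      using 1 z[OF re(3)] z[OF re(4)] small[OF ns(1)] small[OF ns(2)]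
      by (intro add_mono) (auto simp: norm_minus_commute intro: order.trans)
    finally have 2: "norm (\<kappa> / s1 - \<kappa> / s2) \<le> C * real k powr (-(5/2)) * d + 2 / real k ^ 4" by simp
    have "\<kappa> * (w2 - w1) = (s1 * s2) * (\<kappa> / s1 - \<kappa> / s2)"
      using nz by (simp add: field_simps) (simp add: s1_def s2_def algebra_simps)
    then have "norm \<kappa> * d = (norm s1 * norm s2) * norm (\<kappa> / s1 - \<kappa> / s2)"
      unfolding d_def norm_minus_commute[of w1] norm_mult[symmetric] by simp
    also have "\<dots> \<le> ((norm w1 + real k) * (norm w2 + real k)) * (C * real k powr (-(5/2)) * d + 2 / real k ^ 4)"
      using norm_triangle_ineq[of w1 "of_nat k"] norm_triangle_ineq[of w2 "of_nat k"] 2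
      by (intro mult_mono) (auto simp: s1_def s2_def)
    finally show ?thesis .
  qed
  have lim: "(\<lambda>k. (norm w1 + real k) * (norm w2 + real k) * (C * real k powr (-(5/2)) * d + 2 / real k ^ 4)) \<longlonglongrightarrow> 0"
    by real_asymp
  have "\<forall>\<^sub>F k in sequentially. real k > R'" by real_asymp
  then have "\<forall>\<^sub>F k in sequentially. norm \<kappa> * d \<le> (norm w1 + real k) * (norm w2 + real k) * (C * real k powr (-(5/2)) * d + 2 / real k ^ 4)"
    using eventually_ge_at_top[of 1] by eventually_elim (rule key)
  then have "norm \<kappa> * d \<le> 0" by (rule tendsto_lowerbound[OF lim]) simp
  then show ?thesis using k0 by (simp add: d_def mult_le_0_iff)
qed

locale parabolic_direction_holomorphic = parabolic_direction +
  fixes \<rho> :: real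
  assumes rho: "\<rho> > 0"
    and hol: "\<And>p q S. open S \<Longrightarrow> p holomorphic_on S \<Longrightarrow> q holomorphic_on S \<Longrightarrow>
      (\<And>w. w \<in> S \<Longrightarrow> norm (p w) < \<rho> \<and> norm (q w) < \<rho>) \<Longrightarrow>
      (\<lambda>w. f1 (p w, q w)) holomorphic_on S \<and> (\<lambda>w. f2 (p w, q w)) holomorphic_on S"
begin

text \<open>
  The Lipschitz constant \<open>L\<close> of the equation for the correction depends on \<open>K\<close> and the bounds for the
  remainders, but not on the order of the approximate solution. So \<open>m\<close> can be chosen in terms of \<open>L\<close>,
  then an approximate solution whose defect is of the order prescribed by \<open>m\<close>, and finally \<open>R\<close> in terms
  of all of these.
\<close>

lemma parabolic_solution:
  obtains R M z1 z2 g where "R \<ge> 1" "z1 holomorphic_on halfplane R" "z2 holomorphic_on halfplane R" "g \<in> log_polys"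
    "\<And>w. Re w > R \<Longrightarrow> z1 (w + 1) = f1 (z1 w, z2 w) \<and> z2 (w + 1) = f2 (z1 w, z2 w)"
    "\<And>w. Re w > R \<Longrightarrow> norm (z1 w) < \<rho> \<and> norm (z2 w) < \<rho>"
    "\<And>w. Re w > R \<Longrightarrow> norm (z1 w - \<kappa> / w - g w / w^2) \<le> 1 / norm w ^ 4"
    "\<And>w. Re w > R \<Longrightarrow> norm (z1 w - \<kappa> / w) \<le> M * norm w powr (-(3/2))"
    "\<And>w. Re w > R \<Longrightarrow> norm (z2 w - t * \<kappa>^2 / w^2) \<le> M * norm w powr (-(5/2))"
proof -
  \<comment> \<open>One more than \<open>K\<close>, to leave room for the correction.\<close>
  define K1 where "K1 = K + 1"
  have K1: "K1 \<ge> 1" using K_ge by (simp add: K1_def)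
  define B where "B = 2 * norm a + 2 * norm b + 3 * norm c + C * \<mu>0"
  have C\<mu>: "C * \<mu>0 \<ge> 0" using C by simp
  then have B: "B \<ge> 0" by (simp add: B_def)
  define L where "L = 1 + C * \<mu>0 + K1^2 * B"
  have L1: "L \<ge> 1" using C\<mu> B by (simp add: L_def)
  have K1B: "K1 * B \<le> K1^2 * B" using K1 B self_le_power[of K1 2] by (intro mult_right_mono) auto
  obtain m0 :: nat where m0: "8 * L \<le> real m0" using real_arch_simple by blast
  define m where "m = Suc m0"
  have m: "m \<ge> 1" "real m \<ge> 8 * L" using m0 by (simp_all add: m_def)
  \<comment> \<open>As \<open>Re w \<le> \<bar>w\<bar>\<close>, defects of size \<open>1 / \<bar>w\<bar>\<^sup>m\<^sup>+\<^sup>5\<close> and \<open>1 / \<bar>w\<bar>\<^sup>m\<^sup>+\<^sup>6\<close> are below the weights \<open>m + 1\<close> and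
    \<open>m + 2\<close> that \<open>shadowing\<close> requires. Those of an approximate solution of order \<open>m + 5\<close> decay
    faster by one order.\<close>
  obtain g1 g2 where ap: "approx_solution (m + 5) g1 g2" using approx_solution_exists[of "m + 5"] by auto
  define y1 where "y1 = (\<lambda>w. \<kappa> / w + g1 w / w^2)"
  define y2 where "y2 = (\<lambda>w. t * \<kappa>^2 / w^2 + g2 w / w^3)"
  have g: "g1 \<in> log_polys" "g2 \<in> log_polys" using ap by (auto simp: approx_solution_def)
  note lf = leading_form[OF g y1_def y2_def]
  have d1: "(\<lambda>w. f1 (y1 w, y2 w) - y1 (w + 1)) \<in> soft_O (real (m + 5) + 1)"
    and d2: "(\<lambda>w. f2 (y1 w, y2 w) - y2 (w + 1)) \<in> soft_O (real (m + 5) + 2)"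
    using ap by (auto simp: approx_solution_def y1_def y2_def)
  obtain Ra where Ra: "\<And>w. Re w > Ra \<Longrightarrow> norm (f1 (y1 w, y2 w) - y1 (w + 1)) \<le> 1 / norm w ^ (m + 5)"
    by (rule soft_small[OF d1, of "m + 5" 1]) auto
  obtain Rb where Rb: "\<And>w. Re w > Rb \<Longrightarrow> norm (f2 (y1 w, y2 w) - y2 (w + 1)) \<le> 1 / norm w ^ (m + 6)"
    by (rule soft_small[OF d2, of "m + 6" 1]) auto
  obtain Rc where Rc: "\<And>w. Re w > Rc \<Longrightarrow> norm (y1 w) \<le> K / norm w \<and> norm (y2 w) \<le> (K / norm w)^2"
    using leading_bound[OF lf(5,6)] unfolding eventually_right_inf by blast
  obtain M1 Rd where Rd: "M1 > 0" "\<And>w. Re w > Rd \<Longrightarrow> norm (y1 w - \<kappa> / w) \<le> M1 * norm w powr (-(3/2))"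
    by (rule softD[OF lf(5), of "3/2"]) auto
  obtain M2 Re' where Re': "M2 > 0" "\<And>w. Re w > Re' \<Longrightarrow> norm (y2 w - t * \<kappa>^2 / w^2) \<le> M2 * norm w powr (-(5/2))"
    by (rule softD[OF lf(6), of "5/2"]) auto
  define R where "R = Max {1, 8 * L, K1, K1 / \<mu>0, K1 / \<rho>, Ra, Rb, Rc, Rd, Re'}"
  have R: "R \<ge> 1" "R \<ge> 8 * L" "R \<ge> K1" "R \<ge> K1 / \<mu>0" "R \<ge> K1 / \<rho>" "R \<ge> Ra" "R \<ge> Rb" "R \<ge> Rc" "R \<ge> Rd" "R \<ge> Re'"
    unfolding R_def by (intro Max_ge; simp)+
  have Hpos: "norm w > R \<and> Re w \<le> norm w \<and> norm w \<ge> 1 \<and> Re w \<ge> 1" if "Re w > R" for w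
    using that R(1) complex_Re_le_cmod[of w] by linarith
  have w4: "weight j w \<le> 1 / norm w ^ 4" if t: "Re w > R" for j w
  proof -
    have "norm w ^ 4 * 1 \<le> norm w ^ 4 * Re w ^ j" using Hpos[OF t] by (intro mult_left_mono one_le_power) auto
    moreover have "0 < norm w" "0 < Re w" using Hpos[OF t] by linarith+
    ultimately show ?thesis unfolding weight_def by (intro divide_left_mono mult_pos_pos zero_less_power) simp_all
  qed
  have small: "norm (y1 w + p) \<le> K1 / norm w \<and> norm (y2 w + q) \<le> (K1 / norm w)^2"
    if t: "Re w > R" and "norm p \<le> weight m w" "norm q \<le> weight (Suc m) w" for w p q
  proof -
    have pq: "norm p \<le> 1 / norm w ^ 4" "norm q \<le> 1 / norm w ^ 4" using that w4[OF t] order.trans by blast+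
    have pw: "1 / norm w ^ 4 \<le> 1 / norm w ^ i" if "i \<le> 4" for i
      using Hpos[OF t] that by (intro divide_left_mono power_increasing mult_pos_pos zero_less_power) auto
    have "norm (y1 w + p) \<le> K / norm w + 1 / norm w ^ 1"
      using Rc[of w] t R(8) pq(1) pw[of 1] by (intro order.trans[OF norm_triangle_ineq] add_mono) auto
    also have "\<dots> = K1 / norm w" by (simp add: K1_def add_divide_distrib)
    finally have 1: "norm (y1 w + p) \<le> K1 / norm w" .
    have "norm (y2 w + q) \<le> (K / norm w)^2 + 1 / norm w ^ 2"
      using Rc[of w] t R(8) pq(2) pw[of 2] by (intro order.trans[OF norm_triangle_ineq] add_mono) auto
    also have "\<dots> = (K^2 + 1) / norm w^2" by (simp add: power_divide add_divide_distrib)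
    also have "\<dots> \<le> K1^2 / norm w^2" using K_ge by (intro divide_right_mono) (auto simp: K1_def power2_eq_square algebra_simps)
    finally show ?thesis using 1 by (simp add: power_divide)
  qed
  have mu: "0 < K1 / norm w \<and> K1 / norm w \<le> \<mu>0 \<and> K1 / norm w \<le> K1 / Re w \<and> K1 / norm w < \<rho> \<and> K1 / norm w < 1"
    if t: "Re w > R" for w
  proof (intro conjI)
    note h = Hpos[OF t]
    have np: "0 < norm w" "0 < Re w" using h by linarith+
    show "0 < K1 / norm w" using h K1 by (intro divide_pos_pos) linarith+
    have "K1 / \<mu>0 < norm w" using h R(4) by linarith
    then show "K1 / norm w \<le> \<mu>0" using np C(2) by (simp add: pos_divide_le_eq pos_divide_less_eq mult.commute)
    have "K1 / \<rho> < norm w" using h R(5) by linarith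
    then show "K1 / norm w < \<rho>" using np rho by (simp add: pos_divide_less_eq mult.commute)
    show "K1 / norm w \<le> K1 / Re w" using h np K1 by (intro divide_left_mono mult_pos_pos) linarith+
    have "K1 < norm w" using h R(3) by linarith
    then show "K1 / norm w < 1" using np by simp
  qed
  have in_rho: "norm (y1 w + p) < \<rho> \<and> norm (y2 w + q) < \<rho>"
    if t: "Re w > R" and "norm p \<le> weight m w" "norm q \<le> weight (Suc m) w" for w p q
  proof -
    have "(K1 / norm w)^2 \<le> K1 / norm w"
      using mu[OF t] power_decreasing[of 1 2 "K1 / norm w"] by simp
    then show ?thesis using small[OF that] mu[OF t] by linarith
  qed
  define E1 where "E1 w p q = f1 (y1 w + p, y2 w + q) - p - y1 (w + 1)" for w p q
  define E2 where "E2 w p q = f2 (y1 w + p, y2 w + q) - q - y2 (w + 1)" for w p q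
  have yhol: "y1 holomorphic_on halfplane R" "y2 holomorphic_on halfplane R"
    using R(1) by (intro log_polys_holomorphic lf; auto)+
  have yhol1: "(\<lambda>w. y1 (w + 1)) holomorphic_on halfplane R" "(\<lambda>w. y2 (w + 1)) holomorphic_on halfplane R"
  proof -
    have s: "(\<lambda>w. w + 1) ` halfplane R \<subseteq> halfplane R" "(\<lambda>w. w + 1) holomorphic_on halfplane R"
      by (auto intro!: holomorphic_intros)
    show "(\<lambda>w. y1 (w + 1)) holomorphic_on halfplane R" "(\<lambda>w. y2 (w + 1)) holomorphic_on halfplane R"
      using holomorphic_on_compose_gen[OF s(2) yhol(1) s(1)] holomorphic_on_compose_gen[OF s(2) yhol(2) s(1)]
      by (simp_all add: o_def)
  qed
  have Ehol: "(\<lambda>w. E1 w (p w) (q w)) holomorphic_on halfplane R \<and> (\<lambda>w. E2 w (p w) (q w)) holomorphic_on halfplane R"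
    if "p holomorphic_on halfplane R \<and> q holomorphic_on halfplane R \<and>
      (\<forall>w. Re w > R \<longrightarrow> norm (p w) \<le> weight m w \<and> norm (q w) \<le> weight (Suc m) w)" for p q
  proof -
    have ph: "p holomorphic_on halfplane R" and qh: "q holomorphic_on halfplane R"
      and pq: "\<And>w. Re w > R \<Longrightarrow> norm (p w) \<le> weight m w" "\<And>w. Re w > R \<Longrightarrow> norm (q w) \<le> weight (Suc m) w"
      using that by blast+
    have "(\<lambda>w. f1 (y1 w + p w, y2 w + q w)) holomorphic_on halfplane R \<and> (\<lambda>w. f2 (y1 w + p w, y2 w + q w)) holomorphic_on halfplane R"
      by (rule hol[OF open_halfplane holomorphic_on_add[OF yhol(1) ph] holomorphic_on_add[OF yhol(2) qh]], rule in_rho)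
         (use pq in auto)
    then show ?thesis unfolding E1_def E2_def using ph qh yhol1 by (auto intro!: holomorphic_intros)
  qed
  have Elip: "norm (E1 w p q - E1 w p' q') \<le> L * (norm (q - q') + norm (p - p') / Re w) \<and>
        norm (E2 w p q - E2 w p' q') \<le> L * (norm (q - q') / Re w + norm (p - p') / (Re w)^2)"
    if t: "Re w > R" and p: "norm p \<le> weight m w" "norm p' \<le> weight m w"
       and q: "norm q \<le> weight (Suc m) w" "norm q' \<le> weight (Suc m) w" for w p q p' q'
  proof -
    define \<mu> where "\<mu> = K1 / norm w"
    define x where "x = y1 w + p"
    define x' where "x' = y1 w + p'"
    define y where "y = y2 w + q"
    define y' where "y' = y2 w + q'"
    have \<mu>: "0 < \<mu>" "\<mu> \<le> \<mu>0" "\<mu> \<le> K1 / Re w" using mu[OF t] by (auto simp: \<mu>_def)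
    have b: "norm x \<le> \<mu>" "norm x' \<le> \<mu>" "norm y \<le> \<mu>^2" "norm y' \<le> \<mu>^2"
      using small[OF t p(1) q(1)] small[OF t p(2) q(2)] by (auto simp: \<mu>_def x_def x'_def y_def y'_def)
    have dx: "x - x' = p - p'" "y - y' = q - q'" by (simp_all add: x_def x'_def y_def y'_def)
    define P where "P = norm (p - p')"
    define Q where "Q = norm (q - q')"
    have PQ: "P \<ge> 0" "Q \<ge> 0" by (simp_all add: P_def Q_def)
    have Rt: "Re w > 0" using Hpos[OF t] by linarith
    have r1: "norm (r1 x y - r1 x' y') \<le> C * (\<mu>^2 * P + \<mu> * Q)"
      using weighted_lipschitzD[OF lip1 \<mu>(1,2) b]
      by (simp add: r1_def P_def Q_def dx numeral_2_eq_2)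
    have r2: "norm (r2 x y - r2 x' y') \<le> C * (\<mu>^3 * P + \<mu>^2 * Q)"
      using weighted_lipschitzD[OF lip2 \<mu>(1,2) b]
      by (simp add: r2_def P_def Q_def dx numeral_3_eq_3)
    have "E1 w p q - E1 w p' q' = (q - q') + a * ((x + x') * (p - p')) + (r1 x y - r1 x' y')"
      unfolding E1_def r1_def x_def[symmetric] y_def[symmetric] x'_def[symmetric] y'_def[symmetric]
      by (simp add: x_def x'_def y_def y'_def power2_eq_square algebra_simps)
    also have "norm \<dots> \<le> Q + norm a * ((2 * \<mu>) * P) + C * (\<mu>^2 * P + \<mu> * Q)"
    proof (intro order.trans[OF norm_triangle_ineq] add_mono r1)
      show "norm (q - q') \<le> Q" by (simp add: Q_def)
      have "norm (x + x') \<le> 2 * \<mu>" using norm_triangle_ineq[of x x'] b by linarith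
      then show "norm (a * ((x + x') * (p - p'))) \<le> norm a * ((2 * \<mu>) * P)"
        unfolding norm_mult P_def by (intro mult_left_mono mult_right_mono) auto
    qed
    also have "\<dots> = (1 + C * \<mu>) * Q + ((2 * norm a + C * \<mu>) * \<mu>) * P" by (simp add: algebra_simps power2_eq_square)
    also have "\<dots> \<le> L * Q + (L / Re w) * P"
    proof (intro add_mono mult_right_mono PQ)
      have cm: "C * \<mu> \<le> C * \<mu>0" using \<mu> C by (intro mult_left_mono) auto
      show "1 + C * \<mu> \<le> L" using cm B by (simp add: L_def) (meson add_increasing2 mult_nonneg_nonneg order_refl zero_le_power2)
      have "2 * norm a + C * \<mu> \<le> B"
        using cm norm_ge_zero[of a] norm_ge_zero[of b] norm_ge_zero[of c] unfolding B_def by linarith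
      then have "(2 * norm a + C * \<mu>) * \<mu> \<le> B * (K1 / Re w)"
        using \<mu> B by (intro mult_mono) auto
      also have "\<dots> \<le> L / Re w" using K1B C\<mu> Rt by (simp add: L_def divide_right_mono mult.commute)
      finally show "(2 * norm a + C * \<mu>) * \<mu> \<le> L / Re w" .
    qed
    also have "\<dots> = L * (norm (q - q') + norm (p - p') / Re w)" by (simp add: P_def Q_def distrib_left)
    finally have 1: "norm (E1 w p q - E1 w p' q') \<le> L * (norm (q - q') + norm (p - p') / Re w)" .
    have "E2 w p q - E2 w p' q' = (2 * b) * (x * (q - q') + y' * (p - p')) + c * ((x^2 + x * x' + x'^2) * (p - p')) + (r2 x y - r2 x' y')"
      unfolding E2_def r2_def x_def[symmetric] y_def[symmetric] x'_def[symmetric] y'_def[symmetric] dx[symmetric]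
      unfolding dx by (simp add: x_def x'_def y_def y'_def power2_eq_square power3_eq_cube algebra_simps)
    also have "norm \<dots> \<le> (2 * norm b) * (\<mu> * Q + \<mu>^2 * P) + norm c * ((3 * \<mu>^2) * P) + C * (\<mu>^3 * P + \<mu>^2 * Q)"
    proof (intro order.trans[OF norm_triangle_ineq] add_mono r2)
      have "norm (x * (q - q') + y' * (p - p')) \<le> \<mu> * Q + \<mu>^2 * P"
        unfolding P_def Q_def using b by (intro order.trans[OF norm_triangle_ineq] add_mono) (auto simp: norm_mult intro!: mult_right_mono)
      then show "norm ((2 * b) * (x * (q - q') + y' * (p - p'))) \<le> (2 * norm b) * (\<mu> * Q + \<mu>^2 * P)"
        unfolding norm_mult by (intro mult_mono) auto
      have "norm (x^2 + x * x' + x'^2) \<le> norm (x^2) + norm (x * x') + norm (x'^2)"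
        by (intro order.trans[OF norm_triangle_ineq] add_mono norm_triangle_ineq order.refl)
      also have "\<dots> \<le> \<mu>^2 + \<mu> * \<mu> + \<mu>^2"
        unfolding norm_mult norm_power using b \<mu> by (intro add_mono mult_mono power_mono) auto
      finally have "norm (x^2 + x * x' + x'^2) \<le> 3 * \<mu>^2" by (simp add: power2_eq_square)
      then show "norm (c * ((x^2 + x * x' + x'^2) * (p - p'))) \<le> norm c * ((3 * \<mu>^2) * P)"
        unfolding norm_mult P_def by (intro mult_left_mono mult_right_mono) auto
    qed
    also have "\<dots> = ((2 * norm b + C * \<mu>) * \<mu>) * Q + ((2 * norm b + 3 * norm c + C * \<mu>) * \<mu>^2) * P"
      by (simp add: algebra_simps power2_eq_square power3_eq_cube)
    also have "\<dots> \<le> (L / Re w) * Q + (L / (Re w)^2) * P"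
    proof (intro add_mono mult_right_mono PQ)
      have cm: "C * \<mu> \<le> C * \<mu>0" using \<mu> C by (intro mult_left_mono) auto
      have "2 * norm b + C * \<mu> \<le> B"
        using cm norm_ge_zero[of a] norm_ge_zero[of b] norm_ge_zero[of c] unfolding B_def by linarith
      then have "(2 * norm b + C * \<mu>) * \<mu> \<le> B * (K1 / Re w)"
        using \<mu> B by (intro mult_mono) auto
      also have "\<dots> \<le> L / Re w" using K1B C\<mu> Rt by (simp add: L_def divide_right_mono mult.commute)
      finally show "(2 * norm b + C * \<mu>) * \<mu> \<le> L / Re w" .
      have "\<mu>^2 \<le> (K1 / Re w)^2" using \<mu> by (intro power_mono) auto
      moreover have "2 * norm b + 3 * norm c + C * \<mu> \<le> B"
        using cm norm_ge_zero[of a] unfolding B_def by linarith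
      ultimately have "(2 * norm b + 3 * norm c + C * \<mu>) * \<mu>^2 \<le> B * (K1 / Re w)^2"
        using B by (intro mult_mono) auto
      also have "\<dots> \<le> L / (Re w)^2" using C\<mu> Rt by (simp add: L_def power_divide divide_right_mono mult.commute)
      finally show "(2 * norm b + 3 * norm c + C * \<mu>) * \<mu>^2 \<le> L / (Re w)^2" .
    qed
    also have "\<dots> = L * (norm (q - q') / Re w + norm (p - p') / (Re w)^2)" by (simp add: P_def Q_def distrib_left)
    finally show ?thesis using 1 by blast
  qed
  have Ezero: "norm (E1 w 0 0) \<le> 2 * L * weight (Suc m) w \<and> norm (E2 w 0 0) \<le> 2 * L * weight (Suc (Suc m)) w"
    if t: "Re w > R" for w
  proof -
    have w: "1 / norm w ^ (j + 4) \<le> 2 * L * weight j w" for j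
    proof -
      have "1 / norm w ^ (j + 4) = 1 / (norm w ^ 4 * norm w ^ j)" by (simp add: power_add mult.commute)
      also have "\<dots> \<le> weight j w" unfolding weight_def
        using Hpos[OF t] by (intro divide_left_mono mult_left_mono power_mono mult_pos_pos zero_less_power) auto
      also have "\<dots> \<le> 2 * L * weight j w"
      proof -
        have "0 \<le> weight j w" using weight_pos[of w j] Hpos[OF t] by simp
        then show ?thesis using L1 by (simp add: mult_le_cancel_right1)
      qed
      finally show ?thesis .
    qed
    have e: "m + 5 = Suc m + 4" "m + 6 = Suc (Suc m) + 4" by simp_all
    have "Ra < Re w" "Rb < Re w" using t R(6,7) by linarith+
    then have "norm (E1 w 0 0) \<le> 1 / norm w ^ (Suc m + 4)" "norm (E2 w 0 0) \<le> 1 / norm w ^ (Suc (Suc m) + 4)"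
      unfolding E1_def E2_def add_0_right diff_zero e[symmetric] using Ra Rb by blast+
    then show ?thesis using w[of "Suc m"] w[of "Suc (Suc m)"] by (blast intro: order.trans)
  qed
  have Lm: "L * (1 / real m + 1 / R) \<le> 1/4"
  proof -
    have "L / real m \<le> 1/8" using m L1 by (simp add: divide_le_eq)
    moreover have "L / R \<le> 1/8" using R(1,2) by (simp add: divide_le_eq)
    moreover have "L * (1 / real m + 1 / R) = L / real m + L / R" by (simp add: distrib_left)
    ultimately show ?thesis by linarith
  qed
  have L0: "L \<ge> 0" using L1 by simp
  from shadowing[OF R(1) m(1) L0 Lm Ehol[THEN conjunct1] Ehol[THEN conjunct2] Elip Ezero]
  obtain p q where pq: "p holomorphic_on halfplane R \<and> q holomorphic_on halfplane R \<and>
      (\<forall>w. Re w > R \<longrightarrow> norm (p w) \<le> weight m w \<and> norm (q w) \<le> weight (Suc m) w)"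
    "\<And>w. Re w > R \<Longrightarrow> p (w + 1) - p w = E1 w (p w) (q w)"
    "\<And>w. Re w > R \<Longrightarrow> q (w + 1) - q w = E2 w (p w) (q w)"
    by blast
  have ph: "p holomorphic_on halfplane R" and qh: "q holomorphic_on halfplane R"
      and pqb: "\<And>w. Re w > R \<Longrightarrow> norm (p w) \<le> weight m w" "\<And>w. Re w > R \<Longrightarrow> norm (q w) \<le> weight (Suc m) w"
      using pq(1) by blast+
  have p4: "norm (p w) \<le> 1 / norm w ^ 4" "norm (q w) \<le> 1 / norm w ^ 4" if "Re w > R" for w
    using pqb[OF that] w4[OF that] order.trans by blast+
  have inv4: "1 / norm w ^ 4 \<le> 1 * norm w powr (- s)" if "Re w > R" "s \<le> 4" for w s
  proof -
    have "0 < norm w" using Hpos[OF that(1)] by linarith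
    then have "1 / norm w ^ 4 = norm w powr (- real 4)" by (rule powr_minus_nat[symmetric])
    also have "\<dots> \<le> norm w powr (- s)" using Hpos[OF that(1)] that(2) by (intro powr_mono) auto
    finally show ?thesis by simp
  qed
  show ?thesis
  proof (rule that[of R "\<lambda>w. y1 w + p w" "\<lambda>w. y2 w + q w" g1 "max M1 M2 + 1"])
    show "(\<lambda>w. y1 w + p w) holomorphic_on halfplane R" "(\<lambda>w. y2 w + q w) holomorphic_on halfplane R"
      by (rule holomorphic_on_add[OF yhol(1) ph], rule holomorphic_on_add[OF yhol(2) qh])
    fix w assume t: "Re w > R"
    show "y1 (w + 1) + p (w + 1) = f1 (y1 w + p w, y2 w + q w) \<and> y2 (w + 1) + q (w + 1) = f2 (y1 w + p w, y2 w + q w)"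
      using pq(2)[OF t] pq(3)[OF t] by (simp add: E1_def E2_def algebra_simps)
    show "norm (y1 w + p w) < \<rho> \<and> norm (y2 w + q w) < \<rho>" by (rule in_rho[OF t pqb[OF t]])
    show "norm (y1 w + p w - \<kappa> / w - g1 w / w^2) \<le> 1 / norm w ^ 4" using p4(1)[OF t] by (simp add: y1_def)
    have "norm (y1 w + p w - \<kappa> / w) \<le> norm (y1 w - \<kappa> / w) + norm (p w)"
      using norm_triangle_ineq[of "y1 w - \<kappa> / w" "p w"] by (simp add: algebra_simps)
    also have "\<dots> \<le> M1 * norm w powr (-(3/2)) + 1 * norm w powr (-(3/2))"
      using Rd(2)[of w] t R(9) p4(1)[OF t] inv4[OF t, of "3/2"] by (intro add_mono) auto
    also have "\<dots> \<le> (max M1 M2 + 1) * norm w powr (-(3/2))" unfolding distrib_right by (intro add_mono mult_right_mono) auto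
    finally show "norm (y1 w + p w - \<kappa> / w) \<le> (max M1 M2 + 1) * norm w powr (-(3/2))" .
    have "norm (y2 w + q w - t * \<kappa>^2 / w^2) \<le> norm (y2 w - t * \<kappa>^2 / w^2) + norm (q w)"
      using norm_triangle_ineq[of "y2 w - t * \<kappa>^2 / w^2" "q w"] by (simp add: algebra_simps)
    also have "\<dots> \<le> M2 * norm w powr (-(5/2)) + 1 * norm w powr (-(5/2))"
      using Re'(2)[of w] t R(10) p4(2)[OF t] inv4[OF t, of "5/2"] by (intro add_mono) auto
    also have "\<dots> \<le> (max M1 M2 + 1) * norm w powr (-(5/2))" unfolding distrib_right by (intro add_mono mult_right_mono) auto
    finally show "norm (y2 w + q w - t * \<kappa>^2 / w^2) \<le> (max M1 M2 + 1) * norm w powr (-(5/2))" .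
  qed (use R(1) g in auto)
qed

end

section \<open>Taylor coefficients and remainders of the germ\<close>

lemma holomorphic2_compose:
  assumes f: "holomorphic2_on f U" and S: "open S" and p: "p holomorphic_on S" and q: "q holomorphic_on S"
    and U: "\<And>w. w \<in> S \<Longrightarrow> (p w, q w) \<in> U"
  shows "(\<lambda>w. f (p w, q w)) holomorphic_on S"
proof -
  have "\<exists>d. ((\<lambda>w. f (p w, q w)) has_field_derivative d) (at w)" if t: "w \<in> S" for w
  proof -
    obtain p' where p': "(p has_field_derivative p') (at w)" using p S t holomorphic_on_open by blast
    obtain q' where q': "(q has_field_derivative q') (at w)" using q S t holomorphic_on_open by blast
    obtain A B where "(f has_derivative (\<lambda>h. A * fst h + B * snd h)) (at (p w, q w))"
      using f U[OF t] unfolding holomorphic2_on_def by blast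
    moreover have "((\<lambda>w. (p w, q w)) has_derivative (\<lambda>h. (p' * h, q' * h))) (at w)"
      using p' q' unfolding has_field_derivative_def by (rule has_derivative_Pair)
    ultimately have "((\<lambda>w. f (p w, q w)) has_derivative (\<lambda>h. A * fst (p' * h, q' * h) + B * snd (p' * h, q' * h))) (at w)"
      by (rule has_derivative_compose[rotated])
    then have "((\<lambda>w. f (p w, q w)) has_derivative (*) (A * p' + B * q')) (at w)"
      by (rule has_derivative_eq_rhs) (auto simp: algebra_simps)
    then show ?thesis unfolding has_field_derivative_def by blast
  qed
  then show ?thesis using S by (simp add: holomorphic_on_open)
qed

lemma holomorphic2_imp_sep_holomorphic:
  assumes f: "holomorphic2_on f U" and r: "r > 0" and sub: "ball 0 r \<times> ball 0 r \<subseteq> U"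
    and bd: "\<And>z. z \<in> ball 0 r \<times> ball 0 r \<Longrightarrow> norm (f z) \<le> M"
  shows "sep_holomorphic f r M"
  unfolding sep_holomorphic_def
proof (intro conjI ballI r)
  fix w :: complex assume w: "w \<in> ball 0 r"
  show "(\<lambda>x. f (x, w)) holomorphic_on ball 0 r"
    by (rule holomorphic2_compose[OF f open_ball holomorphic_on_ident holomorphic_on_const]) (use sub w in auto)
  show "(\<lambda>y. f (w, y)) holomorphic_on ball 0 r"
    by (rule holomorphic2_compose[OF f open_ball holomorphic_on_const holomorphic_on_ident]) (use sub w in auto)
qed (use bd in auto)

lemma holomorphic2_polydisc:
  assumes f: "holomorphic2_on f U" and "0 \<in> U"
  obtains r where "r > 0" "ball 0 r \<times> ball 0 r \<subseteq> U"
    "\<And>z. z \<in> ball 0 r \<times> ball 0 r \<Longrightarrow> norm (f z) \<le> norm (f 0) + 1"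
proof -
  obtain A B where "(f has_derivative (\<lambda>h. A * fst h + B * snd h)) (at 0)"
    using assms unfolding holomorphic2_on_def by blast
  then have "isCont f 0" by (rule has_derivative_continuous)
  then have "\<exists>e>0. \<forall>z. dist z 0 < e \<longrightarrow> dist (f z) (f 0) < 1"
    by (simp add: continuous_at_eps_delta)
  then obtain e where e: "e > 0" "\<And>z. dist z 0 < e \<Longrightarrow> dist (f z) (f 0) < 1" by blast
  obtain e' where e': "e' > 0" "ball 0 e' \<subseteq> U" using assms unfolding holomorphic2_on_def by (meson openE)
  define r where "r = min e e' / 2"
  have small: "dist z 0 < min e e'" if "z \<in> ball 0 r \<times> ball 0 r" for z :: "complex \<times> complex"
  proof -
    have "norm (fst z) < r" "norm (snd z) < r" using that by (auto simp: mem_Times_iff)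
    moreover have "norm z \<le> norm (fst z) + norm (snd z)" using norm_Pair_le[of "fst z" "snd z"] by simp
    ultimately show ?thesis by (simp add: r_def)
  qed
  show ?thesis
  proof (rule that)
    show "r > 0" using e e' by (simp add: r_def)
    show "ball 0 r \<times> ball 0 r \<subseteq> U"
    proof
      fix z :: "complex \<times> complex" assume "z \<in> ball 0 r \<times> ball 0 r"
      from small[OF this] show "z \<in> U" using e'(2) by (auto simp: dist_commute)
    qed
    fix z :: "complex \<times> complex" assume "z \<in> ball 0 r \<times> ball 0 r"
    from small[OF this] have "dist (f z) (f 0) < 1" using e(2) by auto
    then show "norm (f z) \<le> norm (f 0) + 1" using norm_triangle_sub[of "f z" "f 0"] by (simp add: dist_norm)
  qed
qed

lemma taylor_coeff_linear:
  assumes "(f has_derivative (\<lambda>h. A * fst h + B * snd h)) (at 0)"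
  shows "taylor_coeff f 0 0 = f (0, 0)" "taylor_coeff f 1 0 = A" "taylor_coeff f 0 1 = B"
proof -
  have d: "(f has_derivative (\<lambda>h. A * fst h + B * snd h)) (at (0, 0))" using assms by (simp add: zero_prod_def)
  have "((\<lambda>x. (x, 0)) has_derivative (\<lambda>h. (h, 0))) (at (0::complex))"
    by (intro derivative_eq_intros) auto
  from has_derivative_compose[OF this d] have "((\<lambda>x. f (x, 0)) has_derivative (\<lambda>h. A * fst (h, 0::complex) + B * snd (h, 0::complex))) (at 0)" .
  then have "((\<lambda>x. f (x, 0)) has_field_derivative A) (at 0)"
    unfolding has_field_derivative_def by (rule has_derivative_eq_rhs) auto
  then show "taylor_coeff f 1 0 = A" by (simp add: taylor_coeff_def DERIV_imp_deriv)
  have "((\<lambda>y. (0, y)) has_derivative (\<lambda>h. (0, h))) (at (0::complex))"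
    by (intro derivative_eq_intros) auto
  from has_derivative_compose[OF this d] have "((\<lambda>y. f (0, y)) has_derivative (\<lambda>h. A * fst (0::complex, h) + B * snd (0::complex, h))) (at 0)" .
  then have "((\<lambda>y. f (0, y)) has_field_derivative B) (at 0)"
    unfolding has_field_derivative_def by (rule has_derivative_eq_rhs) auto
  then show "taylor_coeff f 0 1 = B" by (simp add: taylor_coeff_def DERIV_imp_deriv)
qed (simp add: taylor_coeff_def)

text \<open>
  A Taylor polynomial of \<open>f\<close> takes polynomials in \<open>1 / w\<close> and \<open>log w\<close> to such polynomials, and a high
  power of a decaying function is small.
\<close>

lemma sep_holomorphic_expansion:
  assumes f: "sep_holomorphic f r M" and z: "z1 \<in> log_polys" "z2 \<in> log_polys" "z1 \<in> soft_O 1" "z2 \<in> soft_O 1"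
  shows "(\<lambda>w. f (z1 w, z2 w)) \<in> log_expandable"
  unfolding log_expandable_def
proof safe
  fix N :: nat
  note r = sep_holomorphicD(1)[OF f]
  define a where "a w = (\<Sum>j<N. \<Sum>i<N. taylor_coeff f i j * z1 w^i * z2 w^j)" for w
  have a: "a \<in> log_polys" unfolding a_def[abs_def]
    by (intro log_polys_sum log_polys.mult log_polys.const log_polys_power z)
  define s where "s = 2 / r"
  define X :: "complex \<Rightarrow> complex" where "X w = of_real s * of_real (norm (z1 w))" for w :: complex
  define Y :: "complex \<Rightarrow> complex" where "Y w = of_real s * of_real (norm (z2 w))" for w :: complex
  have XY: "X \<in> soft_O 1" "Y \<in> soft_O 1" unfolding X_def[abs_def] Y_def[abs_def]
    by (rule soft_cmult[OF soft_norm[OF z(3)]], rule soft_cmult[OF soft_norm[OF z(4)]])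
  define G where "G w = of_real (2 * M) * (Y w^N + (\<Sum>j<N. X w^N * Y w^j))" for w
  have pw: "(\<lambda>w. X w^N) \<in> soft_O (real N)" "(\<lambda>w. Y w^N) \<in> soft_O (real N)" "(\<lambda>w. Y w^j) \<in> soft_O (real j)" for j
    using soft_power[OF XY(1), of N] soft_power[OF XY(2), of N] soft_power[OF XY(2), of j] by simp_all
  have G: "G \<in> soft_O (real N)" unfolding G_def[abs_def]
    by (intro soft_cmult soft_add soft_sum pw soft_mult[OF pw(1) pw(3)]) simp
  obtain R1 where R1: "\<And>w. Re w > R1 \<Longrightarrow> norm (z1 w) \<le> (r/4) / norm w ^ 0"
    by (rule soft_small[OF z(3), of 0 "r/4"]) (use r in auto)
  obtain R2 where R2: "\<And>w. Re w > R2 \<Longrightarrow> norm (z2 w) \<le> (r/4) / norm w ^ 0"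
    by (rule soft_small[OF z(4), of 0 "r/4"]) (use r in auto)
  have "(\<lambda>w. f (z1 w, z2 w) - a w) \<in> soft_O (real N)"
  proof (rule soft_transfer[OF G, of _ 1])
    show "\<forall>\<^sub>F w in right_inf. norm (f (z1 w, z2 w) - a w) \<le> 1 * norm (G w)"
      using eventually_right_inf_gt[of R1] eventually_right_inf_gt[of R2]
    proof eventually_elim
      case (elim w)
      have b: "norm (z1 w) \<le> r/4" "norm (z2 w) \<le> r/4" using R1[OF elim(1)] R2[OF elim(2)] by simp_all
      define g where "g = 2 * M * ((s * norm (z2 w))^N + (\<Sum>j<N. (s * norm (z1 w))^N * (s * norm (z2 w))^j))"
      have "norm (f (z1 w, z2 w) - a w) \<le> g"
        using bivariate_taylor[OF f b, where n = N and N = "\<lambda>_. N"] by (simp add: a_def g_def s_def)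
      also have "g \<le> norm (complex_of_real g)" by simp
      also have "complex_of_real g = G w" by (simp add: g_def G_def X_def Y_def)
      finally show ?case by simp
    qed
  qed
  then show "\<exists>a\<in>log_polys. (\<lambda>w. f (z1 w, z2 w) - a w) \<in> soft_O (real N)" using a by blast
qed

lemma sep_holomorphic_subtract_polynomial:
  assumes f: "sep_holomorphic f r M"
  shows "sep_holomorphic (\<lambda>z. f z - (c10 * fst z + c01 * snd z + c20 * fst z^2 + c11 * fst z * snd z + c30 * fst z^3)) r
     (M + (norm c10 * r + norm c01 * r + norm c20 * r^2 + norm c11 * r * r + norm c30 * r^3))"
  unfolding sep_holomorphic_def
proof (intro conjI ballI sep_holomorphicD(1)[OF f])
  fix x y :: complex assume "x \<in> ball 0 r" "y \<in> ball 0 r"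
  then have b: "norm x < r" "norm y < r" by auto
  have "norm (c10 * x + c01 * y + c20 * x^2 + c11 * x * y + c30 * x^3) \<le>
     norm (c10 * x) + norm (c01 * y) + norm (c20 * x^2) + norm (c11 * x * y) + norm (c30 * x^3)"
    by (intro order.trans[OF norm_triangle_ineq] add_mono order.refl)
  also have "\<dots> \<le> norm c10 * r + norm c01 * r + norm c20 * r^2 + norm c11 * r * r + norm c30 * r^3"
    unfolding norm_mult norm_power using b sep_holomorphicD(1)[OF f] by (intro add_mono mult_mono power_mono) auto
  finally show "norm (f (x, y) - (c10 * fst (x, y) + c01 * snd (x, y) + c20 * fst (x, y)^2 + c11 * fst (x, y) * snd (x, y) + c30 * fst (x, y)^3))
     \<le> M + (norm c10 * r + norm c01 * r + norm c20 * r^2 + norm c11 * r * r + norm c30 * r^3)"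
    using sep_holomorphicD(4)[OF f b] by (intro order.trans[OF norm_triangle_ineq4] add_mono) auto
qed (auto intro!: holomorphic_intros sep_holomorphicD[OF f])

text \<open>
  Here \<open>e\<close> is the shape of the error in \<open>bivariate_taylor\<close>, as a function of the rescaled absolute
  values \<open>2 \<bar>x\<bar> / r\<close> and \<open>2 \<bar>y\<bar> / r\<close>.
\<close>

lemma weighted_lipschitz_of_taylor:
  assumes P: "sep_holomorphic P r M'" and M: "M \<ge> 0" and C: "C \<ge> 0"
    and bd: "\<And>x y. norm x \<le> r/4 \<Longrightarrow> norm y \<le> r/4 \<Longrightarrow> norm (P (x, y)) \<le> 2 * M * e (2/r * norm x) (2/r * norm y)"
    and e: "\<And>\<mu> X Y. 0 < \<mu> \<Longrightarrow> \<mu> \<le> 1 \<Longrightarrow> 0 \<le> X \<Longrightarrow> 0 \<le> Y \<Longrightarrow> X \<le> 4/r * \<mu> \<Longrightarrow> Y \<le> 4/r * \<mu>^2 \<Longrightarrow> e X Y \<le> C * \<mu>^(d+2)"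
  shows "weighted_lipschitz (min 1 (r/8)) d (2 * (2 * M * C)) P"
proof (rule weighted_lipschitzI[OF P])
  note r = sep_holomorphicD(1)[OF P]
  show "0 \<le> 2 * M * C" using M C by simp
  show "2 * min 1 (r/8) \<le> r" using r by auto
  fix \<nu> x y assume n: "0 < \<nu>" "\<nu> \<le> min 1 (r/8)" and xy: "norm (x::complex) \<le> 2 * \<nu>" "norm (y::complex) \<le> 2 * \<nu>\<^sup>2"
  have "\<nu>^2 \<le> \<nu>" using n power_decreasing[of 1 2 \<nu>] by simp
  then have "norm x \<le> r/4" "norm y \<le> r/4" using xy n by auto
  from bd[OF this] have "norm (P (x, y)) \<le> 2 * M * e (2/r * norm x) (2/r * norm y)" .
  also have "\<dots> \<le> 2 * M * (C * \<nu>^(d+2))"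
  proof (intro mult_left_mono e)
    have "2/r * norm x \<le> 2/r * (2 * \<nu>)" "2/r * norm y \<le> 2/r * (2 * \<nu>^2)"
      using xy r by (intro mult_left_mono; simp)+
    then show "2/r * norm x \<le> 4/r * \<nu>" "2/r * norm y \<le> 4/r * \<nu>^2" by simp_all
  qed (use n r M in auto)
  finally show "norm (P (x, y)) \<le> 2 * M * C * \<nu>^(d+2)" by simp
qed simp

lemma weighted_error_cubic:
  fixes s \<mu> X Y :: real
  assumes "s > 0" "0 < \<mu>" "\<mu> \<le> 1" "0 \<le> X" "0 \<le> Y" "X \<le> s * \<mu>" "Y \<le> s * \<mu>^2"
  shows "Y^2 + (X^3 + X * Y) \<le> (s^2 + (s^3 + s * s)) * \<mu>^(1+2)"
proof -
  have "Y^2 \<le> (s * \<mu>^2)^2" "X^3 \<le> (s * \<mu>)^3" "X * Y \<le> (s * \<mu>) * (s * \<mu>^2)"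
    using assms by (intro power_mono mult_mono; simp)+
  moreover have "(s * \<mu>^2)^2 \<le> s^2 * \<mu>^3"
    using assms power_decreasing[of 3 4 \<mu>] by (simp add: power_mult_distrib flip: power_mult)
  ultimately show ?thesis by (simp add: power_mult_distrib algebra_simps power2_eq_square power3_eq_cube)
qed

lemma weighted_error_quartic:
  fixes s \<mu> X Y :: real
  assumes "s > 0" "0 < \<mu>" "\<mu> \<le> 1" "0 \<le> X" "0 \<le> Y" "X \<le> s * \<mu>" "Y \<le> s * \<mu>^2"
  shows "Y^2 + (X^4 + X^2 * Y) \<le> (s^2 + (s^4 + s^2 * s)) * \<mu>^(2+2)"
proof -
  have "Y^2 \<le> (s * \<mu>^2)^2" "X^4 \<le> (s * \<mu>)^4" "X^2 * Y \<le> (s * \<mu>)^2 * (s * \<mu>^2)"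
    using assms by (intro power_mono mult_mono; simp)+
  moreover have "(s * \<mu>^2)^2 = s^2 * \<mu>^4" "(s * \<mu>)^2 * (s * \<mu>^2) = s^2 * s * \<mu>^4"
    by (simp_all add: power_mult_distrib power4_eq_xxxx power2_eq_square)
  ultimately show ?thesis by (simp add: power_mult_distrib algebra_simps)
qed

lemma first_component_remainder:
  assumes f: "sep_holomorphic f r M"
    and t: "taylor_coeff f 0 0 = 0" "taylor_coeff f 1 0 = 1" "taylor_coeff f 0 1 = 1" "taylor_coeff f 2 0 = a"
  shows "\<exists>C\<ge>0. weighted_lipschitz (min 1 (r/8)) 1 C (\<lambda>(x, y). f (x, y) - x - y - a * x^2)"
proof -
  note r = sep_holomorphicD(1)[OF f]
  have M: "M \<ge> 0" using order.trans[OF norm_ge_zero sep_holomorphicD(4)[OF f, of 0 0]] r by auto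
  define s where "s = 4 / r"
  have s: "s > 0" using r by (simp add: s_def)
  define D where "D = s^2 + (s^3 + s * s)"
  have D: "D \<ge> 0" using s by (simp add: D_def)
  define P where "P = (\<lambda>z. f z - (1 * fst z + 1 * snd z + a * fst z^2 + 0 * fst z * snd z + 0 * fst z^3))"
  have bd: "norm (P (x, y)) \<le> 2 * M * ((2/r * norm y)^2 + ((2/r * norm x)^3 + (2/r * norm x) * (2/r * norm y)))"
    if "norm x \<le> r/4" "norm y \<le> r/4" for x y
  proof -
    have "norm (f (x, y) - (\<Sum>j<2. \<Sum>i<(if j = 0 then 3 else 1). taylor_coeff f i j * x^i * y^j))
      \<le> 2 * M * ((2/r * norm y)^2 + (\<Sum>j<2. (2/r * norm x)^(if j = 0 then 3 else 1) * (2/r * norm y)^j))"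
      by (rule bivariate_taylor[OF f that])
    moreover have "(\<Sum>j<2. \<Sum>i<(if j = 0 then 3 else 1). taylor_coeff f i j * x^i * y^j) = x + y + a * x^2"
      using t by (simp add: numeral_2_eq_2 numeral_3_eq_3)
    ultimately show ?thesis by (simp add: P_def numeral_2_eq_2)
  qed
  have "weighted_lipschitz (min 1 (r/8)) 1 (2 * (2 * M * D)) P"
  proof (rule weighted_lipschitz_of_taylor[where e = "\<lambda>X Y. Y^2 + (X^3 + X * Y)", OF sep_holomorphic_subtract_polynomial[OF f, of 1 1 a 0 0, folded P_def] M D bd])
    show "Y^2 + (X^3 + X * Y) \<le> D * \<mu>^(1+2)" if "0 < \<mu>" "\<mu> \<le> 1" "0 \<le> X" "0 \<le> Y" "X \<le> 4/r * \<mu>" "Y \<le> 4/r * \<mu>^2" for \<mu> X Y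
      unfolding D_def by (rule weighted_error_cubic[OF s that(1-4)]) (use that in \<open>auto simp: s_def\<close>)
  qed
  moreover have "P = (\<lambda>(x, y). f (x, y) - x - y - a * x^2)" by (auto simp: P_def fun_eq_iff)
  moreover have "0 \<le> 2 * (2 * M * D)" using M D by simp
  ultimately show ?thesis by metis
qed

lemma second_component_remainder:
  assumes f: "sep_holomorphic f r M"
    and t: "taylor_coeff f 0 0 = 0" "taylor_coeff f 1 0 = 0" "taylor_coeff f 0 1 = 1" "taylor_coeff f 2 0 = 0"
      "taylor_coeff f 1 1 = 2 * b" "taylor_coeff f 3 0 = c"
  shows "\<exists>C\<ge>0. weighted_lipschitz (min 1 (r/8)) 2 C (\<lambda>(x, y). f (x, y) - y - 2 * b * x * y - c * x^3)"
proof -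
  note r = sep_holomorphicD(1)[OF f]
  have M: "M \<ge> 0" using order.trans[OF norm_ge_zero sep_holomorphicD(4)[OF f, of 0 0]] r by auto
  define s where "s = 4 / r"
  have s: "s > 0" using r by (simp add: s_def)
  define D where "D = s^2 + (s^4 + s^2 * s)"
  have D: "D \<ge> 0" using s by (simp add: D_def)
  define P where "P = (\<lambda>z. f z - (0 * fst z + 1 * snd z + 0 * fst z^2 + (2 * b) * fst z * snd z + c * fst z^3))"
  have bd: "norm (P (x, y)) \<le> 2 * M * ((2/r * norm y)^2 + ((2/r * norm x)^4 + (2/r * norm x)^2 * (2/r * norm y)))"
    if "norm x \<le> r/4" "norm y \<le> r/4" for x y
  proof -
    have "norm (f (x, y) - (\<Sum>j<2. \<Sum>i<(if j = 0 then 4 else 2). taylor_coeff f i j * x^i * y^j))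
      \<le> 2 * M * ((2/r * norm y)^2 + (\<Sum>j<2. (2/r * norm x)^(if j = 0 then 4 else 2) * (2/r * norm y)^j))"
      by (rule bivariate_taylor[OF f that])
    moreover have "(\<Sum>j<2. \<Sum>i<(if j = 0 then 4 else 2). taylor_coeff f i j * x^i * y^j) = y + 2 * b * x * y + c * x^3"
      using t by (simp add: numeral_2_eq_2 numeral_3_eq_3 eval_nat_numeral)
    ultimately show ?thesis by (simp add: P_def numeral_2_eq_2)
  qed
  have "weighted_lipschitz (min 1 (r/8)) 2 (2 * (2 * M * D)) P"
  proof (rule weighted_lipschitz_of_taylor[where e = "\<lambda>X Y. Y^2 + (X^4 + X^2 * Y)", OF sep_holomorphic_subtract_polynomial[OF f, of 0 1 0 "2 * b" c, folded P_def] M D bd])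
    show "Y^2 + (X^4 + X^2 * Y) \<le> D * \<mu>^(2+2)" if "0 < \<mu>" "\<mu> \<le> 1" "0 \<le> X" "0 \<le> Y" "X \<le> 4/r * \<mu>" "Y \<le> 4/r * \<mu>^2" for \<mu> X Y
      unfolding D_def by (rule weighted_error_quartic[OF s that(1-4)]) (use that in \<open>auto simp: s_def\<close>)
  qed
  moreover have "P = (\<lambda>(x, y). f (x, y) - y - 2 * b * x * y - c * x^3)" by (auto simp: P_def fun_eq_iff)
  moreover have "0 \<le> 2 * (2 * M * D)" using M D by simp
  ultimately show ?thesis by metis
qed

text \<open>
  Two blocks of size one would make the matrix diagonal, so there is a single block of size two, and
  its eigenvalue is in the spectrum.
\<close>

lemma nondiagonal_jordan_2x2:
  fixes p q r s :: complex
  defines "A \<equiv> mat_of_rows_list 2 [[p, q], [r, s]]"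
  assumes nd: "\<not> diagonalizable_mat A" and sp: "spectrum A = {1}" and jf: "in_jordan_form A"
  shows "p = 1 \<and> q = 1 \<and> r = 0 \<and> s = 1"
proof -
  have dim: "dim_row A = 2" "dim_col A = 2" by (simp_all add: A_def mat_of_rows_list_def)
  have ent: "A $$ (0, 0) = p" "A $$ (0, 1) = q" "A $$ (1, 0) = r" "A $$ (1, 1) = s"
    by (simp_all add: A_def mat_of_rows_list_def)
  obtain n_as where n: "0 \<notin> fst ` set n_as" and An: "A = jordan_matrix n_as"
    using jf unfolding in_jordan_form_def by blast
  have sum: "sum_list (map fst n_as) = 2" using dim(1) unfolding An by simp
  have "\<not> diagonal_mat A"
  proof
    assume "diagonal_mat A"
    moreover have "similar_mat A A" by (rule similar_mat_refl[of _ 2]) (use dim in auto)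
    ultimately show False using nd unfolding diagonalizable_mat_def by blast
  qed
  then have off: "q \<noteq> 0 \<or> r \<noteq> 0"
    unfolding diagonal_mat_def dim using ent by (auto simp: less_2_cases_iff)
  obtain m x rest where c1: "n_as = (m, x) # rest" using sum by (cases n_as) auto
  have m: "m \<noteq> 0" using n c1 by auto
  show ?thesis
  proof (cases rest)
    case Nil
    then have "m = 2" using sum c1 by simp
    then have AJ: "A = jordan_block 2 x"
      unfolding An c1 Nil jordan_matrix_def by (intro eq_matI) (auto simp: Let_def)
    have e: "p = x" "q = 1" "r = 0" "s = x" unfolding ent[symmetric] AJ by simp_all
    have "eigenvalue A x"
      unfolding eigenvalue_def
    proof (rule exI[of _ "unit_vec 2 0"])
      have "A *\<^sub>v unit_vec 2 0 = x \<cdot>\<^sub>v unit_vec 2 0"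
        by (rule eq_vecI) (auto simp: dim scalar_prod_def ent e less_2_cases_iff numeral_2_eq_2 AJ)
      then show "eigenvector A (unit_vec 2 0) x" unfolding eigenvector_def using dim by (auto simp: unit_vec_nonzero)
    qed
    then have "x \<in> spectrum A" by (simp add: spectrum_def)
    then have "x = 1" using sp by simp
    then show ?thesis using e by simp
  next
    case (Cons nb rest')
    obtain m' x' where nb: "nb = (m', x')" by (cases nb)
    have m': "m' \<noteq> 0" using n c1 Cons nb by auto
    have "m + m' + sum_list (map fst rest') = 2" using sum c1 Cons nb by simp
    then have mm: "m = 1" "m' = 1" "sum_list (map fst rest') = 0" using m m' by linarith+
    have "rest' = []"
    proof (rule ccontr)
      assume "rest' \<noteq> []"
      then obtain y ys where "rest' = y # ys" by (cases rest') auto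
      then show False using mm(3) n c1 Cons by auto
    qed
    then have AJ: "A = diag_block_mat [jordan_block 1 x, jordan_block 1 x']"
      unfolding An c1 Cons nb jordan_matrix_def mm by simp
    have "q = 0" "r = 0" unfolding ent[symmetric] AJ by (simp_all add: Let_def)
    then show ?thesis using off by simp
  qed
qed

section \<open>From solutions to parabolic curves\<close>

lemma disc_imp_halfplane:
  assumes "R > 0" "\<zeta> \<in> ball 1 1"
  shows "Re (of_real (2 * R) / \<zeta>) > R"
proof -
  have "norm (1 - \<zeta>) ^ 2 < 1 ^ 2" using assms(2) by (intro power_strict_mono) (auto simp: dist_norm)
  then have "(1 - Re \<zeta>)^2 + (Im \<zeta>)^2 < 1" by (simp add: cmod_power2)
  then have a: "(Re \<zeta>)^2 + (Im \<zeta>)^2 < 2 * Re \<zeta>" by (simp add: power2_eq_square algebra_simps)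
  have "\<zeta> \<noteq> 0" using assms(2) by auto
  then have p: "0 < (Re \<zeta>)^2 + (Im \<zeta>)^2" by (metis complex_neq_0)
  have "Re (of_real (2 * R) / \<zeta>) = R * ((2 * Re \<zeta>) / ((Re \<zeta>)^2 + (Im \<zeta>)^2))"
    by (simp add: Re_divide)
  moreover have "R * 1 < R * ((2 * Re \<zeta>) / ((Re \<zeta>)^2 + (Im \<zeta>)^2))"
    using a p assms(1) by (intro mult_strict_left_mono) (auto simp: less_divide_eq)
  ultimately show ?thesis by simp
qed

lemma halfplane_imp_disc:
  assumes "R > 0" "Re w > R"
  shows "of_real (2 * R) / w \<in> ball 1 1"
proof -
  have t: "w \<noteq> 0" using assms by auto
  have "(Re w - 2 * R)^2 < (Re w)^2"
  proof -
    have "(Re w)^2 - (Re w - 2 * R)^2 = 4 * R * (Re w - R)" by (simp add: power2_eq_square algebra_simps)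
    moreover have "\<dots> > 0" using assms by simp
    ultimately show ?thesis by linarith
  qed
  then have "norm (w - of_real (2 * R))^2 < norm w^2" by (simp add: cmod_power2)
  then have "norm (w - of_real (2 * R)) < norm w" by (rule power_less_imp_less_base) simp
  moreover have "1 - of_real (2 * R) / w = (w - of_real (2 * R)) / w" using t by (simp add: diff_divide_distrib)
  ultimately show ?thesis using t by (simp add: dist_norm norm_divide)
qed

lemma proj_pt_scale:
  assumes "c \<noteq> 0"
  shows "proj_pt (c * x, c * y) = proj_pt (x, y)"
proof -
  have "\<exists>e. (d * c * x, d * c * y) = (e * x, e * y) \<and> e \<noteq> 0" if "d \<noteq> 0" for d
    using assms that by (intro exI[of _ "d * c"]) auto
  moreover have "\<exists>e. (d * x, d * y) = (e * (c * x), e * (c * y)) \<and> e \<noteq> 0" if "d \<noteq> 0" for d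
    using assms that by (intro exI[of _ "d / c"]) auto
  ultimately show ?thesis unfolding proj_pt_def by (fastforce simp: mult.assoc)
qed

lemma tangent_e1I:
  assumes lim: "((\<lambda>\<zeta>. snd (\<phi> \<zeta>) / fst (\<phi> \<zeta>)) \<longlongrightarrow> 0) (at 0 within \<Delta>)"
    and nz: "\<And>\<zeta>. \<zeta> \<in> \<Delta> \<Longrightarrow> fst (\<phi> \<zeta>) \<noteq> 0"
  shows "tangent_to \<phi> (1, 0)"
  unfolding tangent_to_def limitin_def
proof (intro conjI allI impI)
  show "proj_pt (1, 0) \<in> topspace P1_topology" by (auto simp: topspace_P1_topology zero_prod_def)
  fix S assume "openin P1_topology S \<and> proj_pt (1, 0) \<in> S"
  then have W: "open {v \<in> - {0}. proj_pt v \<in> S}" and m: "(1, 0) \<in> {v \<in> - {0}. proj_pt v \<in> S}"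
    by (auto simp: openin_P1_topology zero_prod_def)
  have "((\<lambda>\<zeta>. (1, snd (\<phi> \<zeta>) / fst (\<phi> \<zeta>))) \<longlongrightarrow> (1, 0)) (at 0 within \<Delta>)"
    by (intro tendsto_Pair tendsto_const lim)
  from topological_tendstoD[OF this W m]
  have "\<forall>\<^sub>F \<zeta> in at 0 within \<Delta>. proj_pt (1, snd (\<phi> \<zeta>) / fst (\<phi> \<zeta>)) \<in> S" by eventually_elim auto
  moreover have "\<forall>\<^sub>F \<zeta> in at 0 within \<Delta>. \<zeta> \<in> \<Delta>" by (auto simp: eventually_at_filter)
  ultimately show "\<forall>\<^sub>F \<zeta> in at 0 within \<Delta>. proj_pt (\<phi> \<zeta>) \<in> S"
  proof eventually_elim
    case (elim \<zeta>)
    have "proj_pt (fst (\<phi> \<zeta>) * 1, fst (\<phi> \<zeta>) * (snd (\<phi> \<zeta>) / fst (\<phi> \<zeta>))) = proj_pt (1, snd (\<phi> \<zeta>) / fst (\<phi> \<zeta>))"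
      using nz[OF elim(2)] by (rule proj_pt_scale)
    then show ?case using elim(1) nz[OF elim(2)] by simp
  qed
qed

text \<open>
  \<open>z\<^sub>2 / z\<^sub>1\<^sup>2 \<rightarrow> t\<close> as \<open>z\<^sub>1\<close> tends to \<open>0\<close> inside \<open>D\<close>, in a form that also excludes points
  of \<open>D\<close> with \<open>z\<^sub>1 = 0 \<noteq> z\<^sub>2\<close>. Unlike a limit along a parametrisation, it depends on the image of a
  curve only.
\<close>

definition slope_at_origin :: "(complex \<times> complex) set \<Rightarrow> complex \<Rightarrow> bool" where
  "slope_at_origin D t \<longleftrightarrow> (\<forall>e>0. \<exists>d>0. \<forall>z\<in>D. norm (fst z) < d \<longrightarrow>
     norm (snd z - t * (fst z)^2) \<le> e * norm (fst z)^2)"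

text \<open>
  A common piece of curve ending at the origin contains points arbitrarily close to the origin, at
  which \<open>z\<^sub>2 / z\<^sub>1\<^sup>2\<close> would be close to both \<open>t1\<close> and \<open>t2\<close>.
\<close>

lemma distinct_curves_of_slopes:
  assumes s: "slope_at_origin (\<phi> ` \<Delta>) t1" "slope_at_origin (\<psi> ` \<Delta>) t2" and ne: "t1 \<noteq> t2"
  shows "distinct_curves \<phi> \<psi>"
  unfolding distinct_curves_def
proof safe
  fix \<gamma> assume g: "holomorphic_curve \<gamma>" and sub: "\<gamma> ` \<Delta> \<subseteq> \<phi> ` \<Delta> \<inter> \<psi> ` \<Delta>"
  \<comment> \<open>Small enough for two errors of relative size \<open>e\<close> not to make up for \<open>t1 - t2\<close>.\<close>
  define e where "e = norm (t1 - t2) / 3"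
  have e: "e > 0" using ne by (simp add: e_def)
  obtain d1 where d1: "d1 > 0" "\<And>z. z \<in> \<phi> ` \<Delta> \<Longrightarrow> norm (fst z) < d1 \<Longrightarrow> norm (snd z - t1 * (fst z)^2) \<le> e * norm (fst z)^2"
    using s(1) e unfolding slope_at_origin_def by blast
  obtain d2 where d2: "d2 > 0" "\<And>z. z \<in> \<psi> ` \<Delta> \<Longrightarrow> norm (fst z) < d2 \<Longrightarrow> norm (snd z - t2 * (fst z)^2) \<le> e * norm (fst z)^2"
    using s(2) e unfolding slope_at_origin_def by blast
  have "(\<gamma> \<longlongrightarrow> 0) (at 0 within \<Delta>)" using g by (simp add: holomorphic_curve_def)
  then have "((\<lambda>\<zeta>. norm (fst (\<gamma> \<zeta>))) \<longlongrightarrow> norm (fst (0 :: complex \<times> complex))) (at 0 within \<Delta>)"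
    by (intro tendsto_norm tendsto_fst)
  then have "\<forall>\<^sub>F \<zeta> in at 0 within \<Delta>. norm (fst (\<gamma> \<zeta>)) < min d1 d2"
    by (rule order_tendstoD) (use d1 d2 in auto)
  moreover have "\<forall>\<^sub>F \<zeta> in at 0 within \<Delta>. \<zeta> \<in> \<Delta>" by (auto simp: eventually_at_filter)
  ultimately have "\<forall>\<^sub>F \<zeta> in at 0 within \<Delta>. norm (fst (\<gamma> \<zeta>)) < min d1 d2 \<and> \<zeta> \<in> \<Delta>"
    by (rule eventually_conj)
  moreover have "at 0 within \<Delta> \<noteq> bot"
  proof -
    have "(0::complex) islimpt ball 1 1" by (subst islimpt_ball) auto
    then show ?thesis by (simp add: trivial_limit_within)
  qed
  ultimately obtain \<zeta> where z: "norm (fst (\<gamma> \<zeta>)) < min d1 d2" "\<zeta> \<in> \<Delta>"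
    using eventually_happens' by blast
  define x where "x = fst (\<gamma> \<zeta>)"
  define y where "y = snd (\<gamma> \<zeta>)"
  have 1: "norm (y - t1 * x^2) \<le> e * norm x^2" and 2: "norm (y - t2 * x^2) \<le> e * norm x^2"
    unfolding x_def y_def using sub z by (auto intro!: d1 d2)
  have "x \<noteq> 0"
  proof
    assume "x = 0"
    then have "\<gamma> \<zeta> = 0" using 1 by (simp add: x_def y_def prod_eq_iff)
    then show False using g z(2) unfolding holomorphic_curve_def by blast
  qed
  have "norm (t1 - t2) * norm x^2 = norm ((y - t2 * x^2) - (y - t1 * x^2))"
    by (simp add: norm_mult[symmetric] norm_power[symmetric] left_diff_distrib)
  also have "\<dots> \<le> e * norm x^2 + e * norm x^2"
    using 1 2 norm_triangle_ineq4 by (metis add.commute add_mono order_trans)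
  also have "\<dots> = (2 * e) * norm x^2" by simp
  finally have "norm (t1 - t2) \<le> 2 * e" using \<open>x \<noteq> 0\<close> by (simp add: mult_le_cancel_right)
  then show False using e by (simp add: e_def)
qed

definition harmonic_decay :: "(complex \<times> complex \<Rightarrow> complex \<times> complex) \<Rightarrow> complex \<times> complex \<Rightarrow> bool" where
  "harmonic_decay F z \<longleftrightarrow> (\<exists>c1 c2. c1 \<noteq> 0 \<and>
          (\<lambda>k. fst ((F ^^ k) z) - c1 / of_nat k) \<in> o(\<lambda>k. 1 / of_nat k) \<and>
          (\<lambda>k. snd ((F ^^ k) z) - c2 / (of_nat k)\<^sup>2) \<in> o(\<lambda>k. 1 / (of_nat k)\<^sup>2))"

text \<open>
  The curve is \<open>w \<mapsto> (z1 w, z2 w)\<close> after the change of variable \<open>w = 2 R / \<zeta>\<close>, and \<open>F\<close> acts on it by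
  \<open>w \<mapsto> w + 1\<close>. All limits are taken for \<open>w \<rightarrow> \<infinity>\<close> in the half plane without any restriction on the
  direction, because \<open>\<zeta>\<close> may tend to \<open>0\<close> tangentially to the boundary of \<open>\<Delta>\<close>. The lower bound for \<open>z1\<close>
  implies that a point of the curve is close to the origin only if \<open>w\<close> is large.
\<close>

lemma parabolic_curve_of_solution:
  fixes F :: "complex \<times> complex \<Rightarrow> complex \<times> complex"
  assumes R: "R \<ge> 1" and k0: "\<kappa> \<noteq> 0"
    and hol: "z1 holomorphic_on halfplane R" "z2 holomorphic_on halfplane R" and g: "g \<in> log_polys"
    and inv: "\<And>w. Re w > R \<Longrightarrow> F (z1 w, z2 w) = (z1 (w + 1), z2 (w + 1))"
    and U: "\<And>w. Re w > R \<Longrightarrow> (z1 w, z2 w) \<in> U"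
    and fine: "\<And>w. Re w > R \<Longrightarrow> norm (z1 w - \<kappa> / w - g w / w^2) \<le> 1 / norm w ^ 4"
    and b1: "\<And>w. Re w > R \<Longrightarrow> norm (z1 w - \<kappa> / w) \<le> M * norm w powr (-(3/2))"
    and b2: "\<And>w. Re w > R \<Longrightarrow> norm (z2 w - t * \<kappa>^2 / w^2) \<le> M * norm w powr (-(5/2))"
    and low: "\<And>w. Re w > R \<Longrightarrow> norm \<kappa> / (2 * norm w) \<le> norm (z1 w)"
  shows "\<exists>\<phi>. parabolic_curve U F \<phi> \<and> tangent_to \<phi> (1, 0) \<and>
       (\<forall>z\<in>\<phi> ` \<Delta>. harmonic_decay F z) \<and>
       slope_at_origin (\<phi> ` \<Delta>) t"
proof -
  define Z where "Z w = (z1 w, z2 w)" for w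
  define G where "G = inf at_infinity (principal (halfplane R))"
  define T where "T \<zeta> = of_real (2 * R) / \<zeta>" for \<zeta> :: complex
  define \<phi> where "\<phi> \<zeta> = Z (T \<zeta>)" for \<zeta>
  have R0: "R > 0" using R by simp
  have evG: "\<forall>\<^sub>F w in G. Re w > R" unfolding G_def by (simp add: eventually_inf_principal)
  have Gpos: "norm w > 0" if "Re w > R" for w using that R complex_Re_le_cmod[of w] by linarith
  have Ginf: "filterlim norm at_top G" unfolding G_def
    by (rule filterlim_mono[OF filterlim_norm_at_top order.refl inf_le1])
  have powr0: "((\<lambda>w. M * norm w powr (-(1/2))) \<longlongrightarrow> 0) G"
  proof -
    have "((\<lambda>x::real. M * x powr (-(1/2))) \<longlongrightarrow> 0) at_top" by real_asymp
    from filterlim_compose[OF this Ginf] show ?thesis .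
  qed
  have lim: "((\<lambda>w. w ^ n * z w) \<longlongrightarrow> c) G"
    if b: "\<And>w. Re w > R \<Longrightarrow> norm (z w - c / w ^ n) \<le> M * norm w powr (-(real n + 1/2))"
    for n :: nat and z :: "complex \<Rightarrow> complex" and c
  proof (rule LIM_zero_cancel, rule Lim_null_comparison[OF _ powr0])
    show "\<forall>\<^sub>F w in G. norm (w ^ n * z w - c) \<le> M * norm w powr (-(1/2))"
      using evG
    proof eventually_elim
      case (elim w)
      have "w ^ n * z w - c = w ^ n * (z w - c / w ^ n)" using Gpos[OF elim] by (simp add: right_diff_distrib)
      then have "norm (w ^ n * z w - c) \<le> norm w ^ n * (M * norm w powr (-(real n + 1/2)))"
        using b[OF elim] by (simp add: norm_mult norm_power mult_left_mono)
      also have "\<dots> = M * (norm w powr real n * norm w powr (-(real n + 1/2)))"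
        using Gpos[OF elim] by (simp add: powr_realpow)
      also have "\<dots> = M * norm w powr (-(1/2))" by (simp only: powr_add[symmetric]) simp
      finally show ?case .
    qed
  qed
  have lim1: "((\<lambda>w. w * z1 w) \<longlongrightarrow> \<kappa>) G" using lim[of z1 \<kappa> 1] b1 by simp
  have lim2: "((\<lambda>w. w^2 * z2 w) \<longlongrightarrow> t * \<kappa>^2) G" using lim[of z2 "t * \<kappa>^2" 2] b2 by simp
  have inv0: "((\<lambda>w. 1 / w) \<longlongrightarrow> 0) G"
    unfolding divide_inverse mult_1_left G_def by (rule tendsto_mono[OF inf_le1 tendsto_inverse_0])
  have nz: "w \<noteq> 0" "z1 w \<noteq> 0" if "Re w > R" for w
  proof -
    show "w \<noteq> 0" using Gpos[OF that] by simp
    have "0 < norm \<kappa> / (2 * norm w)" using k0 Gpos[OF that] by simp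
    then have "0 < norm (z1 w)" using low[OF that] by linarith
    then show "z1 w \<noteq> 0" by simp
  qed
  have z1_0: "(z1 \<longlongrightarrow> 0) G"
  proof (rule Lim_transform_eventually)
    show "((\<lambda>w. (1 / w) * (w * z1 w)) \<longlongrightarrow> 0) G" using tendsto_mult[OF inv0 lim1] by simp
    show "\<forall>\<^sub>F w in G. (1 / w) * (w * z1 w) = z1 w" using evG by eventually_elim (simp add: nz)
  qed
  have z2_0: "(z2 \<longlongrightarrow> 0) G"
  proof (rule Lim_transform_eventually)
    show "((\<lambda>w. (1 / w) * (1 / w) * (w^2 * z2 w)) \<longlongrightarrow> 0) G"
      using tendsto_mult[OF tendsto_mult[OF inv0 inv0] lim2] by simp
    show "\<forall>\<^sub>F w in G. (1 / w) * (1 / w) * (w^2 * z2 w) = z2 w" using evG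
      by eventually_elim (simp add: nz power2_eq_square)
  qed
  have ratio: "((\<lambda>w. z2 w / (z1 w)^2) \<longlongrightarrow> t) G"
  proof (rule Lim_transform_eventually)
    show "((\<lambda>w. (w^2 * z2 w) / (w * z1 w)^2) \<longlongrightarrow> t) G"
      using tendsto_divide[OF lim2 tendsto_power[OF lim1, of 2]] k0 by simp
    show "\<forall>\<^sub>F w in G. (w^2 * z2 w) / (w * z1 w)^2 = z2 w / (z1 w)^2" using evG
      by eventually_elim (simp add: nz power_mult_distrib)
  qed
  have ratio1: "((\<lambda>w. z2 w / z1 w) \<longlongrightarrow> 0) G"
  proof (rule Lim_transform_eventually)
    show "((\<lambda>w. z2 w / (z1 w)^2 * z1 w) \<longlongrightarrow> 0) G" using tendsto_mult[OF ratio z1_0] by simp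
    show "\<forall>\<^sub>F w in G. z2 w / (z1 w)^2 * z1 w = z2 w / z1 w" using evG
      by eventually_elim (simp add: nz power2_eq_square)
  qed
  have TH: "Re (T \<zeta>) > R" if "\<zeta> \<in> \<Delta>" for \<zeta> unfolding T_def using R0 that by (rule disc_imp_halfplane)
  have Tsurj: "\<exists>\<zeta>\<in>\<Delta>. T \<zeta> = w" if "Re w > R" for w
    using halfplane_imp_disc[OF R0 that] R0 nz[OF that] by (intro bexI[of _ "of_real (2 * R) / w"]) (auto simp: T_def)
  have img: "\<phi> ` \<Delta> = Z ` halfplane R"
  proof
    show "\<phi> ` \<Delta> \<subseteq> Z ` halfplane R" using TH by (auto simp: \<phi>_def)
    show "Z ` halfplane R \<subseteq> \<phi> ` \<Delta>"
    proof
      fix z assume "z \<in> Z ` halfplane R"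
      then obtain w where t: "Re w > R" "z = Z w" by auto
      then obtain \<zeta> where "\<zeta> \<in> \<Delta>" "T \<zeta> = w" using Tsurj by blast
      then show "z \<in> \<phi> ` \<Delta>" using t by (auto simp: \<phi>_def intro!: image_eqI[of _ _ \<zeta>])
    qed
  qed
  have TG: "filterlim T G (at 0 within \<Delta>)"
    unfolding G_def filterlim_inf filterlim_principal
  proof
    have "filterlim (\<lambda>\<zeta>. of_real (2 * R) * inverse \<zeta>) at_infinity (at (0::complex))"
      using R0 by (intro tendsto_mult_filterlim_at_infinity[OF tendsto_const _ filterlim_inverse_at_infinity]) simp
    then have "filterlim T at_infinity (at 0)" by (simp add: T_def[abs_def] divide_inverse)
    then show "filterlim T at_infinity (at 0 within \<Delta>)" by (rule filterlim_mono) (auto intro: at_le)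
    show "\<forall>\<^sub>F \<zeta> in at 0 within \<Delta>. T \<zeta> \<in> halfplane R" using TH by (auto simp: eventually_at_filter)
  qed
  have iter: "(F ^^ k) (Z w) = Z (w + of_nat k)" if "Re w > R" for k w
  proof (induction k)
    case (Suc k)
    have t: "Re (w + of_nat k) > R" using that by simp
    have "(F ^^ Suc k) (Z w) = F (Z (w + of_nat k))" using Suc by simp
    also have "\<dots> = Z (w + of_nat k + 1)" using inv[OF t] by (simp add: Z_def)
    finally show ?case by (simp add: add_ac)
  qed simp
  have Zinj: "w = \<sigma>" if t: "Re w > R" "Re \<sigma> > R" and e: "Z w = Z \<sigma>" for w \<sigma>
  proof (rule shift_separates[OF g k0 R fine t])
    fix k
    have "Z (w + of_nat k) = Z (\<sigma> + of_nat k)" using iter[OF t(1), of k] iter[OF t(2), of k] e by simp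
    then show "z1 (w + of_nat k) = z1 (\<sigma> + of_nat k)" by (simp add: Z_def)
  qed
  have Tinj: "inj_on T \<Delta>"
  proof (rule inj_onI)
    fix x y :: complex assume xy: "x \<in> \<Delta>" "y \<in> \<Delta>" "T x = T y"
    then have "x \<noteq> 0" "y \<noteq> 0" by auto
    then show "x = y" using xy(3) R0 by (simp add: T_def field_simps)
  qed
  have Thol: "T holomorphic_on \<Delta>" unfolding T_def by (intro holomorphic_intros) auto
  have "holomorphic_curve \<phi>"
    unfolding holomorphic_curve_def
  proof (intro conjI)
    have "(z1 \<circ> T) holomorphic_on \<Delta>" "(z2 \<circ> T) holomorphic_on \<Delta>"
      using TH by (auto intro!: holomorphic_on_compose_gen[OF Thol hol(1)] holomorphic_on_compose_gen[OF Thol hol(2)])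
    then show "(fst \<circ> \<phi>) holomorphic_on \<Delta>" "(snd \<circ> \<phi>) holomorphic_on \<Delta>" by (simp_all add: \<phi>_def[abs_def] Z_def o_def)
    show "inj_on \<phi> \<Delta>"
    proof (rule inj_onI)
      fix x y assume xy: "x \<in> \<Delta>" "y \<in> \<Delta>" "\<phi> x = \<phi> y"
      then have "T x = T y" unfolding \<phi>_def by (intro Zinj TH)
      then show "x = y" using Tinj xy by (auto dest: inj_onD)
    qed
    show "\<phi> ` \<Delta> \<subseteq> - {0}" unfolding img using nz by (auto simp: Z_def zero_prod_def)
    have "(Z \<longlongrightarrow> 0) G" unfolding Z_def[abs_def] zero_prod_def by (intro tendsto_Pair z1_0 z2_0)
    from filterlim_compose[OF this TG] show "(\<phi> \<longlongrightarrow> 0) (at 0 within \<Delta>)" unfolding \<phi>_def[abs_def] .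
  qed
  moreover have "stable_curve U F \<phi>"
    unfolding stable_curve_def invariant_curve_def img
  proof (intro conjI allI impI)
    show "Z ` halfplane R \<subseteq> U" using U by (auto simp: Z_def)
    show "F ` Z ` halfplane R \<subseteq> Z ` halfplane R" using inv by (auto simp: Z_def)
    fix K assume K: "compact K \<and> K \<subseteq> Z ` halfplane R"
    show "uniform_limit K (\<lambda>k. F ^^ k) (\<lambda>_. 0) sequentially"
    proof (rule uniform_limitI)
      fix e :: real assume e: "e > 0"
      have "(Z \<longlongrightarrow> 0) G" unfolding Z_def[abs_def] zero_prod_def by (intro tendsto_Pair z1_0 z2_0)
      then have "\<forall>\<^sub>F w in G. dist (Z w) 0 < e" using e by (rule tendstoD)
      then obtain B where B: "\<And>w. norm w \<ge> B \<Longrightarrow> Re w > R \<Longrightarrow> dist (Z w) 0 < e"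
        unfolding G_def eventually_inf_principal eventually_at_infinity by auto
      have "\<forall>\<^sub>F k in sequentially. B \<le> real k" by real_asymp
      then show "\<forall>\<^sub>F k in sequentially. \<forall>z\<in>K. dist ((F ^^ k) z) 0 < e"
      proof eventually_elim
        case (elim k)
        show ?case
        proof
          fix z assume "z \<in> K"
          then have "z \<in> Z ` halfplane R" using K by blast
          then obtain w where t: "Re w > R" "z = Z w" by auto
          have "norm (w + of_nat k) \<ge> B" using complex_Re_le_cmod[of "w + of_nat k"] t(1) R0 elim by simp
          then show "dist ((F ^^ k) z) 0 < e" unfolding t(2) iter[OF t(1)] using t(1) by (intro B) auto
        qed
      qed
    qed
  qed
  moreover have "tangent_to \<phi> (1, 0)"
  proof (rule tangent_e1I)
    show "((\<lambda>\<zeta>. snd (\<phi> \<zeta>) / fst (\<phi> \<zeta>)) \<longlongrightarrow> 0) (at 0 within \<Delta>)"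
      using filterlim_compose[OF ratio1 TG] by (simp add: \<phi>_def Z_def)
  qed (use nz TH in \<open>auto simp: \<phi>_def Z_def\<close>)
  moreover have "harmonic_decay F z" if zin: "z \<in> \<phi> ` \<Delta>" for z
  proof -
    obtain w where t: "Re w > R" "z = Z w" using zin unfolding img by auto
    have Gk: "filterlim (\<lambda>k. w + of_nat k) G sequentially"
      unfolding G_def filterlim_inf filterlim_principal
    proof
      show "filterlim (\<lambda>k. w + of_nat k) at_infinity sequentially"
        by (rule tendsto_add_filterlim_at_infinity[OF tendsto_const tendsto_of_nat])
      show "\<forall>\<^sub>F k in sequentially. w + of_nat k \<in> halfplane R" using t(1) by (auto intro!: always_eventually)
    qed
    have quot: "(\<lambda>k. of_nat k / (w + of_nat k)) \<longlonglongrightarrow> 1"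
    proof (rule Lim_transform_eventually)
      show "(\<lambda>k. 1 - w * (1 / (w + of_nat k))) \<longlonglongrightarrow> 1"
        using tendsto_diff[OF tendsto_const[of 1] tendsto_mult[OF tendsto_const[of w] filterlim_compose[OF inv0 Gk]]] by simp
      have "1 - w * (1 / (w + of_nat k)) = of_nat k / (w + of_nat k)" for k
        using nz(1)[of "w + of_nat k"] t(1) by (simp add: field_simps)
      then show "\<forall>\<^sub>F k in sequentially. 1 - w * (1 / (w + of_nat k)) = of_nat k / (w + of_nat k)" by simp
    qed
    have orbit: "(\<lambda>k. z (w + of_nat k) - c / of_nat k ^ n) \<in> o(\<lambda>k. 1 / of_nat k ^ n)"
      if l: "((\<lambda>w. w ^ n * z w) \<longlongrightarrow> c) G" for n :: nat and z :: "complex \<Rightarrow> complex" and c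
    proof (rule smalloI_tendsto)
      have k_pos: "\<forall>\<^sub>F k in sequentially. (of_nat k :: complex) \<noteq> 0"
        using eventually_gt_at_top[of 0] by eventually_elim simp
      then show "\<forall>\<^sub>F k in sequentially. 1 / (of_nat k :: complex) ^ n \<noteq> 0" by eventually_elim simp
      show "(\<lambda>k. (z (w + of_nat k) - c / of_nat k ^ n) / (1 / of_nat k ^ n)) \<longlonglongrightarrow> 0"
      proof (rule Lim_transform_eventually)
        show "(\<lambda>k. (of_nat k / (w + of_nat k)) ^ n * ((w + of_nat k) ^ n * z (w + of_nat k)) - c) \<longlonglongrightarrow> 0"
          using tendsto_diff[OF tendsto_mult[OF tendsto_power[OF quot, of n] filterlim_compose[OF l Gk]] tendsto_const[of c]]
          by simp
        show "\<forall>\<^sub>F k in sequentially. (of_nat k / (w + of_nat k)) ^ n * ((w + of_nat k) ^ n * z (w + of_nat k)) - c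
            = (z (w + of_nat k) - c / of_nat k ^ n) / (1 / of_nat k ^ n)"
          using k_pos
        proof eventually_elim
          case (elim k)
          have "w + of_nat k \<noteq> 0" using nz(1)[of "w + of_nat k"] t(1) by simp
          then show ?case using elim by (simp add: power_divide right_diff_distrib left_diff_distrib mult.commute)
        qed
      qed
    qed
    have "(\<lambda>k. z1 (w + of_nat k) - \<kappa> / of_nat k) \<in> o(\<lambda>k. 1 / of_nat k)"
      using orbit[of 1 z1 \<kappa>] lim1 by simp
    moreover have "(\<lambda>k. z2 (w + of_nat k) - (t * \<kappa>^2) / (of_nat k)^2) \<in> o(\<lambda>k. 1 / (of_nat k)^2)"
      by (rule orbit[OF lim2])
    ultimately show ?thesis unfolding harmonic_decay_def t(2) iter[OF t(1)] using k0
      by (intro exI[of _ \<kappa>] exI[of _ "t * \<kappa>^2"]) (simp add: Z_def)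
  qed
  moreover have "slope_at_origin (\<phi> ` \<Delta>) t"
    unfolding slope_at_origin_def img
  proof (intro allI impI)
    fix e :: real assume e: "e > 0"
    have "\<forall>\<^sub>F w in G. dist (z2 w / (z1 w)^2) t < e" using ratio e by (rule tendstoD)
    then obtain B where B: "\<And>w. norm w \<ge> B \<Longrightarrow> Re w > R \<Longrightarrow> dist (z2 w / (z1 w)^2) t < e"
      unfolding G_def eventually_inf_principal eventually_at_infinity by auto
    define d where "d = norm \<kappa> / (2 * max B 1)"
    have "d > 0" using k0 by (simp add: d_def)
    moreover have "norm (z2 w - t * (z1 w)^2) \<le> e * norm (z1 w)^2" if t: "Re w > R" and s: "norm (z1 w) < d" for w
    proof -
      have "norm \<kappa> / (2 * norm w) < norm \<kappa> / (2 * max B 1)" using low[OF t] s by (simp add: d_def)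
      then have "max B 1 < norm w" using k0 Gpos[OF t] by (simp add: divide_less_cancel frac_less2 field_simps)
      then have "norm (z2 w / (z1 w)^2 - t) < e" using B[of w] t by (simp add: dist_norm)
      moreover have "z2 w - t * (z1 w)^2 = (z2 w / (z1 w)^2 - t) * (z1 w)^2" using nz[OF t] by (simp add: field_simps)
      ultimately show ?thesis by (simp add: norm_mult norm_power mult_right_mono)
    qed
    ultimately show "\<exists>d>0. \<forall>z\<in>Z ` halfplane R. norm (fst z) < d \<longrightarrow> norm (snd z - t * (fst z)^2) \<le> e * norm (fst z)^2"
      by (intro exI[of _ d]) (auto simp: Z_def)
  qed
  ultimately show ?thesis unfolding parabolic_curve_def by blast
qed

text \<open>
  The half plane of \<open>parabolic_solution\<close> is made smaller until \<open>\<kappa> / w\<close> dominates the other terms of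
  \<open>z1\<close>, which gives the lower bound required by \<open>parabolic_curve_of_solution\<close>.
\<close>

lemma germ_parabolic_curve:
  fixes F :: "complex \<times> complex \<Rightarrow> complex \<times> complex" and a b c t :: complex
  assumes F: "End_germ U F"
    and t1: "taylor_coeff (fst \<circ> F) 1 0 = 1" "taylor_coeff (fst \<circ> F) 0 1 = 1" "taylor_coeff (fst \<circ> F) 2 0 = a"
    and t2: "taylor_coeff (snd \<circ> F) 1 0 = 0" "taylor_coeff (snd \<circ> F) 0 1 = 1" "taylor_coeff (snd \<circ> F) 2 0 = 0"
      "taylor_coeff (snd \<circ> F) 1 1 = 2 * b" "taylor_coeff (snd \<circ> F) 3 0 = c"
    and dir: "2 * b * t + c = 2 * t * (a + t)" and nondeg: "a + t \<noteq> 0"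
  shows "\<exists>\<phi>. parabolic_curve U F \<phi> \<and> tangent_to \<phi> (1, 0) \<and>
       (\<forall>z\<in>\<phi> ` \<Delta>. harmonic_decay F z) \<and>
       slope_at_origin (\<phi> ` \<Delta>) t"
proof -
  define f1 where "f1 = fst \<circ> F"
  define f2 where "f2 = snd \<circ> F"
  note t1 = t1[folded f1_def] and t2 = t2[folded f2_def]
  have h: "holomorphic2_on f1 U" "holomorphic2_on f2 U" and U0: "0 \<in> U" and F0: "F 0 = 0"
    using F by (auto simp: End_germ_def f1_def f2_def)
  have f0: "f1 (0, 0) = 0" "f2 (0, 0) = 0" using F0 by (simp_all add: f1_def f2_def zero_prod_def)
  then have t0: "taylor_coeff f1 0 0 = 0" "taylor_coeff f2 0 0 = 0" by (simp_all add: taylor_coeff_def)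
  obtain ra where ra: "ra > 0" "ball 0 ra \<times> ball 0 ra \<subseteq> U"
    "\<And>z. z \<in> ball 0 ra \<times> ball 0 ra \<Longrightarrow> norm (f1 z) \<le> norm (f1 0) + 1"
    by (rule holomorphic2_polydisc[OF h(1) U0], rule that)
  obtain rb where rb: "rb > 0" "ball 0 rb \<times> ball 0 rb \<subseteq> U"
    "\<And>z. z \<in> ball 0 rb \<times> ball 0 rb \<Longrightarrow> norm (f2 z) \<le> norm (f2 0) + 1"
    by (rule holomorphic2_polydisc[OF h(2) U0], rule that)
  define r where "r = min ra rb"
  have r: "r > 0" using ra rb by (simp add: r_def)
  have sub: "ball 0 r \<times> ball 0 r \<subseteq> U" "ball 0 r \<times> ball 0 r \<subseteq> ball 0 ra \<times> ball (0::complex) ra"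
    "ball 0 r \<times> ball 0 r \<subseteq> ball 0 rb \<times> ball (0::complex) rb"
    using ra(2) by (auto simp: r_def)
  have s1: "sep_holomorphic f1 r (norm (f1 0) + 1)"
    by (rule holomorphic2_imp_sep_holomorphic[OF h(1) r sub(1)], rule ra(3)) (use sub(2) in blast)
  have s2: "sep_holomorphic f2 r (norm (f2 0) + 1)"
    by (rule holomorphic2_imp_sep_holomorphic[OF h(2) r sub(1)], rule rb(3)) (use sub(3) in blast)
  obtain C1 where C1: "C1 \<ge> 0" "weighted_lipschitz (min 1 (r/8)) 1 C1 (\<lambda>(x, y). f1 (x, y) - x - y - a * x^2)"
    using first_component_remainder[OF s1 t0(1) t1] by blast
  obtain C2 where C2: "weighted_lipschitz (min 1 (r/8)) 2 C2 (\<lambda>(x, y). f2 (x, y) - y - 2 * b * x * y - c * x^3)"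
    using second_component_remainder[OF s2 t0(2) t2] by blast
  define C where "C = max C1 C2"
  define \<kappa> where "\<kappa> = - 1 / (a + t)"
  have k0: "\<kappa> \<noteq> 0" using nondeg by (simp add: \<kappa>_def)
  interpret parabolic_direction_holomorphic f1 f2 a b c t \<kappa> C "min 1 (r/8)" r
  proof unfold_locales
    show "f1 (0, 0) = 0" "f2 (0, 0) = 0" by (rule f0)+
    show "(\<lambda>w. f1 (z1 w, z2 w)) \<in> log_expandable" "(\<lambda>w. f2 (z1 w, z2 w)) \<in> log_expandable"
      if "z1 \<in> log_polys" "z2 \<in> log_polys" "z1 \<in> soft_O 1" "z2 \<in> soft_O 1" for z1 z2
      using sep_holomorphic_expansion[OF s1 that] sep_holomorphic_expansion[OF s2 that] by auto
    show "C \<ge> 0" using C1(1) by (simp add: C_def)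
    show "0 < min 1 (r/8)" "0 < r" using r by simp_all
    show "(a + t) * \<kappa> = - 1" using nondeg by (simp add: \<kappa>_def)
    show "2 * b * t + c = 2 * t * (a + t)" by (rule dir)
    show "weighted_lipschitz (min 1 (r/8)) 1 C (\<lambda>(x, y). f1 (x, y) - x - y - a * x^2)"
      using C1(2) by (rule weighted_lipschitz_mono) (simp add: C_def)
    show "weighted_lipschitz (min 1 (r/8)) 2 C (\<lambda>(x, y). f2 (x, y) - y - 2 * b * x * y - c * x^3)"
      using C2 by (rule weighted_lipschitz_mono) (simp add: C_def)
  next
    fix p q :: "complex \<Rightarrow> complex" and S :: "complex set"
    assume S: "open S" and pq: "p holomorphic_on S" "q holomorphic_on S"
      and b: "\<And>w. w \<in> S \<Longrightarrow> norm (p w) < r \<and> norm (q w) < r"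
    have "(p w, q w) \<in> U" if "w \<in> S" for w using sub(1) b[OF that] by (auto simp: subset_iff)
    then show "(\<lambda>w. f1 (p w, q w)) holomorphic_on S \<and> (\<lambda>w. f2 (p w, q w)) holomorphic_on S"
      using holomorphic2_compose[OF h(1) S pq] holomorphic2_compose[OF h(2) S pq] by blast
  qed
  obtain R M z1 z2 g where R: "R \<ge> 1" and z: "z1 holomorphic_on halfplane R" "z2 holomorphic_on halfplane R" and g: "g \<in> log_polys"
    and eq: "\<And>w. Re w > R \<Longrightarrow> z1 (w + 1) = f1 (z1 w, z2 w) \<and> z2 (w + 1) = f2 (z1 w, z2 w)"
    and inr: "\<And>w. Re w > R \<Longrightarrow> norm (z1 w) < r \<and> norm (z2 w) < r"
    and fine: "\<And>w. Re w > R \<Longrightarrow> norm (z1 w - \<kappa> / w - g w / w^2) \<le> 1 / norm w ^ 4"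
    and b1: "\<And>w. Re w > R \<Longrightarrow> norm (z1 w - \<kappa> / w) \<le> M * norm w powr (-(3/2))"
    and b2: "\<And>w. Re w > R \<Longrightarrow> norm (z2 w - t * \<kappa>^2 / w^2) \<le> M * norm w powr (-(5/2))"
    by (rule parabolic_solution, rule that)
  have "((\<lambda>x::real. M * x powr (-(1/2))) \<longlongrightarrow> 0) at_top" by real_asymp
  then have "\<forall>\<^sub>F x in at_top. M * x powr (-(1/2)) < norm \<kappa> / 2" by (rule order_tendstoD) (use k0 in simp)
  then obtain X where X: "\<And>x. x > X \<Longrightarrow> M * x powr (-(1/2)) < norm \<kappa> / 2" unfolding eventually_at_top_dense by auto
  define R' where "R' = max R X"
  have R': "R' \<ge> 1" "\<And>w. Re w > R' \<Longrightarrow> Re w > R" using R by (auto simp: R'_def)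
  show ?thesis
  proof (rule parabolic_curve_of_solution[OF R'(1) k0 _ _ g _ _ fine[OF R'(2)] b1[OF R'(2)] b2[OF R'(2)]])
    show "z1 holomorphic_on halfplane R'" "z2 holomorphic_on halfplane R'"
      using R'(2) by (auto intro: holomorphic_on_subset[OF z(1)] holomorphic_on_subset[OF z(2)])
    fix w assume t: "Re w > R'"
    note tR = R'(2)[OF t]
    show "F (z1 w, z2 w) = (z1 (w + 1), z2 (w + 1))" using eq[OF tR] by (simp add: f1_def f2_def)
    show "(z1 w, z2 w) \<in> U" using sub(1) inr[OF tR] by (auto simp: subset_iff)
    have n: "norm w > X" "norm w > 0" using t R complex_Re_le_cmod[of w] by (auto simp: R'_def)
    have "norm (\<kappa> / w) - norm (z1 w) \<le> norm (z1 w - \<kappa> / w)" 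
      using norm_triangle_ineq2[of "\<kappa> / w" "z1 w"] by (simp add: norm_minus_commute)
    also have "\<dots> \<le> M * norm w powr (-(3/2))" by (rule b1[OF tR])
    also have "norm w powr (-(3/2)) = norm w powr (-(1/2)) * norm w powr (- 1)" by (simp only: powr_add[symmetric]) simp
    also have "norm w powr (- 1) = 1 / norm w" using n by (simp add: powr_minus inverse_eq_divide)
    also have "M * (norm w powr (-(1/2)) * (1 / norm w)) = (M * norm w powr (-(1/2))) / norm w" by simp
    also have "\<dots> \<le> (norm \<kappa> / 2) / norm w" using X[OF n(1)] by (intro divide_right_mono) auto
    finally show "norm \<kappa> / (2 * norm w) \<le> norm (z1 w)" by (simp add: norm_divide)
  qed
qed

section \<open>Existence of parabolic curves\<close>

theorem corollary3p3:
  fixes U :: "(complex \<times> complex) set"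
    and F :: "complex \<times> complex \<Rightarrow> complex \<times> complex"
    and a11_1 a11_2 a12_2 a111_2 \<epsilon> \<eta> :: complex
  assumes "End_germ U F"
    and "\<not> diagonalizable_mat (dF_mat F)"
    and "spectrum (dF_mat F) = {1}"
    and "in_jordan_form (dF_mat F)"
    and "a11_1 = taylor_coeff (fst \<circ> F) 2 0"
    and "a11_2 = taylor_coeff (snd \<circ> F) 2 0"
    and "2 * a12_2 = taylor_coeff (snd \<circ> F) 1 1"
    and "a111_2 = taylor_coeff (snd \<circ> F) 3 0"
    and "a11_2 = 0"
    and "\<epsilon> = a11_1 + a12_2"
    and "\<eta> = (a11_1 - a12_2)\<^sup>2 + 2 * a111_2"
    and "(\<epsilon>, \<eta>) \<noteq> (0, 0)"
  shows
    "(\<eta> \<noteq> 0 \<and> \<eta> \<noteq> \<epsilon>\<^sup>2 \<longrightarrow>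
        (\<exists>\<phi>\<^sub>1 \<phi>\<^sub>2. distinct_curves \<phi>\<^sub>1 \<phi>\<^sub>2 \<and>
          (\<forall>\<phi>\<in>{\<phi>\<^sub>1, \<phi>\<^sub>2}. parabolic_curve U F \<phi> \<and> tangent_to \<phi> (1, 0) \<and>
            (\<forall>z\<in>\<phi> ` \<Delta>. \<exists>c1 c2. c1 \<noteq> 0 \<and>
              (\<lambda>k. fst ((F ^^ k) z) - c1 / of_nat k) \<in> o(\<lambda>k. 1 / of_nat k) \<and>
              (\<lambda>k. snd ((F ^^ k) z) - c2 / (of_nat k)\<^sup>2) \<in> o(\<lambda>k. 1 / (of_nat k)\<^sup>2))))) \<and>
     (\<eta> = \<epsilon>\<^sup>2 \<and> \<epsilon>\<^sup>2 \<noteq> 0 \<or> \<eta> = 0 \<and> \<epsilon>\<^sup>2 \<noteq> 0 \<longrightarrow>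
        (\<exists>\<phi>. parabolic_curve U F \<phi> \<and> tangent_to \<phi> (1, 0) \<and>
            (\<forall>z\<in>\<phi> ` \<Delta>. \<exists>c1 c2. c1 \<noteq> 0 \<and>
              (\<lambda>k. fst ((F ^^ k) z) - c1 / of_nat k) \<in> o(\<lambda>k. 1 / of_nat k) \<and>
              (\<lambda>k. snd ((F ^^ k) z) - c2 / (of_nat k)\<^sup>2) \<in> o(\<lambda>k. 1 / (of_nat k)\<^sup>2))))"
proof -
  have h: "holomorphic2_on (fst \<circ> F) U" "holomorphic2_on (snd \<circ> F) U" and U0: "0 \<in> U"
    using assms(1) by (auto simp: End_germ_def)
  obtain p q where d1: "(fst \<circ> F has_derivative (\<lambda>h. p * fst h + q * snd h)) (at 0)"
    using h(1) U0 unfolding holomorphic2_on_def by blast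
  obtain r s where d2: "(snd \<circ> F has_derivative (\<lambda>h. r * fst h + s * snd h)) (at 0)"
    using h(2) U0 unfolding holomorphic2_on_def by blast
  have "((\<lambda>z. ((fst \<circ> F) z, (snd \<circ> F) z)) has_derivative (\<lambda>h. (p * fst h + q * snd h, r * fst h + s * snd h))) (at 0)"
    using d1 d2 by (rule has_derivative_Pair)
  then have "(F has_derivative (\<lambda>h. (p * fst h + q * snd h, r * fst h + s * snd h))) (at 0)" by simp
  from frechet_derivative_at[OF this, symmetric]
  have dF: "dF_mat F = mat_of_rows_list 2 [[p, q], [r, s]]" by (simp add: dF_mat_def Let_def)
  have pqrs: "p = 1 \<and> q = 1 \<and> r = 0 \<and> s = 1"
    by (rule nondiagonal_jordan_2x2) (use assms(2-4) in \<open>simp_all add: dF\<close>)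
  note lin1 = taylor_coeff_linear[OF d1] and lin2 = taylor_coeff_linear[OF d2]
  have curve: "\<exists>\<phi>. parabolic_curve U F \<phi> \<and> tangent_to \<phi> (1, 0) \<and>
       (\<forall>z\<in>\<phi> ` \<Delta>. harmonic_decay F z) \<and>
       slope_at_origin (\<phi> ` \<Delta>) ((a12_2 - a11_1 + \<sigma>) / 2)"
    if \<sigma>: "\<sigma>^2 = \<eta>" and nd: "\<epsilon> + \<sigma> \<noteq> 0" for \<sigma>
  proof (rule germ_parabolic_curve[OF assms(1)])
    show "taylor_coeff (fst \<circ> F) 1 0 = 1" "taylor_coeff (fst \<circ> F) 0 1 = 1"
      "taylor_coeff (snd \<circ> F) 1 0 = 0" "taylor_coeff (snd \<circ> F) 0 1 = 1"
      using lin1 lin2 pqrs by simp_all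
    show "taylor_coeff (fst \<circ> F) 2 0 = a11_1" "taylor_coeff (snd \<circ> F) 2 0 = 0"
      "taylor_coeff (snd \<circ> F) 1 1 = 2 * a12_2" "taylor_coeff (snd \<circ> F) 3 0 = a111_2"
      using assms(5-9) by simp_all
    have s2: "\<sigma> * \<sigma> = (a11_1 - a12_2) * (a11_1 - a12_2) + 2 * a111_2"
      using \<sigma> assms(11) by (simp add: power2_eq_square)
    define t where "t = (a12_2 - a11_1 + \<sigma>) / 2"
    have \<sigma>t: "\<sigma> = 2 * t + a11_1 - a12_2" by (simp add: t_def field_simps)
    have "2 * (2 * a12_2 * t + a111_2) = 2 * (2 * t * (a11_1 + t))"
      using s2 unfolding \<sigma>t by (simp add: algebra_simps)
    then have "2 * a12_2 * t + a111_2 = 2 * t * (a11_1 + t)"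
      unfolding mult_cancel_left by simp
    then show "2 * a12_2 * ((a12_2 - a11_1 + \<sigma>) / 2) + a111_2 =
      2 * ((a12_2 - a11_1 + \<sigma>) / 2) * (a11_1 + (a12_2 - a11_1 + \<sigma>) / 2)"
      unfolding t_def .
    have e: "a11_1 + (a12_2 - a11_1 + \<sigma>) / 2 = (\<epsilon> + \<sigma>) / 2" using assms(10) by (simp add: field_simps)
    show "a11_1 + (a12_2 - a11_1 + \<sigma>) / 2 \<noteq> 0" unfolding e using nd by simp
  qed
  show ?thesis
    unfolding harmonic_decay_def[symmetric]
  proof (intro conjI impI)
    assume \<eta>: "\<eta> \<noteq> 0 \<and> \<eta> \<noteq> \<epsilon>\<^sup>2"
    define \<sigma> where "\<sigma> = csqrt \<eta>"
    have \<sigma>: "\<sigma>^2 = \<eta>" "(- \<sigma>)^2 = \<eta>" by (simp_all add: \<sigma>_def)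
    have nd: "\<epsilon> + \<sigma> \<noteq> 0" "\<epsilon> + - \<sigma> \<noteq> 0"
      using \<eta> \<sigma> by (auto simp: add_eq_0_iff2)
    obtain \<phi> where p: "parabolic_curve U F \<phi>" "tangent_to \<phi> (1, 0)"
       "\<forall>z\<in>\<phi> ` \<Delta>. harmonic_decay F z"
       "slope_at_origin (\<phi> ` \<Delta>) ((a12_2 - a11_1 + \<sigma>) / 2)"
      using curve[OF \<sigma>(1) nd(1)] by blast
    obtain \<psi> where q: "parabolic_curve U F \<psi>" "tangent_to \<psi> (1, 0)"
       "\<forall>z\<in>\<psi> ` \<Delta>. harmonic_decay F z"
       "slope_at_origin (\<psi> ` \<Delta>) ((a12_2 - a11_1 + - \<sigma>) / 2)"
      using curve[OF \<sigma>(2) nd(2)] by blast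
    have "\<sigma> \<noteq> 0" using \<sigma>(1) \<eta> by auto
    then have "(a12_2 - a11_1 + \<sigma>) / 2 \<noteq> (a12_2 - a11_1 + - \<sigma>) / 2" by (simp add: eq_neg_iff_add_eq_0)
    then have "distinct_curves \<phi> \<psi>" by (rule distinct_curves_of_slopes[OF p(4) q(4)])
    then show "\<exists>\<phi>\<^sub>1 \<phi>\<^sub>2. distinct_curves \<phi>\<^sub>1 \<phi>\<^sub>2 \<and>
          (\<forall>\<phi>\<in>{\<phi>\<^sub>1, \<phi>\<^sub>2}. parabolic_curve U F \<phi> \<and> tangent_to \<phi> (1, 0) \<and>
            (\<forall>z\<in>\<phi> ` \<Delta>. harmonic_decay F z))"
      using p(1-3) q(1-3) by (intro exI[of _ \<phi>] exI[of _ \<psi>]) simp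
  next
    assume "\<eta> = \<epsilon>\<^sup>2 \<and> \<epsilon>\<^sup>2 \<noteq> 0 \<or> \<eta> = 0 \<and> \<epsilon>\<^sup>2 \<noteq> 0"
    then obtain \<sigma> where "\<sigma>^2 = \<eta>" "\<epsilon> + \<sigma> \<noteq> 0"
    proof
      assume e: "\<eta> = \<epsilon>\<^sup>2 \<and> \<epsilon>\<^sup>2 \<noteq> 0"
      show thesis by (rule that[of \<epsilon>]) (use e in auto)
    next
      assume e: "\<eta> = 0 \<and> \<epsilon>\<^sup>2 \<noteq> 0"
      show thesis by (rule that[of 0]) (use e in auto)
    qed
    from curve[OF this] show "\<exists>\<phi>. parabolic_curve U F \<phi> \<and> tangent_to \<phi> (1, 0) \<and>
            (\<forall>z\<in>\<phi> ` \<Delta>. harmonic_decay F z)"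
      by blast
  qed
qed

end
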